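(* Let $\mathcal D$ be a link diagram, fix one of its crossings, and let $\mathcal D_0$ and $\mathcal D_1$ be the diagrams obtained from $\mathcal D$ by replacing this crossing by its $0$-resolution and its $1$-resolution respectively. Then there is a long exact sequence of odd Khovanov homology groups $$\cdots\longrightarrow \mathrm{Kh}'(\mathcal D_1)\xrightarrow{\,i_*\,}\mathrm{Kh}'(\mathcal D)\xrightarrow{\,\pi_*\,}\mathrm{Kh}'(\mathcal D_0)\xrightarrow{\,\partial\,}\mathrm{Kh}'(\mathcal D_1)\longrightarrow\cdots .$$
   Context: Here $\mathrm{Kh}'$ of a diagram denotes the total homology of the complex $(C,\partial_\epsilon)$ defined below (bigradings are not tracked in the statement; as an ungraded group it does not depend on orientations of the links). Resolutions and arrows. Let $\mathcal D$ be a planar link diagram with set of crossings $\mathcal X$. Near a crossing, drawn so that the over-strand runs from upper left to lower right, the $0$-resolution joins the two upper ends by an arc and the two lower ends by an arc, and the $1$-resolution joins the two left ends and the two right ends. At each crossing $x$ let $\gamma_x$ be a short arc at $x$ joining the two strands of the $0$-resolution; surgery along $\gamma_x$ turns the $0$-resolution into the $1$-resolution. Choose an orientation (arrow) on each $\gamma_x$. Rotating the arrow $90^\circ$ counterclockwise gives an oriented arc $\gamma_x^*$ joining the two strands of the $1$-resolution at $x$. Hypercube. Vertices are maps $I:\mathcal X\to\{0,1\}$; $\mathcal D(I)$ is the collection of disjoint planar circles obtained by resolving each $x$ according to $I(x)$. There is an edge $e$ from $I_0$ to $I_1$ if they agree except at one crossing $x$, where $I_0(x)=0$, $I_1(x)=1$.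 $V(\mathcal D(I))$ is the free abelian group on the circles of $\mathcal D(I)$. The map $F_e:\Lambda^*V(\mathcal D(I_0))\to\Lambda^*V(\mathcal D(I_1))$ is: (merge) if circles $a_1,a_2$ of $\mathcal D(I_0)$ are joined, $F_e$ is induced by $V(\mathcal D(I_0))\to V(\mathcal D(I_0))/(a_1-a_2)\cong V(\mathcal D(I_1))$; (split) if a circle divides into $a_1,a_2$, with $\gamma_x^*$ pointing from $a_1$ to $a_2$, then $F_e(v)=(a_1-a_2)\wedge\tilde v$, where $\tilde v$ is any lift of $v$ under $\Lambda^*V(\mathcal D(I_1))\to\Lambda^*(V(\mathcal D(I_1))/(a_1-a_2))\cong\Lambda^*V(\mathcal D(I_0))$. Types of squares. A square face is given by a vertex $I_{00}$ and crossings $x_1,x_2$ with $I_{00}(x_1)=I_{00}(x_2)=0$. If the two composites of edge maps around the square are nonzero, they agree up to sign; the square is of type $C$ if they are equal, type $A$ if they are negatives. They are both zero exactly when $\gamma_{x_1},\gamma_{x_2}$ have all endpoints on one circle of $\mathcal D(I_{00})$ and these interleave; then one arc lies inside the circle and the other outside. Traverse the circle counterclockwise from the tail of the inside arc: the square is of type $X$ if the next endpoint met is the tail of the outside arc, type $Y$ if it is the head. Edge assignments. Maps $\epsilon:\{\text{edges}\}\to\{\pm1\}$; a square is even (odd) if it has an even (odd) number of edges with $\epsilon=-1$. Type $X$: squares of types $A,X$ are even and of types $C,Y$ odd. Type $Y$: squares of types $A,Y$ are even and of types $C,X$ odd. Complex. $C(\mathcal D)=\bigoplus_I\Lambda^*V(\mathcal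 D(I))$, $\partial_\epsilon(v)=\sum_e\epsilon(e)F_e(v)$ over edges $e$ starting at $I$, for $v\in\Lambda^*V(\mathcal D(I))$, with $\epsilon$ of type $X$ or $Y$. $\mathrm{Kh}'(\mathcal D)$ is the homology of $(C(\mathcal D),\partial_\epsilon)$; up to isomorphism it is independent of arrows and $\epsilon$. *)

theory Defs
  imports
    "HOL-Library.Product_Plus"
    "HOL-Algebra.Exact_Sequence"
    "HOL-Algebra.Free_Abelian_Groups"
begin

section \<open>The exterior algebra of a free abelian group\<close>

text \<open>
  With concatenation as addition of words, \<open>'a list \<Rightarrow>\<^sub>0 int\<close> is the
  tensor algebra over the integers of the free abelian group on \<open>'a\<close>.
\<close>

instantiation list :: (type) monoid_add
begin

definition zero_list :: "'a list" where "zero_list = []"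

definition plus_list :: "'a list \<Rightarrow> 'a list \<Rightarrow> 'a list" where "plus_list = (@)"

instance
  by standard (simp_all add: zero_list_def plus_list_def)

end

definition degree_one :: "('a list \<Rightarrow>\<^sub>0 int) set"
  where "degree_one = {v. Poly_Mapping.keys v \<subseteq> range (\<lambda>a. [a])}"

text \<open>The two-sided ideal generated by the squares \<open>v \<otimes> v\<close>.\<close>

inductive_set square_ideal :: "('a list \<Rightarrow>\<^sub>0 int) set" where
  zero: "0 \<in> square_ideal"
| square: "v \<in> degree_one \<Longrightarrow> p * (v * v) * q \<in> square_ideal"
| add: "s \<in> square_ideal \<Longrightarrow> t \<in> square_ideal \<Longrightarrow> s + t \<in> square_ideal"

lemma square_ideal_mult_left: "s \<in> square_ideal \<Longrightarrow> r * s \<in> square_ideal"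
proof (induction rule: square_ideal.induct)
  case (square v p q)
  then have "(r * p) * (v * v) * q \<in> square_ideal"
    by (rule square_ideal.square)
  then show ?case by (simp add: mult.assoc)
qed (simp_all add: square_ideal.intros distrib_left)

lemma square_ideal_mult_right: "s \<in> square_ideal \<Longrightarrow> s * r \<in> square_ideal"
proof (induction rule: square_ideal.induct)
  case (square v p q)
  then have "p * (v * v) * (q * r) \<in> square_ideal"
    by (rule square_ideal.square)
  then show ?case by (simp add: mult.assoc)
qed (simp_all add: square_ideal.intros distrib_right)

lemma square_ideal_minus: "s \<in> square_ideal \<Longrightarrow> - s \<in> square_ideal"
  using square_ideal_mult_left[of s "- 1"] by simp

lemma square_ideal_diff:
  "s \<in> square_ideal \<Longrightarrow> t \<in> square_ideal \<Longrightarrow> s - t \<in> square_ideal"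
  using square_ideal.add[OF _ square_ideal_minus, of s t] by simp

quotient_type 'a exterior = "'a list \<Rightarrow>\<^sub>0 int" / "\<lambda>p q. p - q \<in> square_ideal"
proof (rule equivpI)
  show "reflp (\<lambda>p q :: 'a list \<Rightarrow>\<^sub>0 int. p - q \<in> square_ideal)"
    by (simp add: reflp_def square_ideal.zero)
  show "symp (\<lambda>p q :: 'a list \<Rightarrow>\<^sub>0 int. p - q \<in> square_ideal)"
    unfolding symp_def using square_ideal_minus by fastforce
  show "transp (\<lambda>p q :: 'a list \<Rightarrow>\<^sub>0 int. p - q \<in> square_ideal)"
    unfolding transp_def using square_ideal.add by fastforce
qed

lemma lookup_times_Nil:
  fixes p q :: "'a list \<Rightarrow>\<^sub>0 int"
  shows "Poly_Mapping.lookup (p * q) [] = Poly_Mapping.lookup p [] * Poly_Mapping.lookup q []"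
proof -
  have sngl: "(\<Sum>b. Poly_Mapping.lookup q b when (x::'a list) = b) = Poly_Mapping.lookup q x" for x
    by simp
  have "Poly_Mapping.lookup (p * q) [] =
      (\<Sum>a. Poly_Mapping.lookup p a * (\<Sum>b. Poly_Mapping.lookup q b when [] = a + b))"
    by (simp add: lookup_mult)
  also have "\<dots> = (\<Sum>a. (Poly_Mapping.lookup p a * Poly_Mapping.lookup q []) when a = [])"
  proof (rule Sum_any.cong)
    fix a :: "'a list"
    show "Poly_Mapping.lookup p a * (\<Sum>b. Poly_Mapping.lookup q b when [] = a + b)
        = (Poly_Mapping.lookup p a * Poly_Mapping.lookup q [] when a = [])"
      by (cases "a = []") (simp_all add: plus_list_def)
  qed
  also have "\<dots> = Poly_Mapping.lookup p [] * Poly_Mapping.lookup q []"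
    by simp
  finally show ?thesis .
qed

lemma lookup_square_ideal_Nil: "s \<in> square_ideal \<Longrightarrow> Poly_Mapping.lookup s [] = 0"
proof (induction rule: square_ideal.induct)
  case (square v p q)
  then have "[] \<notin> Poly_Mapping.keys v"
    by (auto simp: degree_one_def)
  then show ?case by (simp add: lookup_times_Nil in_keys_iff)
qed (simp_all add: lookup_add)

instantiation exterior :: (type) ring_1
begin

lift_definition zero_exterior :: "'a exterior" is 0 .

lift_definition one_exterior :: "'a exterior" is 1 .

lift_definition plus_exterior :: "'a exterior \<Rightarrow> 'a exterior \<Rightarrow> 'a exterior" is "(+)"
proof -
  fix p p' q q' :: "'a list \<Rightarrow>\<^sub>0 int"
  assume "p - p' \<in> square_ideal" "q - q' \<in> square_ideal"
  then have "(p - p') + (q - q') \<in> square_ideal" by (rule square_ideal.add)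
  then show "(p + q) - (p' + q') \<in> square_ideal" by (simp add: algebra_simps)
qed

lift_definition uminus_exterior :: "'a exterior \<Rightarrow> 'a exterior" is uminus
  using square_ideal_minus by fastforce

lift_definition minus_exterior :: "'a exterior \<Rightarrow> 'a exterior \<Rightarrow> 'a exterior" is "(-)"
proof -
  fix p p' q q' :: "'a list \<Rightarrow>\<^sub>0 int"
  assume "p - p' \<in> square_ideal" "q - q' \<in> square_ideal"
  then have "(p - p') - (q - q') \<in> square_ideal" by (rule square_ideal_diff)
  then show "(p - q) - (p' - q') \<in> square_ideal" by (simp add: algebra_simps)
qed

text \<open>Multiplication is the wedge product.\<close>

lift_definition times_exterior :: "'a exterior \<Rightarrow> 'a exterior \<Rightarrow> 'a exterior" is "(*)"
proof -
  fix p p' q q' :: "'a list \<Rightarrow>\<^sub>0 int"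
  assume "p - p' \<in> square_ideal" "q - q' \<in> square_ideal"
  then have "(p - p') * q + p' * (q - q') \<in> square_ideal"
    by (intro square_ideal.add square_ideal_mult_left square_ideal_mult_right)
  then show "p * q - p' * q' \<in> square_ideal" by (simp add: algebra_simps)
qed

instance
proof
  show "(0 :: 'a exterior) \<noteq> 1"
  proof transfer
    show "(0 :: 'a list \<Rightarrow>\<^sub>0 int) - 1 \<notin> square_ideal"
      using lookup_square_ideal_Nil[of "0 - 1"]
      by (auto simp: lookup_minus lookup_one zero_list_def)
  qed
qed (transfer; simp add: square_ideal.zero algebra_simps)+

end

lift_definition gen :: "'a \<Rightarrow> 'a exterior" is "\<lambda>a. frag_of [a]" .

text \<open>
  The exterior algebra of the free abelian group on \<open>S\<close>, realised inside the exterior algebra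
  of the free abelian group on the whole type.
\<close>

definition exterior_on :: "'a set \<Rightarrow> 'a exterior set"
  where "exterior_on S = abs_exterior ` {p. Poly_Mapping.keys p \<subseteq> lists S}"

definition tensor_map :: "('a \<Rightarrow> 'b) \<Rightarrow> ('a list \<Rightarrow>\<^sub>0 int) \<Rightarrow> ('b list \<Rightarrow>\<^sub>0 int)"
  where "tensor_map f = frag_extend (\<lambda>w. frag_of (map f w))"

lemma tensor_map_add: "tensor_map f (p + q) = tensor_map f p + tensor_map f q"
  by (simp add: tensor_map_def frag_extend_add)

lemma tensor_map_diff: "tensor_map f (p - q) = tensor_map f p - tensor_map f q"
  by (simp add: tensor_map_def frag_extend_diff)

lemma frag_of_mult: "(frag_of u :: 'a list \<Rightarrow>\<^sub>0 int) * frag_of w = frag_of (u @ w)"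
  by (simp add: mult_single plus_list_def)

lemma tensor_map_mult: "tensor_map f (p * q) = tensor_map f p * tensor_map f q"
proof (rule frag_induction[of p UNIV])
  fix u
  show "tensor_map f (frag_of u * q) = tensor_map f (frag_of u) * tensor_map f q"
    by (rule frag_induction[of q UNIV])
      (simp_all add: frag_of_mult tensor_map_def frag_extend_diff right_diff_distrib)
qed (simp_all add: tensor_map_diff left_diff_distrib, simp add: tensor_map_def)

lemma tensor_map_square_ideal:
  "s \<in> square_ideal \<Longrightarrow> tensor_map f s \<in> square_ideal"
proof (induction rule: square_ideal.induct)
  case zero
  show ?case by (simp add: tensor_map_def square_ideal.zero)
next
  case (square v p q)
  have "Poly_Mapping.keys (tensor_map f v) \<subseteq> (\<lambda>w. map f w) ` Poly_Mapping.keys v"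
    unfolding tensor_map_def by (rule order_trans[OF keys_frag_extend]) auto
  then have "tensor_map f v \<in> degree_one"
    using square by (fastforce simp: degree_one_def)
  then show ?case
    by (simp add: tensor_map_mult square_ideal.square)
qed (simp add: tensor_map_add square_ideal.add)

lift_definition exterior_map :: "('a \<Rightarrow> 'b) \<Rightarrow> 'a exterior \<Rightarrow> 'b exterior" is tensor_map
  by (metis tensor_map_diff tensor_map_square_ideal)


section \<open>Planar link diagrams\<close>

text \<open>
  Every planar link diagram is planar isotopic to a mosaic diagram (Lomonaco and Kauffman): the
  plane is cut into unit squares, all but finitely many of them blank, and each square carries
  one of eleven tiles.  Blank squares carry nothing, arcs join the midpoints of two adjacent sides,
  lines the midpoints of two opposite sides, and \<open>CrossH\<close> and \<open>CrossV\<close> are the two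
  crossings, with the horizontal, respectively vertical, strand on top.
\<close>

datatype side = East | North | West | South

datatype tile =
  Blank | Arc_NE | Arc_NW | Arc_SW | Arc_SE | Line_H | Line_V
  | Arcs_NW_SE | Arcs_NE_SW | CrossH | CrossV

fun strands :: "tile \<Rightarrow> side set set" where
  "strands Blank = {}"
| "strands Arc_NE = {{North, East}}"
| "strands Arc_NW = {{North, West}}"
| "strands Arc_SW = {{South, West}}"
| "strands Arc_SE = {{South, East}}"
| "strands Line_H = {{West, East}}"
| "strands Line_V = {{North, South}}"
| "strands Arcs_NW_SE = {{North, West}, {South, East}}"
| "strands Arcs_NE_SW = {{North, East}, {South, West}}"
| "strands CrossH = {{West, East}, {North, South}}"
| "strands CrossV = {{West, East}, {North, South}}"

text \<open>
  The over-strand of \<open>CrossH\<close> becomes one from upper left to lower right after a clockwise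
  rotation by 45 degrees, which takes West and North to the two upper ends.  For \<open>CrossV\<close>
  rotate counterclockwise: North and East become the upper ends.
\<close>

fun smoothing :: "nat \<Rightarrow> tile \<Rightarrow> tile" where
  "smoothing i CrossH = (if i = 0 then Arcs_NW_SE else Arcs_NE_SW)"
| "smoothing i CrossV = (if i = 0 then Arcs_NE_SW else Arcs_NW_SE)"
| "smoothing i t = t"

text \<open>Rotation by 90 degrees counterclockwise.\<close>

fun rot :: "side \<Rightarrow> side" where
  "rot East = North"
| "rot North = West"
| "rot West = South"
| "rot South = East"

definition opposite :: "side \<Rightarrow> side"
  where "opposite d = rot (rot d)"

fun vec :: "side \<Rightarrow> int \<times> int" where
  "vec East = (1, 0)"
| "vec North = (0, 1)"
| "vec West = (- 1, 0)"
| "vec South = (0, - 1)"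

text \<open>
  The square with index \<open>c\<close> has side length 2 and centre \<open>c + c\<close>.  So
  the midpoint of its side \<open>d\<close> is the same point as that of the opposite side of the
  neighbour \<open>c + vec d\<close>.
\<close>

type_synonym square = "int \<times> int"
type_synonym point = "int \<times> int"
type_synonym diagram = "square \<Rightarrow> tile"

definition midpoint :: "square \<Rightarrow> side \<Rightarrow> point"
  where "midpoint c d = c + c + vec d"

definition link_diagram :: "diagram \<Rightarrow> bool"
  where "link_diagram D \<longleftrightarrow>
    finite {c. D c \<noteq> Blank} \<and>
    (\<forall>c d. d \<in> \<Union> (strands (D c)) \<longleftrightarrow> opposite d \<in> \<Union> (strands (D (c + vec d))))"

definition crossings :: "diagram \<Rightarrow> square set"
  where "crossings D = {c. D c \<in> {CrossH, CrossV}}"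

text \<open>The diagram with the crossing \<open>x\<close> replaced by its \<open>i\<close>-resolution.\<close>

definition replace_crossing :: "diagram \<Rightarrow> square \<Rightarrow> nat \<Rightarrow> diagram"
  where "replace_crossing D x i = D(x := smoothing i (D x))"


section \<open>Resolutions, circles and arrows\<close>

definition vertices :: "diagram \<Rightarrow> (square \<Rightarrow> nat) set"
  where "vertices D = crossings D \<rightarrow>\<^sub>E {0, 1}"

definition resolution :: "diagram \<Rightarrow> (square \<Rightarrow> nat) \<Rightarrow> diagram"
  where "resolution D I = (\<lambda>c. if c \<in> crossings D then smoothing (I c) (D c) else D c)"

text \<open>A circle is represented by the set of the midpoints of sides through which it passes.\<close>

type_synonym circle = "point set"

definition joined :: "diagram \<Rightarrow> (point \<times> point) set"
  where "joined M = {(midpoint c d, midpoint c d') | c d d'. {d, d'} \<in> strands (M c)}"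

definition circles :: "diagram \<Rightarrow> circle set"
  where "circles M = (\<lambda>p. (joined M)\<^sup>* `` {p}) ` Field (joined M)"

definition circle_through :: "diagram \<Rightarrow> square \<Rightarrow> side set \<Rightarrow> circle"
  where "circle_through M c s = (joined M)\<^sup>* `` (midpoint c ` s)"

text \<open>
  The arrow on the arc at a crossing \<open>x\<close> is given by the strand \<open>arr x\<close> of the
  0-resolution at its tail; its head is on the other strand \<open>- arr x\<close>.  The arc rotated
  by 90 degrees counterclockwise has its tail on the strand \<open>rot ` arr x\<close> of the
  1-resolution and its head on the strand \<open>- (rot ` arr x)\<close>.
\<close>

type_synonym arrows = "square \<Rightarrow> side set"

definition arrow_choice :: "diagram \<Rightarrow> arrows \<Rightarrow> bool"
  where "arrow_choice D arr \<longleftrightarrow> (\<forall>x \<in> crossings D. arr x \<in> strands (smoothing 0 (D x)))"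


section \<open>The hypercube\<close>

type_synonym edge = "(square \<Rightarrow> nat) \<times> square"

text \<open>The edge from \<open>I\<close> to \<open>I(x := 1)\<close> is the pair \<open>(I, x)\<close>.\<close>

definition edges :: "diagram \<Rightarrow> edge set"
  where "edges D = {(I, x). I \<in> vertices D \<and> x \<in> crossings D \<and> I x = 0}"

definition state_space :: "diagram \<Rightarrow> (square \<Rightarrow> nat) \<Rightarrow> circle exterior set"
  where "state_space D I = exterior_on (circles (resolution D I))"

text \<open>
  The strands at the tail and head of the arrow at \<open>x\<close> lie on \<open>a\<^sub>1\<close> and
  \<open>a\<^sub>2\<close> before the surgery; those of the rotated arrow lie on \<open>b\<^sub>1\<close> and
  \<open>b\<^sub>2\<close> after it.  If \<open>a\<^sub>1\<close> and \<open>a\<^sub>2\<close> are distinct, they merge into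
  \<open>b\<^sub>1 = b\<^sub>2\<close>; otherwise \<open>a\<^sub>1 = a\<^sub>2\<close> splits into \<open>b\<^sub>1\<close> and \<open>b\<^sub>2\<close>.  All other
  circles are equal as sets before and after.
\<close>

definition edge_map ::
    "diagram \<Rightarrow> arrows \<Rightarrow> edge \<Rightarrow> circle exterior \<Rightarrow> circle exterior"
  where "edge_map D arr e v =
    (let I = fst e; x = snd e;
         M\<^sub>0 = resolution D I; M\<^sub>1 = resolution D (I(x := 1));
         a\<^sub>1 = circle_through M\<^sub>0 x (arr x); a\<^sub>2 = circle_through M\<^sub>0 x (- arr x);
         b\<^sub>1 = circle_through M\<^sub>1 x (rot ` arr x); b\<^sub>2 = circle_through M\<^sub>1 x (- (rot ` arr x))
     in if a\<^sub>1 \<noteq> a\<^sub>2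
        then exterior_map (\<lambda>a. if a \<in> {a\<^sub>1, a\<^sub>2} then b\<^sub>1 else a) v
        else (gen b\<^sub>1 - gen b\<^sub>2) *
             (SOME w. w \<in> state_space D (I(x := 1)) \<and>
                      exterior_map (\<lambda>b. if b \<in> {b\<^sub>1, b\<^sub>2} then a\<^sub>1 else b) w = v))"


section \<open>Types of squares\<close>

definition squares :: "diagram \<Rightarrow> ((square \<Rightarrow> nat) \<times> square \<times> square) set"
  where "squares D = {(I, x, y). I \<in> vertices D \<and> x \<in> crossings D \<and> y \<in> crossings D \<and>
                                 x \<noteq> y \<and> I x = 0 \<and> I y = 0}"

definition composite ::
    "diagram \<Rightarrow> arrows \<Rightarrow> (square \<Rightarrow> nat) \<Rightarrow> square \<Rightarrow> square \<Rightarrow> circle exterior \<Rightarrow> circle exterior"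
  where "composite D arr I x y v = edge_map D arr (I(x := 1), y) (edge_map D arr (I, x) v)"

definition composites_nonzero ::
    "diagram \<Rightarrow> arrows \<Rightarrow> (square \<Rightarrow> nat) \<Rightarrow> square \<Rightarrow> square \<Rightarrow> bool"
  where "composites_nonzero D arr I x y \<longleftrightarrow>
    (\<exists>v \<in> state_space D I. composite D arr I x y v \<noteq> 0) \<and>
    (\<exists>v \<in> state_space D I. composite D arr I y x v \<noteq> 0)"

definition type_A :: "diagram \<Rightarrow> arrows \<Rightarrow> (square \<Rightarrow> nat) \<Rightarrow> square \<Rightarrow> square \<Rightarrow> bool"
  where "type_A D arr I x y \<longleftrightarrow> composites_nonzero D arr I x y \<and>
    (\<forall>v \<in> state_space D I. composite D arr I x y v = - composite D arr I y x v)"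

definition type_C :: "diagram \<Rightarrow> arrows \<Rightarrow> (square \<Rightarrow> nat) \<Rightarrow> square \<Rightarrow> square \<Rightarrow> bool"
  where "type_C D arr I x y \<longleftrightarrow> composites_nonzero D arr I x y \<and>
    (\<forall>v \<in> state_space D I. composite D arr I x y v = composite D arr I y x v)"

text \<open>
  The even-odd rule for a corner \<open>p\<close> of some square (a point with both coordinates odd): the
  vertical ray upwards from \<open>p\<close> crosses the circle exactly at the points of \<open>a\<close> on it.
\<close>

definition inside :: "circle \<Rightarrow> point \<Rightarrow> bool"
  where "inside a p \<longleftrightarrow> odd (card {y. snd p < y \<and> (fst p, y) \<in> a})"

text \<open>
  In the 0-resolution of \<open>x\<close>, the corner between the two sides in \<open>rot ` arr x\<close> is not
  separated from the arc at \<open>x\<close> by a strand.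
\<close>

definition arc_inside :: "circle \<Rightarrow> arrows \<Rightarrow> square \<Rightarrow> bool"
  where "arc_inside a arr x \<longleftrightarrow> inside a (x + x + (\<Sum>d \<in> rot ` arr x. vec d))"

text \<open>
  Traversing a resolution: the state \<open>(c, d)\<close> enters the square \<open>c\<close> through its side
  \<open>d\<close>.  The direction of motion is then \<open>opposite d\<close>, and the state is counterclockwise
  on the circle \<open>a\<close> if the corner just to the left of the entrance is inside \<open>a\<close>.
\<close>

definition partner :: "tile \<Rightarrow> side \<Rightarrow> side"
  where "partner t d = (THE d'. d' \<noteq> d \<and> {d, d'} \<in> strands t)"

definition next_state :: "diagram \<Rightarrow> square \<times> side \<Rightarrow> square \<times> side"
  where "next_state M = (\<lambda>(c, d). let d' = partner (M c) d in (c + vec d', opposite d'))"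

definition counterclockwise :: "circle \<Rightarrow> square \<times> side \<Rightarrow> bool"
  where "counterclockwise a = (\<lambda>(c, d). inside a (midpoint c d + vec (rot (opposite d))))"

text \<open>The time at which the strand \<open>s\<close> in the square \<open>c\<close> is first met after the start.\<close>

definition meeting_time ::
    "diagram \<Rightarrow> square \<times> side \<Rightarrow> square \<Rightarrow> side set \<Rightarrow> nat"
  where "meeting_time M start c s =
    (LEAST n. 0 < n \<and> (next_state M ^^ n) start \<in> {c} \<times> s)"

text \<open>
  All four endpoints of the arcs at \<open>x\<close> and \<open>y\<close> are on one circle, the arc at \<open>x\<close> is
  inside and the arc at \<open>y\<close> outside, and going counterclockwise from the tail of the inside arc
  one meets the strand \<open>s\<close> of \<open>y\<close>, then the head of the inside arc, then the other
  strand of \<open>y\<close>.  So the endpoints interleave, and the next one met is the one on \<open>s\<close>.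
\<close>

definition interleaved_via ::
    "diagram \<Rightarrow> arrows \<Rightarrow> (square \<Rightarrow> nat) \<Rightarrow> square \<Rightarrow> square \<Rightarrow> side set \<Rightarrow> bool"
  where "interleaved_via D arr I x y s \<longleftrightarrow>
    (let M = resolution D I; a = circle_through M x (arr x) in
       circle_through M x (- arr x) = a \<and>
       circle_through M y (arr y) = a \<and> circle_through M y (- arr y) = a \<and>
       arc_inside a arr x \<and> \<not> arc_inside a arr y \<and>
       (\<exists>d \<in> arr x. counterclockwise a (x, d) \<and>
          meeting_time M (x, d) y s < meeting_time M (x, d) x (- arr x) \<and>
          meeting_time M (x, d) x (- arr x) < meeting_time M (x, d) y (- s)))"

definition type_X :: "diagram \<Rightarrow> arrows \<Rightarrow> (square \<Rightarrow> nat) \<Rightarrow> square \<Rightarrow> square \<Rightarrow> bool"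
  where "type_X D arr I x y \<longleftrightarrow>
    interleaved_via D arr I x y (arr y) \<or> interleaved_via D arr I y x (arr x)"

definition type_Y :: "diagram \<Rightarrow> arrows \<Rightarrow> (square \<Rightarrow> nat) \<Rightarrow> square \<Rightarrow> square \<Rightarrow> bool"
  where "type_Y D arr I x y \<longleftrightarrow>
    interleaved_via D arr I x y (- arr y) \<or> interleaved_via D arr I y x (- arr x)"


section \<open>Edge assignments\<close>

definition even_square :: "(edge \<Rightarrow> int) \<Rightarrow> (square \<Rightarrow> nat) \<Rightarrow> square \<Rightarrow> square \<Rightarrow> bool"
  where "even_square \<epsilon> I x y \<longleftrightarrow>
    even (card {e \<in> {(I, x), (I(x := 1), y), (I, y), (I(y := 1), x)}. \<epsilon> e = - 1})"

definition edge_assignment_X :: "diagram \<Rightarrow> arrows \<Rightarrow> (edge \<Rightarrow> int) \<Rightarrow> bool"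
  where "edge_assignment_X D arr \<epsilon> \<longleftrightarrow>
    (\<forall>e \<in> edges D. \<epsilon> e \<in> {1, - 1}) \<and>
    (\<forall>(I, x, y) \<in> squares D.
       (type_A D arr I x y \<or> type_X D arr I x y \<longrightarrow> even_square \<epsilon> I x y) \<and>
       (type_C D arr I x y \<or> type_Y D arr I x y \<longrightarrow> \<not> even_square \<epsilon> I x y))"

definition edge_assignment_Y :: "diagram \<Rightarrow> arrows \<Rightarrow> (edge \<Rightarrow> int) \<Rightarrow> bool"
  where "edge_assignment_Y D arr \<epsilon> \<longleftrightarrow>
    (\<forall>e \<in> edges D. \<epsilon> e \<in> {1, - 1}) \<and>
    (\<forall>(I, x, y) \<in> squares D.
       (type_A D arr I x y \<or> type_Y D arr I x y \<longrightarrow> even_square \<epsilon> I x y) \<and>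
       (type_C D arr I x y \<or> type_X D arr I x y \<longrightarrow> \<not> even_square \<epsilon> I x y))"

text \<open>The choices of arrows and signs from which the complex of \<open>D\<close> can be formed.\<close>

definition odd_khovanov_data :: "diagram \<Rightarrow> arrows \<Rightarrow> (edge \<Rightarrow> int) \<Rightarrow> bool"
  where "odd_khovanov_data D arr \<epsilon> \<longleftrightarrow>
    arrow_choice D arr \<and> (edge_assignment_X D arr \<epsilon> \<or> edge_assignment_Y D arr \<epsilon>)"


section \<open>The complex and its homology\<close>

type_synonym chain = "(square \<Rightarrow> nat) \<Rightarrow> circle exterior"

text \<open>The direct sum of the groups \<open>state_space D I\<close> over the vertices \<open>I\<close>.\<close>

definition chain_group :: "diagram \<Rightarrow> chain monoid"
  where "chain_group D =
    \<lparr>carrier = {c. (\<forall>I \<in> vertices D. c I \<in> state_space D I) \<and> (\<forall>I. I \<notin> vertices D \<longrightarrow> c I = 0)},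
     monoid.mult = (\<lambda>c c' I. c I + c' I),
     one = (\<lambda>I. 0)\<rparr>"

definition differential :: "diagram \<Rightarrow> arrows \<Rightarrow> (edge \<Rightarrow> int) \<Rightarrow> chain \<Rightarrow> chain"
  where "differential D arr \<epsilon> c = (\<lambda>J.
    \<Sum>(I, x) \<in> {(I, x) \<in> edges D. I(x := 1) = J}.
      of_int (\<epsilon> (I, x)) * edge_map D arr (I, x) (c I))"

definition homology_of :: "'a monoid \<Rightarrow> ('a \<Rightarrow> 'a) \<Rightarrow> 'a set monoid"
  where "homology_of G d = subgroup_generated G (kernel G G d) Mod (d ` carrier G)"

definition chain_map ::
    "'a monoid \<Rightarrow> ('a \<Rightarrow> 'a) \<Rightarrow> 'b monoid \<Rightarrow> ('b \<Rightarrow> 'b) \<Rightarrow> ('a \<Rightarrow> 'b) \<Rightarrow> bool"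
  where "chain_map G d H d' f \<longleftrightarrow> f \<in> hom G H \<and> (\<forall>c \<in> carrier G. f (d c) = d' (f c))"

text \<open>The map on homology that takes the class of a cycle \<open>z\<close> to the class of \<open>f z\<close>.\<close>

definition induced_map ::
    "'b monoid \<Rightarrow> ('b \<Rightarrow> 'b) \<Rightarrow> ('a \<Rightarrow> 'b) \<Rightarrow> 'a set \<Rightarrow> 'b set"
  where "induced_map H d' f A = the_elem ((\<lambda>z. (d' ` carrier H) #>\<^bsub>H\<^esub> f z) ` A)"

definition odd_khovanov :: "diagram \<Rightarrow> arrows \<Rightarrow> (edge \<Rightarrow> int) \<Rightarrow> chain set monoid"
  where "odd_khovanov D arr \<epsilon> = homology_of (chain_group D) (differential D arr \<epsilon>)"

end

theory Submission
  imports Defs "HOL-Library.Z2" "HOL-Library.Function_Algebras" "HOL-Combinatorics.Orbits"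
begin

text \<open>
  The chains supported on the vertices \<open>I\<close> with \<open>I x = 1\<close> form a subcomplex, whose quotient is
  given by the vertices with \<open>I x = 0\<close>.  With the restricted arrows and signs these are complexes of
  \<open>D\<^sub>1\<close> and \<open>D\<^sub>0\<close>, so what remains is that the complex of a diagram does not depend on its data.

  Colour the corners of the squares by the parity of the number of strands above them.  Keeping the
  even regions on the left orients all strands, in the same way for all resolutions; circles become
  the orbits of a permutation, and a surgery composes it with a transposition.  So every edge is a
  merge or a split, and counting circles leaves three kinds of faces: both paths have the same
  merges and splits, or both merge and then split, or both split and then merge.  The last kind
  consists of the faces of type X or Y, the others have type A or C.  Comparing face by face, two
  assignments of the same type differ by the signs of the splits at the reversed arrows and by a
  cocycle of the cube, hence a coboundary.

  The types X and Y are exchanged by changing the signs of the splits whose rotated arcs lie in odd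
  regions.  This is realised by the linear involution of the circles that fixes the differences of
  circles bordering a common even region and negates those for an odd region.
\<close>


text \<open>The three diagrams come with unrelated arrows and signs, perhaps of type X for one and
  of type Y for another, while only the restrictions of the data of D to two facets of its cube fit
  into the complex of D. So a comparison across the types cannot be avoided.

  Two devices keep it uniform. Every state space is a quotient of one exterior algebra, generated by
  the points of the diagram. There an edge acts as left multiplication by 1 (merge) or by a
  difference of two points that depends only on the crossing and its arrow (split). And the Jordan
  curve theorem is replaced by potentials: values summed along vertical rays, consistent because the
  increments around every square cancel. With coefficients in Z/2 they tell the inside of a circle.
  With coefficients in the free group on the circles they give a potential L on regions, for which a
  circle is L_odd - L_even, taken on its two sides. The involution has eigenvalue 1 on potentials of
  odd regions and -1 on those of even regions; so it takes a circle to L_odd + L_even.\<close>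

definition word_frag :: "('a \<Rightarrow>\<^sub>0 int) \<Rightarrow> ('a list \<Rightarrow>\<^sub>0 int)"
  where "word_frag = frag_extend (\<lambda>a. frag_of [a])"

lemma word_frag_simps [simp]:
  "word_frag 0 = 0" "word_frag (frag_of a) = frag_of [a]"
  "word_frag (u + v) = word_frag u + word_frag v" "word_frag (u - v) = word_frag u - word_frag v"
  "word_frag (- u) = - word_frag u"
  by (simp_all add: word_frag_def frag_extend_add frag_extend_diff frag_extend_minus)

lemma word_frag_degree_one: "word_frag v \<in> degree_one"
  unfolding word_frag_def degree_one_def using keys_frag_extend by fastforce

text \<open>With the generators of the ideal in the form \<open>word_frag u * word_frag u\<close>,
  linear maps of the free groups are seen to carry generators to generators.\<close>

lemma degree_one_eq: "degree_one = range word_frag"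
proof -
  have "\<exists>u. v = word_frag u" if "Poly_Mapping.keys v \<subseteq> range (\<lambda>a. [a])" for v :: "'a list \<Rightarrow>\<^sub>0 int"
    using that
  proof (induction v rule: frag_induction)
    case zero
    then show ?case by (metis word_frag_simps(1))
  next
    case (one w)
    then obtain a where "w = [a]" by auto
    then have "frag_of w = word_frag (frag_of a)" by simp
    then show ?case by blast
  next
    case (diff a b)
    then show ?case by (metis word_frag_simps(4))
  qed
  then have "v \<in> range word_frag" if "v \<in> degree_one" for v :: "'a list \<Rightarrow>\<^sub>0 int"
    using that unfolding degree_one_def by blast
  then show ?thesis
    using word_frag_degree_one by blast
qed

text \<open>Degree one is needed beyond single generators: for the differences of circles at a split
  and for the images of circles under the reflection.\<close>

lift_definition vect :: "('a \<Rightarrow>\<^sub>0 int) \<Rightarrow> 'a exterior" is word_frag .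

lemma vect_simps [simp]:
  "vect 0 = 0" "vect (frag_of a) = gen a" "vect (u + v) = vect u + vect v"
  "vect (u - v) = vect u - vect v" "vect (- u) = - vect u"
  by (transfer; simp add: square_ideal.zero)+

lemma vect_square: "vect v * vect v = 0"
proof transfer
  fix v :: "'a \<Rightarrow>\<^sub>0 int"
  show "word_frag v * word_frag v - 0 \<in> square_ideal"
    using square_ideal.square[OF word_frag_degree_one, of 1 v 1] by simp
qed

lemma vect_anticommute: "vect u * vect v = - (vect v * vect u)"
proof -
  have "vect (u + v) * vect (u + v) = 0" by (rule vect_square)
  then show ?thesis
    by (simp add: distrib_left distrib_right vect_square eq_neg_iff_add_eq_0 add.commute)
qed

lemma one_frag: "(1 :: 'a list \<Rightarrow>\<^sub>0 int) = frag_of []"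
  by (metis single_one zero_list_def)

section \<open>Algebra maps induced by linear maps\<close>

definition tensor_lin :: "('a \<Rightarrow> 'b \<Rightarrow>\<^sub>0 int) \<Rightarrow> ('a list \<Rightarrow>\<^sub>0 int) \<Rightarrow> ('b list \<Rightarrow>\<^sub>0 int)"
  where "tensor_lin h = frag_extend (\<lambda>w. prod_list (map (\<lambda>a. word_frag (h a)) w))"

lemma tensor_lin_simps:
  "tensor_lin h 0 = 0" "tensor_lin h (p + q) = tensor_lin h p + tensor_lin h q"
  "tensor_lin h (p - q) = tensor_lin h p - tensor_lin h q"
  by (simp_all add: tensor_lin_def frag_extend_add frag_extend_diff)

lemma tensor_lin_of [simp]: "tensor_lin h (frag_of w) = prod_list (map (\<lambda>a. word_frag (h a)) w)"
  by (simp add: tensor_lin_def)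

lemma tensor_lin_one: "tensor_lin h 1 = 1"
  unfolding one_frag tensor_lin_of by (simp add: one_frag)

lemma tensor_lin_mult: "tensor_lin h (p * q) = tensor_lin h p * tensor_lin h q"
proof (rule frag_induction[of p UNIV])
  fix u
  show "tensor_lin h (frag_of u * q) = tensor_lin h (frag_of u) * tensor_lin h q"
    by (rule frag_induction[of q UNIV])
      (simp_all add: frag_of_mult tensor_lin_simps right_diff_distrib)
qed (simp_all add: tensor_lin_simps left_diff_distrib)

lemma tensor_lin_word_frag: "tensor_lin h (word_frag v) = word_frag (frag_extend h v)"
  by (rule frag_induction[of v UNIV]) (simp_all add: tensor_lin_simps frag_extend_diff)

lemma tensor_lin_square_ideal: "s \<in> square_ideal \<Longrightarrow> tensor_lin h s \<in> square_ideal"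
proof (induction rule: square_ideal.induct)
  case (square v p q)
  then obtain u where "v = word_frag u" by (auto simp: degree_one_eq)
  then show ?case
    by (simp add: tensor_lin_mult tensor_lin_word_frag square_ideal.square word_frag_degree_one)
qed (simp_all add: tensor_lin_simps square_ideal.intros)

text \<open>\<open>exterior_map\<close> only renames generators, whereas the reflection takes a
  circle to a linear combination of circles.\<close>

lift_definition exterior_lin :: "('a \<Rightarrow> 'b \<Rightarrow>\<^sub>0 int) \<Rightarrow> 'a exterior \<Rightarrow> 'b exterior" is tensor_lin
  by (metis tensor_lin_simps(3) tensor_lin_square_ideal)

lemma exterior_lin_simps [simp]:
  "exterior_lin h 0 = 0" "exterior_lin h 1 = 1"
  "exterior_lin h (p + q) = exterior_lin h p + exterior_lin h q"
  "exterior_lin h (p - q) = exterior_lin h p - exterior_lin h q"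
  "exterior_lin h (p * q) = exterior_lin h p * exterior_lin h q"
  "exterior_lin h (vect v) = vect (frag_extend h v)"
  "exterior_lin h (gen a) = vect (h a)"
  by (transfer; simp add: tensor_lin_simps tensor_lin_mult tensor_lin_word_frag tensor_lin_one
      square_ideal.zero)+

lemma exterior_lin_minus [simp]: "exterior_lin h (- p) = - exterior_lin h p"
  using exterior_lin_simps(4)[of h 0 p] by simp

lemma prod_list_frag_of: "prod_list (map (\<lambda>a. frag_of [f a]) w) = (frag_of (map f w) :: 'b list \<Rightarrow>\<^sub>0 int)"
  by (induction w) (simp_all add: one_frag frag_of_mult)

lemma tensor_map_eq_lin: "tensor_map f = tensor_lin (\<lambda>a. frag_of (f a))"
  unfolding tensor_map_def tensor_lin_def by (simp add: prod_list_frag_of)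

lemma exterior_map_eq_lin: "exterior_map f = exterior_lin (\<lambda>a. frag_of (f a))"
proof
  fix x :: "'a exterior"
  show "exterior_map f x = exterior_lin (\<lambda>a. frag_of (f a)) x"
    by transfer (simp add: tensor_map_eq_lin square_ideal.zero)
qed

lemma exterior_map_simps [simp]:
  "exterior_map f 0 = 0" "exterior_map f 1 = 1"
  "exterior_map f (p + q) = exterior_map f p + exterior_map f q"
  "exterior_map f (p - q) = exterior_map f p - exterior_map f q"
  "exterior_map f (p * q) = exterior_map f p * exterior_map f q"
  "exterior_map f (gen a) = gen (f a)" "exterior_map f (- p) = - exterior_map f p"
  "exterior_map f (vect v) = vect (frag_extend (\<lambda>a. frag_of (f a)) v)"
  by (simp_all add: exterior_map_eq_lin)

section \<open>The exterior algebra on a set of generators\<close>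

lemma exterior_on_closed [simp]:
  "0 \<in> exterior_on S" "1 \<in> exterior_on S"
  "x \<in> exterior_on S \<Longrightarrow> y \<in> exterior_on S \<Longrightarrow> x + y \<in> exterior_on S"
  "x \<in> exterior_on S \<Longrightarrow> y \<in> exterior_on S \<Longrightarrow> x - y \<in> exterior_on S"
  "x \<in> exterior_on S \<Longrightarrow> - x \<in> exterior_on S"
proof -
  show z: "0 \<in> exterior_on S"
    unfolding exterior_on_def by (rule image_eqI[of _ _ 0]) (simp_all add: zero_exterior.abs_eq)
  show "1 \<in> exterior_on S"
    unfolding exterior_on_def
    by (rule image_eqI[of _ _ 1]) (simp_all add: one_exterior.abs_eq zero_list_def)
  show "x + y \<in> exterior_on S" if "x \<in> exterior_on S" "y \<in> exterior_on S" for x y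
    using that unfolding exterior_on_def
    by (force simp: plus_exterior.abs_eq dest: subsetD[OF keys_add])
  show d: "x - y \<in> exterior_on S" if "x \<in> exterior_on S" "y \<in> exterior_on S" for x y
    using that unfolding exterior_on_def
    by (force simp: minus_exterior.abs_eq dest: subsetD[OF keys_diff])
  show "- x \<in> exterior_on S" if "x \<in> exterior_on S" for x
    using d[OF z that] by simp
qed

lemma gen_times_abs: "gen a * abs_exterior (frag_of w) = abs_exterior (frag_of (a # w))"
  by (simp add: gen.abs_eq times_exterior.abs_eq frag_of_mult)

text \<open>The case of differences also yields 0, as \<open>1 - 1\<close>, and with it negatives
  and sums; words are built by left multiplication with generators.\<close>

lemma exterior_on_induct [consumes 1, case_names one gen diff]:
  assumes "x \<in> exterior_on S"
    and one: "P 1"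
    and gen: "\<And>a x. a \<in> S \<Longrightarrow> P x \<Longrightarrow> P (gen a * x)"
    and diff: "\<And>x y. P x \<Longrightarrow> P y \<Longrightarrow> P (x - y)"
  shows "P x"
proof -
  obtain p where p: "Poly_Mapping.keys p \<subseteq> lists S" and x: "x = abs_exterior p"
    using assms(1) by (auto simp: exterior_on_def)
  have z: "P 0" using diff[OF one one] by simp
  from p have "P (abs_exterior p)"
  proof (induction p rule: frag_induction)
    case zero
    then show ?case using z by (simp add: zero_exterior.abs_eq)
  next
    case (one w)
    then show ?case
    proof (induction w)
      case Nil
      then show ?case using assms(2) by (simp add: one_exterior.abs_eq one_frag)
    next
      case (Cons a w)
      then show ?case using gen[of a] by (simp flip: gen_times_abs)
    qed
  next
    case (diff a b)
    then show ?case using assms(4) by (simp flip: minus_exterior.abs_eq)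
  qed
  then show ?thesis by (simp add: x)
qed

lemma exterior_on_gen_times:
  assumes "a \<in> S" "x \<in> exterior_on S"
  shows "gen a * x \<in> exterior_on S"
proof -
  obtain p where p: "Poly_Mapping.keys p \<subseteq> lists S" and x: "x = abs_exterior p"
    using assms(2) by (auto simp: exterior_on_def)
  have "gen a * abs_exterior p \<in> exterior_on S"
    using p
  proof (induction p rule: frag_induction)
    case zero
    then show ?case by (simp flip: zero_exterior.abs_eq)
  next
    case (one w)
    then show ?case using \<open>a \<in> S\<close> unfolding gen_times_abs exterior_on_def by force
  next
    case (diff p q)
    then show ?case by (simp add: right_diff_distrib flip: minus_exterior.abs_eq)
  qed
  then show ?thesis by (simp add: x)
qed

lemma exterior_on_times:
  assumes "x \<in> exterior_on S" "y \<in> exterior_on S"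
  shows "x * y \<in> exterior_on S"
  using assms(1)
  by (induction rule: exterior_on_induct)
    (simp_all add: assms left_diff_distrib mult.assoc exterior_on_gen_times)

lemma exterior_on_gen: "a \<in> S \<Longrightarrow> gen a \<in> exterior_on S"
  using exterior_on_gen_times[of a S 1] by simp

lemma exterior_on_vect:
  assumes "Poly_Mapping.keys v \<subseteq> S"
  shows "vect v \<in> exterior_on S"
  using assms by (induction v rule: frag_induction) (simp_all add: exterior_on_gen)

lemma exterior_on_UNIV: "x \<in> exterior_on UNIV"
proof -
  have "x = abs_exterior (rep_exterior x)"
    by (simp add: Quotient3_abs_rep[OF Quotient3_exterior])
  then show ?thesis
    unfolding exterior_on_def by simp
qed

lemma exterior_lin_in:
  assumes "x \<in> exterior_on S" "\<And>a. a \<in> S \<Longrightarrow> Poly_Mapping.keys (h a) \<subseteq> T"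
  shows "exterior_lin h x \<in> exterior_on T"
  using assms(1)
  by (induction rule: exterior_on_induct)
    (simp_all add: assms exterior_on_times exterior_on_vect)

lemma exterior_map_in:
  assumes "x \<in> exterior_on S" "\<And>a. a \<in> S \<Longrightarrow> f a \<in> T"
  shows "exterior_map f x \<in> exterior_on T"
  unfolding exterior_map_eq_lin using assms by (auto intro: exterior_lin_in)

lemma exterior_lin_cong:
  assumes "x \<in> exterior_on S" "\<And>a. a \<in> S \<Longrightarrow> h a = k a"
  shows "exterior_lin h x = exterior_lin k x"
  using assms(1) by (induction rule: exterior_on_induct) (simp_all add: assms)

lemma exterior_map_cong:
  assumes "x \<in> exterior_on S" "\<And>a. a \<in> S \<Longrightarrow> f a = g a"
  shows "exterior_map f x = exterior_map g x"
  unfolding exterior_map_eq_lin using assms by (auto intro: exterior_lin_cong)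

lemma exterior_lin_comp:
  "exterior_lin h (exterior_lin k x) = exterior_lin (\<lambda>a. frag_extend h (k a)) x"
  using exterior_on_UNIV[of x]
  by (induction rule: exterior_on_induct) simp_all

lemma exterior_lin_id:
  assumes "x \<in> exterior_on S" "\<And>a. a \<in> S \<Longrightarrow> h a = frag_of a"
  shows "exterior_lin h x = x"
  using assms(1) by (induction rule: exterior_on_induct) (simp_all add: assms)

lemma exterior_map_comp: "exterior_map f (exterior_map g x) = exterior_map (\<lambda>a. f (g a)) x"
  by (simp add: exterior_map_eq_lin exterior_lin_comp)

lemma exterior_map_id:
  assumes "x \<in> exterior_on S" "\<And>a. a \<in> S \<Longrightarrow> f a = a"
  shows "exterior_map f x = x"
  unfolding exterior_map_eq_lin using assms by (auto intro: exterior_lin_id)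

text \<open>Choosing a preimage of every generator splits the map. With \<open>f\<close> sending a
  point to its circle, this presents a state space as a quotient of the exterior algebra on the
  points.\<close>

lemma exterior_map_image: "exterior_map f ` exterior_on S = exterior_on (f ` S)"
proof
  show "exterior_map f ` exterior_on S \<subseteq> exterior_on (f ` S)"
    by (auto intro: exterior_map_in)
  show "exterior_on (f ` S) \<subseteq> exterior_map f ` exterior_on S"
  proof
    fix x assume x: "x \<in> exterior_on (f ` S)"
    have "exterior_map (inv_into S f) x \<in> exterior_on S"
      by (rule exterior_map_in[OF x]) (rule inv_into_into)
    moreover have "exterior_map f (exterior_map (inv_into S f) x) = x"
      unfolding exterior_map_comp by (rule exterior_map_id[OF x]) (rule f_inv_into_f)
    ultimately show "x \<in> exterior_map f ` exterior_on S" by (metis image_eqI)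
  qed
qed

text \<open>The kernel of the identification is the ideal of
  \<open>gen b\<^sub>1 - gen b\<^sub>2\<close>. The change of a product is collected factor by
  factor, and anticommutation moves each difference to the front.\<close>

lemma identify_gens:
  "\<exists>u. x - exterior_map (\<lambda>b. if b = b\<^sub>2 then b\<^sub>1 else b) x = (gen b\<^sub>1 - gen b\<^sub>2) * u"
  using exterior_on_UNIV[of x]
proof (induction rule: exterior_on_induct)
  case one
  show ?case by (rule exI[of _ 0]) simp
next
  case (gen a x)
  let ?h = "exterior_map (\<lambda>b. if b = b\<^sub>2 then b\<^sub>1 else b)"
  obtain u where u: "x - ?h x = (gen b\<^sub>1 - gen b\<^sub>2) * u" using gen by blast
  have anti: "gen c * (gen b\<^sub>1 - gen b\<^sub>2) = - ((gen b\<^sub>1 - gen b\<^sub>2) * gen c)" for c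
    using vect_anticommute[of "frag_of c" "frag_of b\<^sub>1 - frag_of b\<^sub>2"] by simp
  have "gen a * x - ?h (gen a * x) = (gen a - ?h (gen a)) * x + ?h (gen a) * (x - ?h x)"
    by (simp add: algebra_simps)
  also have "\<dots> = (gen a - ?h (gen a)) * x - (gen b\<^sub>1 - gen b\<^sub>2) * (?h (gen a) * u)"
    unfolding u by (simp add: anti flip: mult.assoc)
  \<comment> \<open>For \<open>a = b\<^sub>2\<close> the first factor is
    \<open>gen b\<^sub>2 - gen b\<^sub>1\<close>, hence the sign in \<open>- x\<close>.\<close>
  also have "\<dots> = (gen b\<^sub>1 - gen b\<^sub>2) * ((if a = b\<^sub>2 then - x else 0) - ?h (gen a) * u)"
    by (simp add: algebra_simps)
  finally show ?case by blast
next
  case (diff x y)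
  then obtain u v where uv: "x - exterior_map (\<lambda>b. if b = b\<^sub>2 then b\<^sub>1 else b) x = (gen b\<^sub>1 - gen b\<^sub>2) * u"
    "y - exterior_map (\<lambda>b. if b = b\<^sub>2 then b\<^sub>1 else b) y = (gen b\<^sub>1 - gen b\<^sub>2) * v" by blast
  have "x - y - exterior_map (\<lambda>b. if b = b\<^sub>2 then b\<^sub>1 else b) (x - y)
      = (x - exterior_map (\<lambda>b. if b = b\<^sub>2 then b\<^sub>1 else b) x)
        - (y - exterior_map (\<lambda>b. if b = b\<^sub>2 then b\<^sub>1 else b) y)"
    by simp
  also have "\<dots> = (gen b\<^sub>1 - gen b\<^sub>2) * (u - v)"
    unfolding uv by (simp add: right_diff_distrib)
  finally show ?case by blast
qed

text \<open>So the map of a split does not depend on the choice of a lift.\<close>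

lemma diff_times_cong:
  assumes "exterior_map (\<lambda>b. if b = b\<^sub>2 then b\<^sub>1 else b) w = exterior_map (\<lambda>b. if b = b\<^sub>2 then b\<^sub>1 else b) w'"
  shows "(gen b\<^sub>1 - gen b\<^sub>2) * w = (gen b\<^sub>1 - gen b\<^sub>2) * w'"
proof -
  obtain u where "w - w' = (gen b\<^sub>1 - gen b\<^sub>2) * u"
    using identify_gens[of "w - w'" b\<^sub>2 b\<^sub>1] assms by auto
  then have "(gen b\<^sub>1 - gen b\<^sub>2) * (w - w') = 0"
    using vect_square[of "frag_of b\<^sub>1 - frag_of b\<^sub>2"] by (simp flip: mult.assoc)
  then show ?thesis by (simp add: right_diff_distrib)
qed



section \<open>Coefficients in degrees one and two\<close>

lemma lookup_frag_of: "Poly_Mapping.lookup (frag_of u) w = (if w = u then 1 else 0)"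
  by (simp add: lookup_single when_def)

lemma lookup_times_single:
  fixes p q :: "'a list \<Rightarrow>\<^sub>0 int"
  shows "Poly_Mapping.lookup (p * q) [a] =
    Poly_Mapping.lookup p [] * Poly_Mapping.lookup q [a] + Poly_Mapping.lookup p [a] * Poly_Mapping.lookup q []"
proof (rule frag_induction[of p UNIV])
  fix u :: "'a list"
  show "Poly_Mapping.lookup (frag_of u * q) [a] =
    Poly_Mapping.lookup (frag_of u) [] * Poly_Mapping.lookup q [a]
    + Poly_Mapping.lookup (frag_of u) [a] * Poly_Mapping.lookup q []"
  proof (rule frag_induction[of q UNIV])
    fix w :: "'a list"
    show "Poly_Mapping.lookup (frag_of u * frag_of w) [a] =
      Poly_Mapping.lookup (frag_of u) [] * Poly_Mapping.lookup (frag_of w) [a]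
      + Poly_Mapping.lookup (frag_of u) [a] * Poly_Mapping.lookup (frag_of w) []"
      unfolding frag_of_mult lookup_frag_of by (cases u) auto
  qed (simp_all add: right_diff_distrib lookup_minus)
qed (simp_all add: left_diff_distrib lookup_minus)

lemma lookup_times_double:
  fixes p q :: "'a list \<Rightarrow>\<^sub>0 int"
  shows "Poly_Mapping.lookup (p * q) [a, b] =
    Poly_Mapping.lookup p [] * Poly_Mapping.lookup q [a, b]
    + Poly_Mapping.lookup p [a] * Poly_Mapping.lookup q [b]
    + Poly_Mapping.lookup p [a, b] * Poly_Mapping.lookup q []"
proof (rule frag_induction[of p UNIV])
  fix u :: "'a list"
  show "Poly_Mapping.lookup (frag_of u * q) [a, b] =
    Poly_Mapping.lookup (frag_of u) [] * Poly_Mapping.lookup q [a, b]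
    + Poly_Mapping.lookup (frag_of u) [a] * Poly_Mapping.lookup q [b]
    + Poly_Mapping.lookup (frag_of u) [a, b] * Poly_Mapping.lookup q []"
  proof (rule frag_induction[of q UNIV])
    fix w :: "'a list"
    show "Poly_Mapping.lookup (frag_of u * frag_of w) [a, b] =
      Poly_Mapping.lookup (frag_of u) [] * Poly_Mapping.lookup (frag_of w) [a, b]
      + Poly_Mapping.lookup (frag_of u) [a] * Poly_Mapping.lookup (frag_of w) [b]
      + Poly_Mapping.lookup (frag_of u) [a, b] * Poly_Mapping.lookup (frag_of w) []"
    proof (cases u)
      case (Cons c us)
      then show ?thesis unfolding frag_of_mult lookup_frag_of by (cases us) auto
    qed (simp add: frag_of_mult lookup_frag_of)
  qed (simp_all add: right_diff_distrib lookup_minus)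
qed (simp_all add: left_diff_distrib lookup_minus)

lemma lookup_degree_one:
  assumes "v \<in> degree_one"
  shows "Poly_Mapping.lookup v [] = 0" "Poly_Mapping.lookup v [a, b] = 0"
  using assms by (auto simp: degree_one_def simp flip: not_in_keys_iff_lookup_eq_zero)

text \<open>In length two the only contribution of \<open>p * (v * v) * q\<close> is a multiple of
  \<open>v * v\<close>, whose coefficients are symmetric. So these functionals descend to the
  exterior algebra, where they detect that composites of edge maps are nonzero.\<close>

lemma square_ideal_coeff:
  assumes "s \<in> square_ideal"
  shows "Poly_Mapping.lookup s [a] = 0" "Poly_Mapping.lookup s [a, b] = Poly_Mapping.lookup s [b, a]"
  using assms
proof (induction rule: square_ideal.induct)
  case (square v p q)
  { case 1
    show ?case
      by (simp add: lookup_times_single lookup_times_Nil lookup_degree_one[OF square]) }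
  { case 2
    show ?case
      by (simp add: lookup_times_single lookup_times_double lookup_times_Nil lookup_degree_one[OF square]
          mult.commute mult.left_commute) }
qed (simp_all add: lookup_add)

lift_definition coeff1 :: "'a \<Rightarrow> 'a exterior \<Rightarrow> int" is "\<lambda>a p. Poly_Mapping.lookup p [a]"
  using square_ideal_coeff(1) by (fastforce simp: lookup_minus)

text \<open>The antisymmetrised coefficient, dual to the wedge of \<open>a\<close> and
  \<open>b\<close>.\<close>

lift_definition coeff2 :: "'a \<Rightarrow> 'a \<Rightarrow> 'a exterior \<Rightarrow> int"
  is "\<lambda>a b p. Poly_Mapping.lookup p [a, b] - Poly_Mapping.lookup p [b, a]"
proof -
  fix a b :: 'a and p q :: "'a list \<Rightarrow>\<^sub>0 int"
  assume "p - q \<in> square_ideal"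
  from square_ideal_coeff(2)[OF this, of a b]
  show "Poly_Mapping.lookup p [a, b] - Poly_Mapping.lookup p [b, a] =
      Poly_Mapping.lookup q [a, b] - Poly_Mapping.lookup q [b, a]"
    by (simp add: lookup_minus)
qed

lemma coeff1_zero: "coeff1 c 0 = 0" and coeff2_zero: "coeff2 c d 0 = 0"
  by (transfer, simp)+

lemma coeff1_add: "coeff1 c (x + y) = coeff1 c x + coeff1 c y"
  by (induction x rule: exterior.abs_induct, induction y rule: exterior.abs_induct)
    (simp add: plus_exterior.abs_eq coeff1.abs_eq coeff2.abs_eq lookup_add)
lemma coeff1_diff: "coeff1 c (x - y) = coeff1 c x - coeff1 c y"
  by (induction x rule: exterior.abs_induct, induction y rule: exterior.abs_induct)
    (simp add: minus_exterior.abs_eq coeff1.abs_eq coeff2.abs_eq lookup_minus)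
lemma coeff1_gen: "coeff1 c (gen a) = (if a = c then 1 else 0)"
  unfolding gen.abs_eq coeff1.abs_eq lookup_frag_of by simp
lemma coeff2_add: "coeff2 c d (x + y) = coeff2 c d x + coeff2 c d y"
  by (induction x rule: exterior.abs_induct, induction y rule: exterior.abs_induct)
    (simp add: plus_exterior.abs_eq coeff1.abs_eq coeff2.abs_eq lookup_add)
lemma coeff2_diff: "coeff2 c d (x - y) = coeff2 c d x - coeff2 c d y"
  by (induction x rule: exterior.abs_induct, induction y rule: exterior.abs_induct)
    (simp add: minus_exterior.abs_eq coeff1.abs_eq coeff2.abs_eq lookup_minus)
lemma coeff2_gen: "coeff2 c d (gen a * gen b) =
    (if a = c \<and> b = d then 1 else 0) - (if a = d \<and> b = c then 1 else 0)"
  unfolding gen.abs_eq times_exterior.abs_eq coeff2.abs_eq frag_of_mult lookup_frag_of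
  by (simp only: append.simps list.inject simp_thms eq_commute[of c] eq_commute[of d])
lemmas coeff1_simps = coeff1_add coeff1_diff coeff1_gen
lemmas coeff2_simps = coeff2_add coeff2_diff coeff2_gen

lemma gen_diff_nonzero: "a \<noteq> b \<Longrightarrow> gen a - gen b \<noteq> 0"
proof
  assume "a \<noteq> b" "gen a - gen b = 0"
  then have "coeff1 a (gen a - gen b) = coeff1 a (0 + 0)" by simp
  then show False using \<open>a \<noteq> b\<close> by (simp add: coeff1_simps coeff1_zero)
qed

text \<open>One of \<open>a\<close> and \<open>b\<close> is not among \<open>c\<close>,
  \<open>d\<close>; its wedge with \<open>c\<close> occurs in the product and nothing cancels
  it.\<close>

lemma gen_diff_times_nonzero:
  assumes "a \<noteq> b" "c \<noteq> d" "{a, b} \<noteq> {c, d}"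
  shows "(gen a - gen b) * (gen c - gen d) \<noteq> 0"
proof
  assume z: "(gen a - gen b) * (gen c - gen d) = 0"
  have co: "coeff2 p q (gen a * gen c) - coeff2 p q (gen a * gen d)
      - (coeff2 p q (gen b * gen c) - coeff2 p q (gen b * gen d)) = 0" for p q
    using arg_cong[OF z, of "coeff2 p q"]
    by (simp add: left_diff_distrib right_diff_distrib coeff2_simps(1-2) coeff2_zero)
  consider "a \<notin> {c, d}" | "b \<notin> {c, d}" using assms by blast
  then show False
  proof cases
    case 1
    then show False using co[of a c] assms by (auto simp: coeff2_simps(3) split: if_splits)
  next
    case 2
    then show False using co[of b c] assms by (auto simp: coeff2_simps(3) split: if_splits)
  qed
qed

section \<open>Sides of squares and their midpoints\<close>

lemma UNIV_side: "UNIV = {East, North, West, South}"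
  by (auto intro: side.exhaust)

instance side :: finite
  by standard (simp add: UNIV_side)

lemma side_simps [simp]:
  "opposite East = West" "opposite North = South" "opposite West = East" "opposite South = North"
  by (simp_all add: opposite_def)

lemma opposite_opposite [simp]: "opposite (opposite d) = d"
  by (cases d) simp_all

lemma vec_opposite: "vec (opposite d) = - vec d"
  by (cases d) simp_all

lemma vec_rot_opposite: "vec (rot (opposite d)) = - vec (rot d)"
  by (cases d) simp_all

lemma opposite_neq [simp]: "opposite d \<noteq> d" "d \<noteq> opposite d"
  by (cases d; simp)+

lemma midpoint_neighbour [simp]: "midpoint (c + vec d) (opposite d) = midpoint c d"
  by (cases d) (simp_all add: midpoint_def prod_eq_iff)

lemma midpoint_eq_iff:
  "midpoint c d = midpoint c' d' \<longleftrightarrow> c' = c \<and> d' = d \<or> c' = c + vec d \<and> d' = opposite d"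
  by (cases c; cases c'; cases d; cases d'; simp add: midpoint_def; presburger)

lemma midpoint_odd: "odd (fst (midpoint c d) + snd (midpoint c d))"
  by (cases d) (simp_all add: midpoint_def)

section \<open>Potentials on the corners\<close>

text \<open>A discrete primitive that vanishes far up. Only nonzero values are summed, so that the
  index set is finite for finitely supported \<open>w\<close>.\<close>

definition potential :: "(point \<Rightarrow> 'g::ab_group_add) \<Rightarrow> point \<Rightarrow> 'g"
  where "potential w p = (\<Sum>y | snd p < y \<and> w (fst p, y) \<noteq> 0. w (fst p, y))"

text \<open>A cochain on the sides of the squares; \<open>square\<close> says that its increments
  around a square cancel. It is used with values in Z/2, for sets of points, and with values in the
  free group on the circles.\<close>

locale weight =
  fixes w :: "point \<Rightarrow> 'g::ab_group_add"
  assumes finite_support: "finite {p. w p \<noteq> 0}"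
    and support: "w p \<noteq> 0 \<Longrightarrow> odd (fst p + snd p)"
    and square: "w (midpoint c South) - w (midpoint c North) = w (midpoint c East) - w (midpoint c West)"
begin

lemma finite_ray: "finite {y. Y < y \<and> w (X, y) \<noteq> 0}"
  by (rule finite_subset[of _ "snd ` {p. w p \<noteq> 0}"]) (auto simp: finite_support image_iff)

lemma potential_vertical:
  assumes "odd X" "even Y"
  shows "potential w (X, Y - 1) = potential w (X, Y + 1) + w (X, Y)"
proof -
  \<comment> \<open>\<open>(X, Y + 1)\<close> is a corner, and weights sit on midpoints; so between
    two consecutive corners of a column only the height \<open>Y\<close> counts.\<close>
  have z: "w (X, Y + 1) = 0" using support[of "(X, Y + 1)"] assms by auto
  have "{y. Y - 1 < y \<and> w (X, y) \<noteq> 0} =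
      {y. Y + 1 < y \<and> w (X, y) \<noteq> 0} \<union> (if w (X, Y) = 0 then {} else {Y})"
  proof (rule Set.set_eqI)
    fix y
    have "Y - 1 < y \<longleftrightarrow> y = Y \<or> y = Y + 1 \<or> Y + 1 < y" by linarith
    then show "y \<in> {y. Y - 1 < y \<and> w (X, y) \<noteq> 0} \<longleftrightarrow>
        y \<in> {y. Y + 1 < y \<and> w (X, y) \<noteq> 0} \<union> (if w (X, Y) = 0 then {} else {Y})"
      using z by auto
  qed
  moreover have "Y \<notin> {y. Y + 1 < y \<and> w (X, y) \<noteq> 0}" by simp
  ultimately show ?thesis
    unfolding potential_def using finite_ray[of "Y + 1" X] by (simp add: add.commute)
qed

text \<open>Both columns have potential 0 above all weights, and \<open>square\<close> carries the
  identity down past one square at a time.\<close>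

lemma potential_horizontal:
  "potential w (2 * a + 1, 2 * b + 1) - potential w (2 * a - 1, 2 * b + 1) = w (2 * a, 2 * b + 1)"
proof -
  have "finite (snd ` {p. w p \<noteq> 0})" using finite_support by simp
  then obtain N where N: "\<And>y. y \<in> snd ` {p. w p \<noteq> 0} \<Longrightarrow> y < N"
    by (metis bdd_above_finite bdd_above.unfold gt_ex order_le_less_trans)
  have N: "w (X, y) = 0" if "N \<le> y" for X y
    using N[of y] that by force
  \<comment> \<open>The bound \<open>0 \<le> B\<close> gives \<open>N \<le> 2 * B + 1\<close>, so
    the induction starts above all weights.\<close>
  have "potential w (2 * a + 1, 2 * (B - int n) + 1) - potential w (2 * a - 1, 2 * (B - int n) + 1)
      = w (2 * a, 2 * (B - int n) + 1)" if "N \<le> B" "0 \<le> B" for n B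
  proof (induction n)
    case 0
    have "{y. 2 * B + 1 < y \<and> w (X, y) \<noteq> 0} = {}" for X using N that by fastforce
    then show ?case using N that by (simp add: potential_def)
  next
    case (Suc n)
    define b where "b = B - int n"
    have eq: "2 * (B - int (Suc n)) + 1 = 2 * b - 1" by (simp add: b_def)
    have v: "potential w (2 * a + s, 2 * b - 1) = potential w (2 * a + s, 2 * b + 1) + w (2 * a + s, 2 * b)"
      if "odd s" for s using potential_vertical[of "2 * a + s" "2 * b"] that by simp
    have sq: "w (2 * a, 2 * b - 1) - w (2 * a, 2 * b + 1) = w (2 * a + 1, 2 * b) - w (2 * a - 1, 2 * b)"
      using square[of "(a, b)"] by (simp add: midpoint_def)
    show ?case
      using Suc v[of 1] v[of "- 1"] sq unfolding eq b_def[symmetric]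
      by (simp add: algebra_simps)
  qed
  moreover define B where "B = max 0 (max N b)"
  moreover have "b \<le> B" by (simp add: B_def le_max_iff_disj)
  then have "B - int (nat (B - b)) = b" by simp
  moreover have "N \<le> B" "0 \<le> B" by (simp_all add: B_def le_max_iff_disj)
  ultimately show ?thesis by metis
qed

lemma potential_corners:
  "potential w (c + c + (1, 1)) = potential w (c + c + (- 1, 1)) + w (midpoint c North)"
  "potential w (c + c + (1, - 1)) = potential w (c + c + (- 1, - 1)) + w (midpoint c South)"
  "potential w (c + c + (1, - 1)) = potential w (c + c + (1, 1)) + w (midpoint c East)"
  "potential w (c + c + (- 1, - 1)) = potential w (c + c + (- 1, 1)) + w (midpoint c West)"
proof -
  obtain a b where c: "c = (a, b)" by force
  show "potential w (c + c + (1, 1)) = potential w (c + c + (- 1, 1)) + w (midpoint c North)"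
    using potential_horizontal[of a b] by (simp add: c midpoint_def algebra_simps)
  show "potential w (c + c + (1, - 1)) = potential w (c + c + (- 1, - 1)) + w (midpoint c South)"
    using potential_horizontal[of a "b - 1"] by (simp add: c midpoint_def algebra_simps)
  show "potential w (c + c + (1, - 1)) = potential w (c + c + (1, 1)) + w (midpoint c East)"
    using potential_vertical[of "2 * a + 1" "2 * b"] by (simp add: c midpoint_def algebra_simps)
  show "potential w (c + c + (- 1, - 1)) = potential w (c + c + (- 1, 1)) + w (midpoint c West)"
    using potential_vertical[of "2 * a - 1" "2 * b"] by (simp add: c midpoint_def algebra_simps)
qed

end

section \<open>Diagrams without crossings\<close>

definition points :: "diagram \<Rightarrow> point set"
  where "points M = {midpoint c d | c d. d \<in> \<Union> (strands (M c))}"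

definition flat :: "diagram \<Rightarrow> bool"
  where "flat M \<longleftrightarrow> link_diagram M \<and> (\<forall>c. M c \<notin> {CrossH, CrossV})"

lemma flatD: "flat M \<Longrightarrow> M c \<noteq> CrossH" "flat M \<Longrightarrow> M c \<noteq> CrossV"
  unfolding flat_def by blast+

lemma flat_link_diagram: "flat M \<Longrightarrow> link_diagram M"
  unfolding flat_def by blast

lemma midpoint_in_points:
  assumes "link_diagram M"
  shows "midpoint c d \<in> points M \<longleftrightarrow> d \<in> \<Union> (strands (M c))"
proof
  assume "midpoint c d \<in> points M"
  then obtain c' d' where *: "midpoint c d = midpoint c' d'" "d' \<in> \<Union> (strands (M c'))"
    unfolding points_def by blast
  have "d \<in> \<Union> (strands (M c)) \<longleftrightarrow> opposite d \<in> \<Union> (strands (M (c + vec d)))"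
    using assms unfolding link_diagram_def by blast
  then show "d \<in> \<Union> (strands (M c))"
    using * midpoint_eq_iff[of c d c' d'] by metis
next
  assume "d \<in> \<Union> (strands (M c))"
  then show "midpoint c d \<in> points M" unfolding points_def by blast
qed

lemma finite_points:
  assumes "link_diagram M"
  shows "finite (points M)"
proof -
  have "points M \<subseteq> (\<lambda>(c, d). midpoint c d) ` ({c. M c \<noteq> Blank} \<times> UNIV)"
    unfolding points_def by (auto simp: image_iff) (metis Union_empty empty_iff strands.simps(1))
  then show ?thesis
    using assms finite_subset unfolding link_diagram_def by fastforce
qed

text \<open>The unions of circles. The notion covers single circles as well as
  \<open>points M\<close>, whose \<open>inside\<close> is the checkerboard colouring.\<close>

definition stranded :: "diagram \<Rightarrow> point set \<Rightarrow> bool"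
  where "stranded M A \<longleftrightarrow> A \<subseteq> points M \<and>
    (\<forall>c d d'. {d, d'} \<in> strands (M c) \<longrightarrow> midpoint c d \<in> A \<longrightarrow> midpoint c d' \<in> A)"

lemma strandedD: "stranded M A \<Longrightarrow> {d, d'} \<in> strands (M c) \<Longrightarrow> midpoint c d \<in> A \<longleftrightarrow> midpoint c d' \<in> A"
  unfolding stranded_def by (metis insert_commute)

lemma stranded_points: "stranded M (points M)"
  unfolding stranded_def points_def by (blast intro: exI)

lemma stranded_outside:
  assumes "link_diagram M" "stranded M A" "d \<notin> \<Union> (strands (M c))"
  shows "midpoint c d \<notin> A"
  using assms midpoint_in_points unfolding stranded_def by blast

lemma of_nat_bit_eq_one_iff: "(of_nat n :: bit) = 1 \<longleftrightarrow> odd n"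
  by (induction n) auto

lemma inside_eq_potential:
  assumes "finite A"
  shows "inside A p \<longleftrightarrow> potential (\<lambda>q. of_bool (q \<in> A) :: bit) p = 1"
proof -
  have "finite {y. snd p < y \<and> (fst p, y) \<in> A}"
    by (rule finite_subset[of _ "snd ` A"]) (auto simp: assms intro: rev_image_eqI)
  then have *: "(\<Sum>y\<in>{y. snd p < y \<and> (fst p, y) \<in> A}. of_bool ((fst p, y) \<in> A) :: bit)
      = of_nat (card {y. snd p < y \<and> (fst p, y) \<in> A})"
    by (simp add: sum.cong)
  have "{y. snd p < y \<and> (of_bool ((fst p, y) \<in> A) :: bit) \<noteq> 0} = {y. snd p < y \<and> (fst p, y) \<in> A}"
    by auto
  then have "potential (\<lambda>q. of_bool (q \<in> A) :: bit) p = of_nat (card {y. snd p < y \<and> (fst p, y) \<in> A})"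
    unfolding potential_def using * by simp
  then show ?thesis
    unfolding inside_def by (simp add: of_nat_bit_eq_one_iff)
qed

lemma stranded_tile:
  assumes M: "flat M" and A: "stranded M A"
  shows "case M c of
      Blank \<Rightarrow> midpoint c North \<notin> A \<and> midpoint c East \<notin> A \<and> midpoint c South \<notin> A \<and> midpoint c West \<notin> A
    | Arc_NE \<Rightarrow> (midpoint c North \<in> A \<longleftrightarrow> midpoint c East \<in> A) \<and> midpoint c South \<notin> A \<and> midpoint c West \<notin> A
    | Arc_NW \<Rightarrow> (midpoint c North \<in> A \<longleftrightarrow> midpoint c West \<in> A) \<and> midpoint c South \<notin> A \<and> midpoint c East \<notin> A
    | Arc_SW \<Rightarrow> (midpoint c South \<in> A \<longleftrightarrow> midpoint c West \<in> A) \<and> midpoint c North \<notin> A \<and> midpoint c East \<notin> A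
    | Arc_SE \<Rightarrow> (midpoint c South \<in> A \<longleftrightarrow> midpoint c East \<in> A) \<and> midpoint c North \<notin> A \<and> midpoint c West \<notin> A
    | Line_H \<Rightarrow> (midpoint c West \<in> A \<longleftrightarrow> midpoint c East \<in> A) \<and> midpoint c North \<notin> A \<and> midpoint c South \<notin> A
    | Line_V \<Rightarrow> (midpoint c North \<in> A \<longleftrightarrow> midpoint c South \<in> A) \<and> midpoint c West \<notin> A \<and> midpoint c East \<notin> A
    | Arcs_NW_SE \<Rightarrow> (midpoint c North \<in> A \<longleftrightarrow> midpoint c West \<in> A) \<and> (midpoint c South \<in> A \<longleftrightarrow> midpoint c East \<in> A)
    | Arcs_NE_SW \<Rightarrow> (midpoint c North \<in> A \<longleftrightarrow> midpoint c East \<in> A) \<and> (midpoint c South \<in> A \<longleftrightarrow> midpoint c West \<in> A)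
    | _ \<Rightarrow> False"
proof -
  have s: "{d, d'} \<in> strands (M c) \<longrightarrow> (midpoint c d \<in> A) = (midpoint c d' \<in> A)" for d d'
    using strandedD[OF A] by blast
  have o: "d \<in> \<Union> (strands (M c)) \<or> midpoint c d \<notin> A" for d
    using stranded_outside[OF _ A] M unfolding flat_def by blast
  show ?thesis
    using s[of North East] s[of North West] s[of South East] s[of South West] s[of West East] s[of North South]
      o[of North] o[of East] o[of South] o[of West] flatD[OF M, of c]
    by (cases "M c") simp_all
qed

text \<open>A strand meets two sides of its square, so the number of sides with midpoint in
  \<open>A\<close> is even; this is the relation around the square mod 2.\<close>

lemma stranded_weight:
  assumes M: "flat M" and A: "stranded M A"
  shows "weight (\<lambda>q. of_bool (q \<in> A) :: bit)"
proof
  have l: "link_diagram M" using M unfolding flat_def by blast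
  have sub: "A \<subseteq> points M" using A unfolding stranded_def by blast
  show "finite {p. (of_bool (p \<in> A) :: bit) \<noteq> 0}"
    by (rule finite_subset[OF _ finite_points[OF l]]) (use sub in auto)
  show "odd (fst p + snd p)" if "(of_bool (p \<in> A) :: bit) \<noteq> 0" for p
  proof -
    have "p \<in> A" using that by (cases "p \<in> A") simp_all
    then obtain c d where "p = midpoint c d" using sub unfolding points_def by blast
    then show ?thesis using midpoint_odd by simp
  qed
  fix c
  show "(of_bool (midpoint c South \<in> A) :: bit) - of_bool (midpoint c North \<in> A)
      = of_bool (midpoint c East \<in> A) - of_bool (midpoint c West \<in> A)"
    using stranded_tile[OF assms, of c] by (cases "M c") simp_all
qed

text \<open>\<open>inside\<close> is defined by vertical rays only. Here it becomes local and treats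
  all sides alike: the parity changes exactly across a point of \<open>A\<close>. All later
  statements about inside and outside rest on this.\<close>

lemma inside_corners:
  assumes M: "flat M" and A: "stranded M A"
  shows "inside A (c + c + (1, 1)) \<longleftrightarrow> inside A (c + c + (- 1, 1)) \<noteq> (midpoint c North \<in> A)"
  "inside A (c + c + (1, - 1)) \<longleftrightarrow> inside A (c + c + (- 1, - 1)) \<noteq> (midpoint c South \<in> A)"
  "inside A (c + c + (1, - 1)) \<longleftrightarrow> inside A (c + c + (1, 1)) \<noteq> (midpoint c East \<in> A)"
  "inside A (c + c + (- 1, - 1)) \<longleftrightarrow> inside A (c + c + (- 1, 1)) \<noteq> (midpoint c West \<in> A)"
proof -
  interpret weight "\<lambda>q. of_bool (q \<in> A) :: bit" by (rule stranded_weight[OF assms])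
  have "finite A"
    using M A finite_points finite_subset unfolding flat_def stranded_def by blast
  note i = inside_eq_potential[OF this]
  have e: "(x + of_bool b = (1::bit)) \<longleftrightarrow> (x = 1) \<noteq> b" for x b
    by (cases x) auto
  show "inside A (c + c + (1, 1)) \<longleftrightarrow> inside A (c + c + (- 1, 1)) \<noteq> (midpoint c North \<in> A)"
    unfolding i by (subst potential_corners) (rule e)
  show "inside A (c + c + (1, - 1)) \<longleftrightarrow> inside A (c + c + (- 1, - 1)) \<noteq> (midpoint c South \<in> A)"
    unfolding i by (subst potential_corners(2)) (rule e)
  show "inside A (c + c + (1, - 1)) \<longleftrightarrow> inside A (c + c + (1, 1)) \<noteq> (midpoint c East \<in> A)"
    unfolding i by (subst potential_corners(3)) (rule e)
  show "inside A (c + c + (- 1, - 1)) \<longleftrightarrow> inside A (c + c + (- 1, 1)) \<noteq> (midpoint c West \<in> A)"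
    unfolding i by (subst potential_corners(4)) (rule e)
qed

section \<open>Circles\<close>

lemma strand_neq: "{d, d'} \<in> strands t \<Longrightarrow> d \<noteq> d'"
  by (cases t) (auto simp: doubleton_eq_iff)

lemma strand_exists: "d \<in> \<Union> (strands t) \<Longrightarrow> \<exists>d'. {d, d'} \<in> strands t"
proof -
  assume "d \<in> \<Union> (strands t)"
  then obtain s where s: "s \<in> strands t" "d \<in> s" by blast
  obtain a b where "s = {a, b}" using s(1) by (cases t) auto
  then show ?thesis using s by (metis empty_iff insertE insert_commute)
qed

lemma strand_unique:
  assumes "t \<noteq> CrossH" "t \<noteq> CrossV" "{d, d'} \<in> strands t" "{d, d''} \<in> strands t"
  shows "d' = d''"
  using assms by (cases t; cases d) (auto simp: doubleton_eq_iff)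

lemma partner_eq:
  assumes "t \<noteq> CrossH" "t \<noteq> CrossV" "{d, d'} \<in> strands t"
  shows "partner t d = d'"
  unfolding partner_def
  by (rule the_equality) (use assms strand_unique strand_neq in blast)+

text \<open>Circles are named by points. The points are common to all resolutions, so one point
  names a circle at every vertex of the cube.\<close>

definition circ :: "diagram \<Rightarrow> point \<Rightarrow> circle"
  where "circ M r = (joined M)\<^sup>* `` {r}"

lemma joinedI: "{d, d'} \<in> strands (M c) \<Longrightarrow> (midpoint c d, midpoint c d') \<in> joined M"
  unfolding joined_def by blast

lemma sym_joined: "sym (joined M)"
proof (rule symI)
  fix p q assume "(p, q) \<in> joined M"
  then obtain c d d' where "p = midpoint c d" "q = midpoint c d'" "{d, d'} \<in> strands (M c)"
    unfolding joined_def by blast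
  then show "(q, p) \<in> joined M" using joinedI[of d' d M c] by (simp add: insert_commute)
qed

lemma joined_star_sym: "(p, q) \<in> (joined M)\<^sup>* \<Longrightarrow> (q, p) \<in> (joined M)\<^sup>*"
  using sym_joined sym_rtrancl symD by metis

lemma in_circ: "q \<in> circ M p \<longleftrightarrow> (p, q) \<in> (joined M)\<^sup>*"
  unfolding circ_def by blast

lemma circ_self [simp]: "p \<in> circ M p"
  by (simp add: in_circ)

lemma circ_eq_iff: "circ M p = circ M q \<longleftrightarrow> q \<in> circ M p"
proof
  assume "q \<in> circ M p"
  then have "(p, q) \<in> (joined M)\<^sup>*" "(q, p) \<in> (joined M)\<^sup>*"
    by (simp_all add: in_circ joined_star_sym)
  then show "circ M p = circ M q"
    by (auto simp: in_circ intro: rtrancl_trans)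
qed (metis circ_self)

lemma circ_disjoint: "circ M p \<noteq> circ M q \<Longrightarrow> circ M p \<inter> circ M q = {}"
  using circ_eq_iff by blast

lemma circ_joined: "{d, d'} \<in> strands (M c) \<Longrightarrow> circ M (midpoint c d) = circ M (midpoint c d')"
  unfolding circ_eq_iff in_circ by (blast intro: joinedI)

lemma Field_joined: "Field (joined M) = points M"
proof
  show "Field (joined M) \<subseteq> points M"
    unfolding Field_def joined_def points_def by blast
  show "points M \<subseteq> Field (joined M)"
  proof
    fix p assume "p \<in> points M"
    then obtain c d where p: "p = midpoint c d" "d \<in> \<Union> (strands (M c))"
      unfolding points_def by blast
    obtain d' where "{d, d'} \<in> strands (M c)" using strand_exists[OF p(2)] by blast
    then show "p \<in> Field (joined M)" unfolding p by (blast intro: joinedI FieldI1)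
  qed
qed

lemma circles_eq: "circles M = circ M ` points M"
  unfolding circles_def Field_joined circ_def ..

lemma circle_through_strand:
  assumes "{d, d'} \<in> strands (M c)"
  shows "circle_through M c {d, d'} = circ M (midpoint c d)"
proof -
  have "circle_through M c {d, d'} = circ M (midpoint c d) \<union> circ M (midpoint c d')"
    unfolding circle_through_def circ_def by auto
  then show ?thesis using circ_joined[of d d' M c] assms by simp
qed

lemma circ_subset:
  assumes "p \<in> points M"
  shows "circ M p \<subseteq> points M"
proof
  fix q assume "q \<in> circ M p"
  then have "(p, q) \<in> (joined M)\<^sup>*" by (simp add: in_circ)
  then show "q \<in> points M"
    using assms by (induction rule: rtrancl_induct) (auto simp flip: Field_joined intro: FieldI2)
qed

lemma stranded_circ:
  assumes "p \<in> points M"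
  shows "stranded M (circ M p)"
  unfolding stranded_def using circ_subset[OF assms] circ_joined circ_eq_iff by metis

section \<open>Oriented states\<close>

definition pt :: "square \<times> side \<Rightarrow> point"
  where "pt \<sigma> = midpoint (fst \<sigma>) (snd \<sigma>)"

text \<open>On entering through \<open>d\<close> the motion is in direction
  \<open>opposite d\<close>, whose left is \<open>- vec (rot d)\<close>. So this is the end of the
  side on the left hand.\<close>

definition left_of :: "square \<times> side \<Rightarrow> point"
  where "left_of \<sigma> = midpoint (fst \<sigma>) (snd \<sigma>) - vec (rot (snd \<sigma>))"

definition right_of :: "square \<times> side \<Rightarrow> point"
  where "right_of \<sigma> = midpoint (fst \<sigma>) (snd \<sigma>) + vec (rot (snd \<sigma>))"

lemma corner_simps:
  "left_of (c, East) = c + c + (1, - 1)" "right_of (c, East) = c + c + (1, 1)"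
  "left_of (c, North) = c + c + (1, 1)" "right_of (c, North) = c + c + (- 1, 1)"
  "left_of (c, West) = c + c + (- 1, 1)" "right_of (c, West) = c + c + (- 1, - 1)"
  "left_of (c, South) = c + c + (- 1, - 1)" "right_of (c, South) = c + c + (1, - 1)"
  by (simp_all add: left_of_def right_of_def midpoint_def prod_eq_iff)

lemma neighbour_simps:
  "pt (c + vec d, opposite d) = pt (c, d)"
  "left_of (c + vec d, opposite d) = right_of (c, d)"
  "right_of (c + vec d, opposite d) = left_of (c, d)"
  by (simp_all add: pt_def left_of_def right_of_def vec_rot_opposite)

lemma inside_across:
  assumes "flat M" "stranded M A"
  shows "inside A (right_of \<sigma>) \<longleftrightarrow> inside A (left_of \<sigma>) \<noteq> (pt \<sigma> \<in> A)"
proof -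
  obtain c d where "\<sigma> = (c, d)" by (metis surj_pair)
  then show ?thesis
    using inside_corners[OF assms, of c] by (cases d) (auto simp: corner_simps pt_def)
qed

text \<open>No strand runs between the two corners on the same hand of a strand. The state
  \<open>(c, d')\<close> looks back into the square from the exit, which exchanges left and
  right.\<close>

lemma inside_along:
  assumes M: "flat M" and A: "stranded M A" and dd: "{d, d'} \<in> strands (M c)"
  shows "inside A (right_of (c, d')) \<longleftrightarrow> inside A (left_of (c, d))"
    "inside A (left_of (c, d')) \<longleftrightarrow> inside A (right_of (c, d))"
proof -
  have "(inside A (right_of (c, d')) \<longleftrightarrow> inside A (left_of (c, d))) \<and>
    (inside A (left_of (c, d')) \<longleftrightarrow> inside A (right_of (c, d)))"
    using dd inside_corners[OF M A, of c] stranded_tile[OF M A, of c]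
    by (cases d; cases d'; cases "M c"; simp add: corner_simps doubleton_eq_iff; blast?)
  then show "inside A (right_of (c, d')) \<longleftrightarrow> inside A (left_of (c, d))"
    "inside A (left_of (c, d')) \<longleftrightarrow> inside A (right_of (c, d))" by blast+
qed

text \<open>These states traverse every strand in exactly one direction, so they orient all circles.\<close>

definition states :: "diagram \<Rightarrow> bool \<Rightarrow> (square \<times> side) set"
  where "states M b = {\<sigma>. snd \<sigma> \<in> \<Union> (strands (M (fst \<sigma>))) \<and> inside (points M) (left_of \<sigma>) = b}"

text \<open>Extended by the identity, so that it permutes the whole type in the sense of
  \<open>permutes\<close>.\<close>

definition step :: "diagram \<Rightarrow> bool \<Rightarrow> square \<times> side \<Rightarrow> square \<times> side"
  where "step M b \<sigma> = (if \<sigma> \<in> states M b then next_state M \<sigma> else \<sigma>)"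

lemma next_state_eq:
  assumes "flat M" "{d, d'} \<in> strands (M c)"
  shows "next_state M (c, d) = (c + vec d', opposite d')"
  using partner_eq[OF flatD[OF assms(1)] assms(2)] by (simp add: next_state_def)

lemma neighbour_side:
  "link_diagram M \<Longrightarrow> d \<in> \<Union> (strands (M c)) \<Longrightarrow> opposite d \<in> \<Union> (strands (M (c + vec d)))"
  unfolding link_diagram_def by blast

lemma next_state_inside:
  assumes "flat M" "stranded M A" "\<sigma> \<in> states M b"
  shows "inside A (left_of (next_state M \<sigma>)) \<longleftrightarrow> inside A (left_of \<sigma>)"
    "inside A (right_of (next_state M \<sigma>)) \<longleftrightarrow> inside A (right_of \<sigma>)"
proof -
  obtain c d where \<sigma>: "\<sigma> = (c, d)" by (metis surj_pair)
  obtain d' where "{d, d'} \<in> strands (M c)"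
    using strand_exists assms(3) by (auto simp: states_def \<sigma>)
  then show "inside A (left_of (next_state M \<sigma>)) \<longleftrightarrow> inside A (left_of \<sigma>)"
    "inside A (right_of (next_state M \<sigma>)) \<longleftrightarrow> inside A (right_of \<sigma>)"
    using inside_along[OF assms(1,2)] by (simp_all add: \<sigma> next_state_eq[OF assms(1)] neighbour_simps)
qed

lemma next_state_in_states:
  assumes "flat M" "\<sigma> \<in> states M b"
  shows "next_state M \<sigma> \<in> states M b"
proof -
  obtain c d where \<sigma>: "\<sigma> = (c, d)" by (metis surj_pair)
  obtain d' where dd: "{d, d'} \<in> strands (M c)"
    using strand_exists assms(2) by (auto simp: states_def \<sigma>)
  then have "d' \<in> \<Union> (strands (M c))" by blast
  then have "opposite d' \<in> \<Union> (strands (M (c + vec d')))"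
    using neighbour_side flat_link_diagram[OF assms(1)] by blast
  then show ?thesis
    using next_state_inside(1)[OF assms(1) stranded_points assms(2)] assms(2)
    by (auto simp: states_def \<sigma> next_state_eq[OF assms(1) dd])
qed

lemma pt_in_points: "\<sigma> \<in> states M b \<Longrightarrow> pt \<sigma> \<in> points M"
  unfolding states_def points_def pt_def by blast

text \<open>The two states at a point face each other, so the left corner of one is the right corner
  of the other; the point separates them, so their colours differ.\<close>

lemma inj_on_pt:
  assumes "flat M"
  shows "inj_on pt (states M b)"
proof (rule inj_onI)
  fix \<sigma> \<tau> assume *: "\<sigma> \<in> states M b" "\<tau> \<in> states M b" "pt \<sigma> = pt \<tau>"
  obtain c d where \<sigma>: "\<sigma> = (c, d)" by (metis surj_pair)
  obtain c' d' where \<tau>: "\<tau> = (c', d')" by (metis surj_pair)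
  have "c' = c + vec d \<and> d' = opposite d \<Longrightarrow> False"
    using * inside_across[OF assms stranded_points, of \<sigma>] pt_in_points[OF *(1)]
    by (simp add: states_def neighbour_simps \<sigma> \<tau>)
  then show "\<sigma> = \<tau>"
    using *(3) midpoint_eq_iff[of c d c' d'] by (auto simp: \<sigma> \<tau> pt_def)
qed

lemma finite_states: "flat M \<Longrightarrow> finite (states M b)"
  by (rule finite_imageD[OF finite_subset[OF _ finite_points] inj_on_pt])
    (auto intro: pt_in_points flat_link_diagram)

lemma points_state:
  assumes "flat M" "p \<in> points M"
  obtains \<sigma> where "\<sigma> \<in> states M b" "pt \<sigma> = p"
proof -
  obtain c d where p: "p = midpoint c d" "d \<in> \<Union> (strands (M c))"
    using assms unfolding points_def by blast
  have o: "opposite d \<in> \<Union> (strands (M (c + vec d)))"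
    using neighbour_side flat_link_diagram[OF assms(1)] p by blast
  show ?thesis
  proof (cases "inside (points M) (left_of (c, d)) = b")
    case True
    then show ?thesis using that[of "(c, d)"] p by (simp add: states_def pt_def)
  next
    case False
    then have "inside (points M) (right_of (c, d)) = b"
      using inside_across[OF assms(1) stranded_points, of "(c, d)"] assms(2) p by (simp add: pt_def)
    then show ?thesis
      using that[of "(c + vec d, opposite d)"] o p
      by (simp add: states_def neighbour_simps) (simp add: pt_def)
  qed
qed

text \<open>The exit determines the square and, without crossings, the strand and its entrance.
  Finiteness turns injectivity into bijectivity.\<close>

lemma step_permutes:
  assumes "flat M"
  shows "step M b permutes states M b"
proof (rule bij_imp_permutes)
  have "inj_on (next_state M) (states M b)"
  proof (rule inj_onI)
    fix \<sigma> \<tau> assume *: "\<sigma> \<in> states M b" "\<tau> \<in> states M b" "next_state M \<sigma> = next_state M \<tau>"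
    obtain c d where \<sigma>: "\<sigma> = (c, d)" by (metis surj_pair)
    obtain e f where \<tau>: "\<tau> = (e, f)" by (metis surj_pair)
    obtain d' f' where dd: "{d, d'} \<in> strands (M c)" "{f, f'} \<in> strands (M e)"
      using strand_exists[of d "M c"] strand_exists[of f "M e"] *(1,2)
      unfolding states_def \<sigma> \<tau> mem_Collect_eq fst_conv snd_conv by blast
    have eq: "c + vec d' = e + vec f'" "opposite d' = opposite f'"
      using *(3) next_state_eq[OF assms dd(1)] next_state_eq[OF assms dd(2)] by (simp_all add: \<sigma> \<tau>)
    then have "d' = f'" by (metis opposite_opposite)
    then have "c = e" using eq(1) by simp
    then show "\<sigma> = \<tau>"
      using strand_unique[OF flatD[OF assms], of d' d c f] dd \<open>d' = f'\<close>
      by (simp add: \<sigma> \<tau> insert_commute)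
  qed
  then have "inj_on (step M b) (states M b)"
    by (simp add: step_def inj_on_def)
  moreover have "step M b ` states M b \<subseteq> states M b"
    using next_state_in_states[OF assms] by (auto simp: step_def)
  ultimately show "bij_betw (step M b) (states M b) (states M b)"
    using endo_inj_surj[OF finite_states[OF assms]] by (simp add: bij_betw_def)
qed (simp add: step_def)

lemma step_permutation: "flat M \<Longrightarrow> permutation (step M b)"
  using step_permutes finite_states permutation_permutes by blast

lemma orbit_states:
  assumes "flat M" "\<sigma> \<in> states M b"
  shows "orbit (step M b) \<sigma> \<subseteq> states M b"
  using permutes_orbit_subset[OF step_permutes] assms by blast

text \<open>\<open>joined\<close> is symmetric while \<open>step\<close> has a direction; in the
  orbits of a permutation with finite support, predecessors are reached as well.\<close>

lemma circ_eq_orbit: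
  assumes M: "flat M" and \<sigma>: "\<sigma> \<in> states M b"
  shows "circ M (pt \<sigma>) = pt ` orbit (step M b) \<sigma>"
proof
  note self = permutation_self_in_orbit[OF step_permutation[OF M]]
  have step: "(pt \<tau>, pt (step M b \<tau>)) \<in> joined M" if \<tau>s: "\<tau> \<in> states M b" for \<tau>
  proof -
    obtain c d where \<tau>: "\<tau> = (c, d)" by (metis surj_pair)
    obtain d' where dd: "{d, d'} \<in> strands (M c)"
      using strand_exists \<tau>s by (auto simp: states_def \<tau>)
    then show ?thesis
      using \<tau>s joinedI[of d d' M c] dd by (simp add: step_def \<tau> next_state_eq[OF M dd] neighbour_simps) (simp add: pt_def)
  qed
  show "pt ` orbit (step M b) \<sigma> \<subseteq> circ M (pt \<sigma>)"
  proof
    fix p assume "p \<in> pt ` orbit (step M b) \<sigma>"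
    then obtain \<tau> where \<tau>: "\<tau> \<in> orbit (step M b) \<sigma>" "p = pt \<tau>" by blast
    from \<tau>(1) have "\<tau> \<in> states M b \<and> pt \<tau> \<in> circ M (pt \<sigma>)"
    proof (induction rule: orbit.induct)
      case base
      then show ?case
        using step[OF \<sigma>] next_state_in_states[OF M \<sigma>] \<sigma> by (auto simp: in_circ step_def)
    next
      case (step y)
      then show ?case
        using \<open>\<And>\<tau>. \<tau> \<in> states M b \<Longrightarrow> (pt \<tau>, pt (step M b \<tau>)) \<in> joined M\<close>[of y] next_state_in_states[OF M, of y]
        by (auto simp: in_circ step_def intro: rtrancl_into_rtrancl)
    qed
    then show "p \<in> circ M (pt \<sigma>)" by (simp add: \<tau>)
  qed
  show "circ M (pt \<sigma>) \<subseteq> pt ` orbit (step M b) \<sigma>"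
  proof
    fix p assume "p \<in> circ M (pt \<sigma>)"
    then have "(pt \<sigma>, p) \<in> (joined M)\<^sup>*" by (simp add: in_circ)
    then show "p \<in> pt ` orbit (step M b) \<sigma>"
    proof (induction rule: rtrancl_induct)
      case base
      then show ?case using self by blast
    next
      case (step p q)
      then obtain \<tau> where \<tau>: "\<tau> \<in> orbit (step M b) \<sigma>" "p = pt \<tau>" by blast
      then have st: "\<tau> \<in> states M b" using orbit_states[OF M \<sigma>] by blast
      obtain c d d' where pq: "p = midpoint c d" "q = midpoint c d'" "{d, d'} \<in> strands (M c)"
        using step.hyps(2) unfolding joined_def by blast
      show ?case
      proof (cases "(c, d) \<in> states M b")
        case True
        then have "\<tau> = (c, d)" using inj_onD[OF inj_on_pt[OF M]] st \<tau>(2) pq by (simp add: pt_def)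
        then have "q = pt (step M b \<tau>)"
          using True by (simp add: step_def next_state_eq[OF M pq(3)] neighbour_simps) (simp add: pq pt_def)
        then show ?thesis using orbit.step[OF \<tau>(1)] by blast
      next
        case False
        \<comment> \<open>Here the strand is travelled from \<open>d'\<close> to \<open>d\<close>,
          so the state at \<open>q\<close> is the predecessor of \<open>\<tau>\<close>.\<close>
        have sides: "d \<in> \<Union> (strands (M c))" "d' \<in> \<Union> (strands (M c))" using pq(3) by blast+
        have l: "inside (points M) (left_of (c, d)) \<noteq> b"
          using False sides(1) unfolding states_def mem_Collect_eq fst_conv snd_conv by blast
        moreover have "pt (c, d) \<in> points M"
          using midpoint_in_points[OF flat_link_diagram[OF M]] sides(1) unfolding pt_def by simp
        ultimately have "inside (points M) (left_of (c, d')) = b"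
          using inside_along(2)[OF M stranded_points pq(3)]
            inside_across[OF M stranded_points, of "(c, d)"] by blast
        then have st': "(c, d') \<in> states M b" using sides by (simp add: states_def)
        have "step M b (c, d') = (c + vec d, opposite d)"
          using st' next_state_eq[OF M, of d' d c] pq(3) by (simp add: step_def insert_commute)
        then have e: "pt (step M b (c, d')) = pt \<tau>"
          using \<tau>(2) pq(1) by (simp only: neighbour_simps) (simp add: pt_def)
        have "step M b (c, d') \<in> states M b"
          using st' next_state_in_states[OF M st'] by (simp add: step_def)
        then have "step M b (c, d') = \<tau>"
          using inj_onD[OF inj_on_pt[OF M] e] st by blast
        then have "(c, d') \<in> orbit (step M b) \<sigma>"
          using \<tau>(1) permutation_orbit_step[OF step_permutation[OF M]]
          by (metis orbit_swap orbit_trans self orbit.base)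
        then show ?thesis using pq(2) by (force simp: pt_def)
      qed
    qed
  qed
qed

lemma circ_orbit_iff:
  assumes "flat M" "\<sigma> \<in> states M b" "\<tau> \<in> states M b"
  shows "circ M (pt \<sigma>) = circ M (pt \<tau>) \<longleftrightarrow> \<tau> \<in> orbit (step M b) \<sigma>"
proof -
  have "pt \<tau> \<in> pt ` orbit (step M b) \<sigma> \<longleftrightarrow> \<tau> \<in> orbit (step M b) \<sigma>"
    using inj_on_image_mem_iff[OF inj_on_pt[OF assms(1)] assms(3) orbit_states[OF assms(1,2)]] .
  then show ?thesis using circ_eq_iff[of M "pt \<sigma>" "pt \<tau>"] circ_eq_orbit[OF assms(1,2)] by simp
qed

section \<open>Composing a permutation with a transposition\<close>

text \<open>The cycles of \<open>u\<close> and \<open>v\<close> are joined if they differ and cut if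
  they agree. A surgery has this form, with two opposite entrances of the crossing as
  \<open>u\<close> and \<open>v\<close>.\<close>

locale swapped =
  fixes f g :: "'a \<Rightarrow> 'a" and u v :: 'a
  assumes perm: "permutation f" and neq: "u \<noteq> v"
    and g_def: "g = f \<circ> transpose u v"
begin

lemma perm_g: "permutation g"
  unfolding g_def by (rule permutation_compose[OF perm permutation_swap_id])

lemma swapped_sym: "swapped g f u v"
proof
  show "permutation g" by (rule perm_g)
  show "u \<noteq> v" by (rule neq)
  show "f = g \<circ> transpose u v" by (simp add: g_def fun_eq_iff)
qed

lemma g_simps: "g u = f v" "g v = f u" "w \<noteq> u \<Longrightarrow> w \<noteq> v \<Longrightarrow> g w = f w"
  by (simp_all add: g_def)

lemma self: "w \<in> orbit f w" "w \<in> orbit g w"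
  by (rule permutation_self_in_orbit[OF perm], rule permutation_self_in_orbit[OF perm_g])

text \<open>From the exchanged start \<open>g\<close> agrees with \<open>f\<close> after one step,
  and then until \<open>u\<close> or \<open>v\<close> is met.\<close>

lemma funpow_g:
  assumes "\<And>j. 0 < j \<Longrightarrow> j < k \<Longrightarrow> (f ^^ j) w \<noteq> u \<and> (f ^^ j) w \<noteq> v"
    and "w \<in> {u, v}" and "0 < j" "j \<le> k"
  shows "(g ^^ j) (transpose u v w) = (f ^^ j) w"
  using assms(3,4)
proof (induction j)
  case (Suc j)
  show ?case
  proof (cases "j = 0")
    case True
    then show ?thesis using assms(2) by (auto simp: g_simps)
  next
    case False
    then have "(g ^^ j) (transpose u v w) = (f ^^ j) w" using Suc by simp
    then show ?thesis using assms(1)[of j] False Suc.prems by (simp add: g_simps)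
  qed
qed simp

lemma orbit_other:
  assumes "w \<notin> orbit f u" "w \<notin> orbit f v"
  shows "orbit g w = orbit f w"
proof -
  have *: "g y = f y" if "y \<in> orbit f w" for y
  proof -
    have "w \<in> orbit f y" using orbit_swap[OF self(1) that] .
    then have "y \<noteq> u" "y \<noteq> v" using assms by auto
    then show ?thesis by (rule g_simps(3))
  qed
  have 1: "y \<in> orbit g w" if "y \<in> orbit f w" for y
    using that
  proof (induction rule: orbit.induct)
    case base
    then show ?case using *[OF self(1)] orbit.base[of g w] by simp
  next
    case (step y)
    then show ?case using *[of y] orbit.step[of y g w] by simp
  qed
  have 2: "y \<in> orbit f w" if "y \<in> orbit g w" for y
    using that
  proof (induction rule: orbit.induct)
    case base
    then show ?case using *[OF self(1)] orbit.base[of f w] by simp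
  next
    case (step y)
    then show ?case using *[of y] orbit.step[of y f w] by simp
  qed
  show ?thesis using 1 2 by blast
qed

text \<open>Starting at \<open>u\<close>, \<open>g\<close> runs once around the old cycle of
  \<open>v\<close> and then along that of \<open>u\<close>.\<close>

lemma orbit_merge:
  assumes "v \<notin> orbit f u"
  shows "orbit g u = orbit f u \<union> orbit f v" "orbit g v = orbit f u \<union> orbit f v"
proof -
  have u: "u \<notin> orbit f v" using assms orbit_swap self(1) by metis
  \<comment> \<open>The first return of \<open>v\<close> under \<open>f\<close>: at this time
    \<open>g\<close> has come from \<open>u\<close> to \<open>v\<close>.\<close>
  obtain n where n: "0 < n" "(f ^^ n) v = v" "\<And>j. 0 < j \<Longrightarrow> j < n \<Longrightarrow> (f ^^ j) v \<noteq> v"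
  proof -
    have "\<exists>n. 0 < n \<and> (f ^^ n) v = v" using self(1)[of v] unfolding orbit_altdef by force
    then have "0 < (LEAST n. 0 < n \<and> (f ^^ n) v = v) \<and> (f ^^ (LEAST n. 0 < n \<and> (f ^^ n) v = v)) v = v"
      by (rule LeastI_ex)
    then show ?thesis
      using that[of "LEAST n. 0 < n \<and> (f ^^ n) v = v"] not_less_Least[of _ "\<lambda>n. 0 < n \<and> (f ^^ n) v = v"]
      by metis
  qed
  have "(f ^^ j) v \<noteq> u" if "0 < j" for j
    using u that unfolding orbit_altdef by blast
  then have v: "(g ^^ n) u = v"
    using funpow_g[of n v n] n by simp
  then have vu: "v \<in> orbit g u" unfolding orbit_altdef using n(1) by blast
  have closed: "orbit g y \<subseteq> orbit f u \<union> orbit f v" if y: "y \<in> orbit f u \<union> orbit f v" for y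
  proof
    have c: "g z \<in> orbit f u \<union> orbit f v" if "z \<in> orbit f u \<union> orbit f v" for z
      using that self(1)[of u] self(1)[of v] g_simps
      by (cases "z = u"; cases "z = v") (auto intro: orbit.intros)
    fix z assume "z \<in> orbit g y"
    then show "z \<in> orbit f u \<union> orbit f v"
      by (induction rule: orbit.induct) (use c y in blast)+
  qed
  interpret g: swapped g f u v by (rule swapped_sym)
  have eq: "orbit g u = orbit g v"
    using vu orbit_trans orbit_swap[OF self(2) vu] by (metis subsetI subset_antisym)
  have "orbit f u \<union> orbit f v \<subseteq> orbit g u"
  proof -
    have "y \<in> orbit g u" if "y \<in> orbit f u" for y
      using that
    proof (induction rule: orbit.induct)
      case base
      then show ?case using g_simps(2) vu orbit.step by metis
    next
      case (step y)
      have "y \<noteq> v" using assms step by blast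
      then show ?case
        using g_simps(2,3) vu step.IH orbit.step by metis
    qed
    moreover have "y \<in> orbit g u" if "y \<in> orbit f v" for y
      using that
    proof (induction rule: orbit.induct)
      case base
      then show ?case using g_simps(1) orbit.base by metis
    next
      case (step y)
      have "y \<noteq> u" using u step by blast
      then show ?case
        using g_simps(1,3) step.IH orbit.step orbit.base by metis
    qed
    ultimately show ?thesis by blast
  qed
  then show "orbit g u = orbit f u \<union> orbit f v"
    using closed[of u] self(1) by blast
  then show "orbit g v = orbit f u \<union> orbit f v" using eq by simp
qed

text \<open>From \<open>v\<close>, \<open>g\<close> repeats the \<open>k\<close> steps of
  \<open>f\<close> from \<open>u\<close> to \<open>v\<close> and closes up. The times are kept, and
  not only the set, since they yield the order in which the ends of two arcs are met.\<close>

lemma orbit_split: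
  assumes "v \<in> orbit f u"
  defines "k \<equiv> LEAST n. 0 < n \<and> (f ^^ n) u = v"
  shows "0 < k" "(f ^^ k) u = v" "orbit g v = {(f ^^ j) u | j. 0 < j \<and> j \<le> k}" "u \<notin> orbit g v"
proof -
  have ex: "\<exists>n. 0 < n \<and> (f ^^ n) u = v" using assms(1) unfolding orbit_altdef by force
  show k0: "0 < k" and kv: "(f ^^ k) u = v"
    using LeastI_ex[OF ex] by (simp_all add: k_def)
  have min: "(f ^^ j) u \<noteq> v" if "0 < j" "j < k" for j
    using not_less_Least[of j "\<lambda>n. 0 < n \<and> (f ^^ n) u = v"] that by (simp add: k_def)
  \<comment> \<open>An earlier return to \<open>u\<close> would lead to \<open>v\<close> before time
    \<open>k\<close>.\<close>
  have nu: "(f ^^ j) u \<noteq> u" if "0 < j" "j \<le> k" for j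
  proof
    assume *: "(f ^^ j) u = u"
    then have "j \<noteq> k" using kv neq by auto
    have "(f ^^ (k - j)) ((f ^^ j) u) = v"
      using kv that funpow_add[of "k - j" j f] by (simp add: o_def fun_eq_iff)
    then show False using * min[of "k - j"] that \<open>j \<noteq> k\<close> by simp
  qed
  have gj: "(g ^^ j) v = (f ^^ j) u" if "0 < j" "j \<le> k" for j
    using funpow_g[of k u j] min nu that by simp
  show orb: "orbit g v = {(f ^^ j) u | j. 0 < j \<and> j \<le> k}"
  proof
    show "{(f ^^ j) u | j. 0 < j \<and> j \<le> k} \<subseteq> orbit g v"
    proof
      fix y assume "y \<in> {(f ^^ j) u | j. 0 < j \<and> j \<le> k}"
      then obtain j where "y = (f ^^ j) u" "0 < j" "j \<le> k" by blast
      then have "y = (g ^^ j) v" "0 < j" using gj by simp_all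
      then show "y \<in> orbit g v" unfolding orbit_altdef by blast
    qed
    show "orbit g v \<subseteq> {(f ^^ j) u | j. 0 < j \<and> j \<le> k}"
    proof
      fix y assume "y \<in> orbit g v"
      then show "y \<in> {(f ^^ j) u | j. 0 < j \<and> j \<le> k}"
      proof (induction rule: orbit.induct)
        case base
        show ?case using k0 g_simps(2) by (auto intro!: exI[of _ 1])
      next
        case (step y)
        then obtain j where j: "y = (f ^^ j) u" "0 < j" "j \<le> k" by blast
        show ?case
        proof (cases "j = k")
          case True
          then show ?thesis using k0 g_simps(2) j kv by (auto intro!: exI[of _ 1])
        next
          case False
          then have "g y = (f ^^ Suc j) u" using j min[of j] nu[of j] by (simp add: g_simps(3))
          then show ?thesis using j False by (intro CollectI exI[of _ "Suc j"]) simp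
        qed
      qed
    qed
  qed
  show "u \<notin> orbit g v" unfolding orb mem_Collect_eq using nu by metis
qed

end

section \<open>Surgery\<close>

text \<open>The relation is symmetric in the two resolutions, so that statements about merging
  circles also describe splits when read backwards.\<close>

locale surgery =
  fixes M\<^sub>0 M\<^sub>1 :: diagram and x :: square
  assumes flat0: "flat M\<^sub>0" and flat1: "flat M\<^sub>1"
    and other: "\<And>c. c \<noteq> x \<Longrightarrow> M\<^sub>1 c = M\<^sub>0 c"
    and tiles: "{M\<^sub>0 x, M\<^sub>1 x} = {Arcs_NW_SE, Arcs_NE_SW}"
begin

lemma surgery_sym: "surgery M\<^sub>1 M\<^sub>0 x"
  by standard (use flat0 flat1 other tiles in auto)

lemma tile_cases:
  obtains "M\<^sub>0 x = Arcs_NW_SE" "M\<^sub>1 x = Arcs_NE_SW" | "M\<^sub>0 x = Arcs_NE_SW" "M\<^sub>1 x = Arcs_NW_SE"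
  using tiles by (auto simp: doubleton_eq_iff)

lemma all_sides: "d \<in> \<Union> (strands (M\<^sub>0 x))" "d \<in> \<Union> (strands (M\<^sub>1 x))"
proof -
  have "\<Union> (strands Arcs_NW_SE) = UNIV" "\<Union> (strands Arcs_NE_SW) = UNIV"
    by (auto simp: UNIV_side)
  then show "d \<in> \<Union> (strands (M\<^sub>0 x))" "d \<in> \<Union> (strands (M\<^sub>1 x))"
    by (metis UNIV_I tile_cases)+
qed

lemma points_eq: "points M\<^sub>1 = points M\<^sub>0"
proof -
  have "\<Union> (strands (M\<^sub>1 c)) = \<Union> (strands (M\<^sub>0 c))" for c
    using all_sides other[of c] by (cases "c = x") auto
  then show ?thesis by (simp add: points_def)
qed

text \<open>The colours, and with them the directions of travel, depend on the points only, and a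
  surgery keeps these.\<close>

lemma states_eq: "states M\<^sub>1 b = states M\<^sub>0 b"
proof -
  have "\<Union> (strands (M\<^sub>1 c)) = \<Union> (strands (M\<^sub>0 c))" for c
    using all_sides other[of c] by (cases "c = x") auto
  then show ?thesis by (simp add: states_def points_eq)
qed

lemma midpoint_point [simp]: "midpoint x d \<in> points M\<^sub>0" "midpoint x d \<in> points M\<^sub>1"
  using midpoint_in_points all_sides flat_link_diagram[OF flat0] flat_link_diagram[OF flat1] by blast+

text \<open>All four sides of \<open>x\<close> carry points, so the colours of its corners
  alternate.\<close>

lemma states_at:
  "(x, d') \<in> states M\<^sub>0 b \<longleftrightarrow> ((x, d) \<in> states M\<^sub>0 b \<longleftrightarrow> d' = d \<or> d' = opposite d)"
  using inside_corners[OF flat0 stranded_points, of x] all_sides(1)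
  by (cases d; cases d') (auto simp: states_def corner_simps)

lemma state_opposite: "(x, opposite d) \<in> states M\<^sub>0 b \<longleftrightarrow> (x, d) \<in> states M\<^sub>0 b"
  using states_at[of "opposite d" b d] by simp

lemma state_colour: "(x, d) \<in> states M\<^sub>0 (inside (points M\<^sub>0) (left_of (x, d)))"
  using all_sides by (auto simp: states_def)

text \<open>Exchanging opposite entrances turns one smoothing into the other; this makes the surgery
  a transposition.\<close>

lemma strand_switch: "{opposite d, d'} \<in> strands (M\<^sub>0 x) \<longleftrightarrow> {d, d'} \<in> strands (M\<^sub>1 x)"
proof -
  have "{opposite d, d'} \<in> strands Arcs_NW_SE \<longleftrightarrow> {d, d'} \<in> strands Arcs_NE_SW"
    "{opposite d, d'} \<in> strands Arcs_NE_SW \<longleftrightarrow> {d, d'} \<in> strands Arcs_NW_SE"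
    by (cases d; cases d'; simp add: doubleton_eq_iff)+
  then show ?thesis by (metis tile_cases)
qed

text \<open>Among the states at \<open>x\<close>, the colour \<open>b\<close> admits only the
  entrances \<open>d\<close> and \<open>opposite d\<close>, and the surgery exchanges what follows
  them.\<close>

lemma swapped_steps:
  assumes d: "(x, d) \<in> states M\<^sub>0 b"
  shows "swapped (step M\<^sub>0 b) (step M\<^sub>1 b) (x, d) (x, opposite d)"
proof
  show "permutation (step M\<^sub>0 b)" using step_permutation flat0 by blast
  show "(x, d) \<noteq> (x, opposite d)" by simp
  have eq: "next_state M\<^sub>1 (x, d) = next_state M\<^sub>0 (x, opposite d)" for d
  proof -
    obtain d' where "{d, d'} \<in> strands (M\<^sub>1 x)" using strand_exists all_sides by blast
    then show ?thesis
      using next_state_eq[OF flat1] next_state_eq[OF flat0] strand_switch by metis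
  qed
  show "step M\<^sub>1 b = step M\<^sub>0 b \<circ> transpose (x, d) (x, opposite d)"
  proof
    fix \<sigma>
    consider "\<sigma> = (x, d)" | "\<sigma> = (x, opposite d)" | "\<sigma> \<noteq> (x, d)" "\<sigma> \<noteq> (x, opposite d)" by blast
    then show "step M\<^sub>1 b \<sigma> = (step M\<^sub>0 b \<circ> transpose (x, d) (x, opposite d)) \<sigma>"
    proof cases
      case 1
      then show ?thesis using eq[of d] d state_opposite by (simp add: step_def states_eq)
    next
      case 2
      then show ?thesis using eq[of "opposite d"] d state_opposite by (simp add: step_def states_eq)
    next
      case 3
      have "next_state M\<^sub>1 \<sigma> = next_state M\<^sub>0 \<sigma>" if "\<sigma> \<in> states M\<^sub>0 b"
      proof -
        have "fst \<sigma> \<noteq> x"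
          using that 3 d states_at[of "snd \<sigma>" b d] by (metis prod.collapse)
        then show ?thesis using other[of "fst \<sigma>"] by (simp add: next_state_def split_beta)
      qed
      then show ?thesis using 3 by (simp add: step_def states_eq)
    qed
  qed
qed

lemma circ_merge:
  assumes distinct: "circ M\<^sub>0 (midpoint x d) \<noteq> circ M\<^sub>0 (midpoint x (opposite d))" and p: "p \<in> points M\<^sub>0"
  shows "circ M\<^sub>1 p = (if p \<in> circ M\<^sub>0 (midpoint x d) \<union> circ M\<^sub>0 (midpoint x (opposite d))
    then circ M\<^sub>0 (midpoint x d) \<union> circ M\<^sub>0 (midpoint x (opposite d)) else circ M\<^sub>0 p)"
proof -
  define b where "b = inside (points M\<^sub>0) (left_of (x, d))"
  have d: "(x, d) \<in> states M\<^sub>0 b" "(x, opposite d) \<in> states M\<^sub>0 b"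
    using state_colour state_opposite by (simp_all add: b_def)
  interpret swapped "step M\<^sub>0 b" "step M\<^sub>1 b" "(x, d)" "(x, opposite d)"
    by (rule swapped_steps[OF d(1)])
  note iff0 = circ_orbit_iff[OF flat0, of _ b]
  note iff1 = circ_orbit_iff[OF flat1, of _ b, unfolded states_eq]
  have pt: "midpoint x d = pt (x, d)" "midpoint x (opposite d) = pt (x, opposite d)"
    by (simp_all add: pt_def)
  have m: "(x, opposite d) \<notin> orbit (step M\<^sub>0 b) (x, d)"
    using distinct iff0[OF d] unfolding pt by blast
  obtain \<sigma> where \<sigma>: "\<sigma> \<in> states M\<^sub>0 b" "pt \<sigma> = p" using points_state[OF flat0 p] .
  have o0: "circ M\<^sub>0 (pt \<tau>) = pt ` orbit (step M\<^sub>0 b) \<tau>" if "\<tau> \<in> states M\<^sub>0 b" for \<tau>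
    using circ_eq_orbit[OF flat0 that] .
  have o1: "circ M\<^sub>1 (pt \<tau>) = pt ` orbit (step M\<^sub>1 b) \<tau>" if "\<tau> \<in> states M\<^sub>0 b" for \<tau>
    using circ_eq_orbit[OF flat1] that states_eq by blast
  have in0: "p \<in> circ M\<^sub>0 (pt \<tau>) \<longleftrightarrow> \<sigma> \<in> orbit (step M\<^sub>0 b) \<tau>" if "\<tau> \<in> states M\<^sub>0 b" for \<tau>
    using iff0[OF that \<sigma>(1)] circ_eq_iff \<sigma>(2) by metis
  show ?thesis
  proof (cases "p \<in> circ M\<^sub>0 (midpoint x d) \<union> circ M\<^sub>0 (midpoint x (opposite d))")
    case True
    then have "\<sigma> \<in> orbit (step M\<^sub>0 b) (x, d) \<union> orbit (step M\<^sub>0 b) (x, opposite d)"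
      using in0 d unfolding pt by blast
    then have "\<sigma> \<in> orbit (step M\<^sub>1 b) (x, d)" using orbit_merge(1)[OF m] by simp
    then have "circ M\<^sub>1 p = circ M\<^sub>1 (pt (x, d))" using iff1[OF d(1) \<sigma>(1)] \<sigma>(2) by simp
    also have "\<dots> = pt ` (orbit (step M\<^sub>0 b) (x, d) \<union> orbit (step M\<^sub>0 b) (x, opposite d))"
      using o1[OF d(1)] orbit_merge(1)[OF m] by simp
    also have "\<dots> = circ M\<^sub>0 (midpoint x d) \<union> circ M\<^sub>0 (midpoint x (opposite d))"
      unfolding pt o0[OF d(1)] o0[OF d(2)] by blast
    finally show ?thesis using True by simp
  next
    case False
    then have "\<sigma> \<notin> orbit (step M\<^sub>0 b) (x, d)" "\<sigma> \<notin> orbit (step M\<^sub>0 b) (x, opposite d)"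
      using in0 d unfolding pt by blast+
    then have "orbit (step M\<^sub>1 b) \<sigma> = orbit (step M\<^sub>0 b) \<sigma>" by (rule orbit_other)
    then have "circ M\<^sub>1 p = circ M\<^sub>0 p" using o0[OF \<sigma>(1)] o1[OF \<sigma>(1)] \<sigma>(2) by simp
    then show ?thesis using False by simp
  qed
qed

lemma circ_split:
  assumes eq: "circ M\<^sub>0 (midpoint x d) = circ M\<^sub>0 (midpoint x (opposite d))"
  shows "circ M\<^sub>1 (midpoint x d) \<noteq> circ M\<^sub>1 (midpoint x (opposite d))"
proof -
  define b where "b = inside (points M\<^sub>0) (left_of (x, d))"
  have d: "(x, d) \<in> states M\<^sub>0 b" "(x, opposite d) \<in> states M\<^sub>0 b"
    using state_colour state_opposite by (simp_all add: b_def)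
  interpret swapped "step M\<^sub>0 b" "step M\<^sub>1 b" "(x, d)" "(x, opposite d)"
    by (rule swapped_steps[OF d(1)])
  have "(x, opposite d) \<in> orbit (step M\<^sub>0 b) (x, d)"
    using eq circ_orbit_iff[OF flat0 d] by (simp add: pt_def)
  then have "(x, d) \<notin> orbit (step M\<^sub>1 b) (x, opposite d)" by (rule orbit_split(4))
  then show ?thesis
    using circ_orbit_iff[OF flat1, of "(x, opposite d)" b "(x, d)"] d by (auto simp: pt_def states_eq)
qed

end

section \<open>Interleaved arcs\<close>

lemma corner_eq: "right_of (c, d) = left_of (c, rot d)"
  by (cases d) (simp_all add: corner_simps)

lemma rot_simps [simp]: "rot (rot d) = opposite d" "rot d \<noteq> d" "rot d \<noteq> opposite d"
    "opposite d \<noteq> rot d" "rot (opposite d) = opposite (rot d)" "opposite (rot d) \<noteq> d" "d \<noteq> rot d" "d \<noteq> opposite (rot d)"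
  by (cases d; simp)+

lemma opposite_eq_iff [simp]: "opposite d = opposite e \<longleftrightarrow> d = e"
  by (metis opposite_opposite)

lemma rot_eq_iff [simp]: "rot d = rot e \<longleftrightarrow> d = e"
  by (cases d; cases e; simp)

lemma side_compl: "- {d, rot d} = {opposite d, opposite (rot d)}"
  by (cases d) (use UNIV_side in auto)

lemma corner_set_eq: "{d, rot d} = {e, rot e} \<longleftrightarrow> d = e"
  by (cases d; cases e; simp add: doubleton_eq_iff)

lemma arc_inside_corner:
  assumes "arr x = {d, rot d}"
  shows "arc_inside a arr x \<longleftrightarrow> inside a (right_of (x, rot d))"
proof -
  have "x + x + (\<Sum>d \<in> rot ` arr x. vec d) = right_of (x, rot d)"
    unfolding assms by (cases d) (simp_all add: right_of_def midpoint_def algebra_simps)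
  then show ?thesis unfolding arc_inside_def by simp
qed

lemma counterclockwise_left: "counterclockwise a \<sigma> \<longleftrightarrow> inside a (left_of \<sigma>)"
  by (cases \<sigma>) (simp add: counterclockwise_def left_of_def vec_opposite)

lemma stranded_circ_iff:
  assumes "stranded M A" "circ M p = circ M q"
  shows "p \<in> A \<longleftrightarrow> q \<in> A"
proof -
  have *: "q \<in> A" if "(p, q) \<in> (joined M)\<^sup>*" "p \<in> A" for p q
    using that
  proof (induction rule: rtrancl_induct)
    case (step q r)
    then show ?case using strandedD[OF assms(1)] unfolding joined_def by blast
  qed
  show ?thesis using * assms(2) circ_eq_iff[of M p q] circ_eq_iff[of M q p] unfolding in_circ by metis
qed

lemma inside_orbit:
  assumes "flat M" "stranded M A" "\<sigma> \<in> states M b" "\<tau> \<in> orbit (step M b) \<sigma>"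
  shows "inside A (left_of \<tau>) \<longleftrightarrow> inside A (left_of \<sigma>)"
  using assms(4)
proof (induction rule: orbit.induct)
  case base
  then show ?case using next_state_inside[OF assms(1-3)] assms(3) by (simp add: step_def)
next
  case (step \<tau>)
  then have "\<tau> \<in> states M b" using orbit_states[OF assms(1,3)] by blast
  then show ?case using next_state_inside[OF assms(1,2)] step by (simp add: step_def)
qed

lemma reverse_state:
  assumes "flat M" "\<tau> \<in> states M b'" "b' \<noteq> b"
  obtains \<tau>' where "\<tau>' \<in> states M b" "pt \<tau>' = pt \<tau>" "left_of \<tau>' = right_of \<tau>"
proof -
  obtain c d where \<tau>: "\<tau> = (c, d)" by (metis surj_pair)
  have d: "d \<in> \<Union> (strands (M c))" using assms(2) by (simp add: states_def \<tau>)
  have "inside (points M) (right_of \<tau>) = b"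
    using inside_across[OF assms(1) stranded_points, of \<tau>] assms(2,3) pt_in_points[OF assms(2)]
    by (auto simp: states_def)
  then have "(c + vec d, opposite d) \<in> states M b"
    using neighbour_side[OF flat_link_diagram[OF assms(1)] d] unfolding states_def
    by (simp add: neighbour_simps \<tau>)
  then show ?thesis using that neighbour_simps by (simp add: \<tau>)
qed

text \<open>A circle that misses \<open>A\<close> never crosses it, so the parity with respect to
  \<open>A\<close> is the same beside all its points, on either hand.\<close>

lemma inside_same_circle:
  assumes M: "flat M" and A: "stranded M A" and st: "\<sigma> \<in> states M b" "\<tau> \<in> states M b'"
    and c: "circ M (pt \<sigma>) = circ M (pt \<tau>)" and o: "pt \<sigma> \<notin> A"
  shows "inside A (left_of \<tau>) \<longleftrightarrow> inside A (left_of \<sigma>)"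
    "inside A (right_of \<tau>) \<longleftrightarrow> inside A (left_of \<sigma>)"
proof -
  have "pt \<tau> \<notin> A" using stranded_circ_iff[OF A c] o by simp
  then have lr: "inside A (right_of \<tau>) \<longleftrightarrow> inside A (left_of \<tau>)"
    using inside_across[OF M A] by simp
  show "inside A (left_of \<tau>) \<longleftrightarrow> inside A (left_of \<sigma>)"
  proof (cases "b' = b")
    case True
    then show ?thesis using circ_orbit_iff[OF M st(1)] st(2) c inside_orbit[OF M A st(1)] by blast
  next
    case False
    then obtain \<tau>' where \<tau>': "\<tau>' \<in> states M b" "pt \<tau>' = pt \<tau>" "left_of \<tau>' = right_of \<tau>"
      using reverse_state[OF M st(2)] by blast
    then have "inside A (left_of \<tau>') \<longleftrightarrow> inside A (left_of \<sigma>)"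
      using circ_orbit_iff[OF M st(1)] c inside_orbit[OF M A st(1)] by metis
    then show ?thesis using \<tau>'(3) lr by simp
  qed
  then show "inside A (right_of \<tau>) \<longleftrightarrow> inside A (left_of \<sigma>)" using lr by simp
qed

text \<open>Each colour travels a circle in one direction, and the inside is on the left for only
  one of the two directions. This links \<open>counterclockwise\<close> to the permutation
  \<open>step\<close>.\<close>

lemma same_colour:
  assumes M: "flat M" and st: "\<sigma> \<in> states M b" "\<tau> \<in> states M b'"
    and c: "circ M (pt \<sigma>) = circ M (pt \<tau>)"
    and i: "inside (circ M (pt \<sigma>)) (left_of \<sigma>) \<longleftrightarrow> inside (circ M (pt \<sigma>)) (left_of \<tau>)"
  shows "b' = b"
proof (rule ccontr)
  assume "b' \<noteq> b"
  then obtain \<tau>' where \<tau>': "\<tau>' \<in> states M b" "pt \<tau>' = pt \<tau>" "left_of \<tau>' = right_of \<tau>"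
    using reverse_state[OF M st(2)] by blast
  have A: "stranded M (circ M (pt \<sigma>))" using stranded_circ pt_in_points[OF st(1)] by blast
  have "inside (circ M (pt \<sigma>)) (left_of \<tau>') \<longleftrightarrow> inside (circ M (pt \<sigma>)) (left_of \<sigma>)"
    using circ_orbit_iff[OF M st(1)] \<tau>' c inside_orbit[OF M A st(1)] by metis
  moreover have "inside (circ M (pt \<sigma>)) (right_of \<tau>) \<longleftrightarrow> \<not> inside (circ M (pt \<sigma>)) (left_of \<tau>)"
    using inside_across[OF M A, of \<tau>] c by simp
  ultimately show False using \<tau>'(3) i by simp
qed

lemma inside_Un:
  assumes "finite A" "finite B" "A \<inter> B = {}"
  shows "inside (A \<union> B) p \<longleftrightarrow> inside A p \<noteq> inside B p"
proof -
  have fin: "finite {y. snd p < y \<and> (fst p, y) \<in> C}" if "finite C" for C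
    by (rule finite_subset[of _ "snd ` C"]) (auto simp: that intro: rev_image_eqI)
  have "{y. snd p < y \<and> (fst p, y) \<in> A \<union> B} =
      {y. snd p < y \<and> (fst p, y) \<in> A} \<union> {y. snd p < y \<and> (fst p, y) \<in> B}" by blast
  then have "card {y. snd p < y \<and> (fst p, y) \<in> A \<union> B} =
      card {y. snd p < y \<and> (fst p, y) \<in> A} + card {y. snd p < y \<and> (fst p, y) \<in> B}"
    using assms by (auto intro: card_Un_disjoint fin)
  then show ?thesis unfolding inside_def by simp
qed

text \<open>Interleaved arcs with arrow tails on the strands \<open>{d, rot d}\<close> and
  \<open>{e, rot e}\<close>. Interleaving is expressed by \<open>merge_y\<close> without an order on
  the circle: the surgery at \<open>x\<close> separates the ends of the arc at
  \<open>y\<close>.\<close>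

locale two_arcs = surgery +
  fixes y :: square and d e :: side
  assumes xy: "y \<noteq> x"
    and strands_x: "{d, rot d} \<in> strands (M\<^sub>0 x)"
    and tile_y: "M\<^sub>0 y \<in> {Arcs_NW_SE, Arcs_NE_SW}"
    and strands_y: "{e, rot e} \<in> strands (M\<^sub>0 y)"
    and circ_x: "circ M\<^sub>0 (midpoint x d) = circ M\<^sub>0 (midpoint x (opposite d))"
    and circ_y: "circ M\<^sub>0 (midpoint y e) = circ M\<^sub>0 (midpoint x d)"
      "circ M\<^sub>0 (midpoint y (opposite e)) = circ M\<^sub>0 (midpoint x d)"
    and merge_y: "circ M\<^sub>1 (midpoint y e) \<noteq> circ M\<^sub>1 (midpoint y (opposite e))"
begin

abbreviation "a \<equiv> circ M\<^sub>0 (midpoint x d)"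
abbreviation "b\<^sub>1 \<equiv> circ M\<^sub>1 (midpoint x d)"
abbreviation "b\<^sub>2 \<equiv> circ M\<^sub>1 (midpoint x (opposite d))"

lemma y_side: "f \<in> \<Union> (strands (M\<^sub>0 y))"
proof -
  have "\<Union> (strands Arcs_NW_SE) = UNIV" "\<Union> (strands Arcs_NE_SW) = UNIV"
    by (auto simp: UNIV_side)
  then show ?thesis using tile_y by auto
qed

lemma y_state: "(y, f) \<in> states M\<^sub>0 (inside (points M\<^sub>0) (left_of (y, f)))"
  using y_side by (simp add: states_def)

lemma b_neq: "b\<^sub>1 \<noteq> b\<^sub>2"
  by (rule circ_split[OF circ_x])

lemma circ_in_a:
  assumes "p \<in> a"
  shows "circ M\<^sub>1 p = b\<^sub>1 \<or> circ M\<^sub>1 p = b\<^sub>2"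
proof -
  interpret s: surgery M\<^sub>1 M\<^sub>0 x by (rule surgery_sym)
  have "a = b\<^sub>1 \<union> b\<^sub>2" using s.circ_merge[OF b_neq, of "midpoint x d"] by simp
  then show ?thesis using assms circ_eq_iff by blast
qed

lemma a_eq: "a = b\<^sub>1 \<union> b\<^sub>2"
proof -
  interpret s: surgery M\<^sub>1 M\<^sub>0 x by (rule surgery_sym)
  show ?thesis using s.circ_merge[OF b_neq, of "midpoint x d"] by simp
qed

lemma y_circs:
  "circ M\<^sub>1 (midpoint y e) = b\<^sub>1 \<and> circ M\<^sub>1 (midpoint y (opposite e)) = b\<^sub>2 \<or>
   circ M\<^sub>1 (midpoint y e) = b\<^sub>2 \<and> circ M\<^sub>1 (midpoint y (opposite e)) = b\<^sub>1"
  using circ_in_a[of "midpoint y e"] circ_in_a[of "midpoint y (opposite e)"] merge_y circ_y circ_eq_iff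
  by metis

lemma y_circ_rot: "circ M\<^sub>1 (midpoint y (rot e)) = circ M\<^sub>1 (midpoint y e)"
  using circ_joined[of e "rot e" M\<^sub>1 y] strands_y other[OF xy] by simp

text \<open>After the surgery both the arc at \<open>y\<close> and the rotated arc at
  \<open>x\<close> join \<open>b\<^sub>1\<close> to \<open>b\<^sub>2\<close>. Each of these circles
  misses the other and passes beside both arcs, so the arcs lie on the same side of either circle
  and hence of their union \<open>a\<close>. The arc at \<open>x\<close> itself is across one strand
  of \<open>a\<close> from its rotation.\<close>

lemma inside_opposite: "inside a (right_of (x, rot d)) \<noteq> inside a (right_of (y, rot e))"
proof -
  have st: "stranded M\<^sub>1 b\<^sub>1" "stranded M\<^sub>1 b\<^sub>2" by (simp_all add: stranded_circ)
  have fin: "finite b\<^sub>1" "finite b\<^sub>2"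
    using st finite_points[OF flat_link_diagram[OF flat1]] finite_subset unfolding stranded_def by metis+
  have disj: "b\<^sub>1 \<inter> b\<^sub>2 = {}" using circ_disjoint[OF b_neq] .
  have xs: "(x, f) \<in> states M\<^sub>1 (inside (points M\<^sub>0) (left_of (x, f)))" for f
    using state_colour states_eq by blast
  have ys: "(y, f) \<in> states M\<^sub>1 (inside (points M\<^sub>0) (left_of (y, f)))" for f
    using y_state states_eq by blast
  have rd: "circ M\<^sub>1 (midpoint x (rot d)) = b\<^sub>2"
    using circ_joined[of "opposite d" "rot d" M\<^sub>1 x] strand_switch[of "opposite d" "rot d"] strands_x by simp
  \<comment> \<open>\<open>K\<close> is a corner in the region of the arc at \<open>y\<close>, and
    \<open>E\<close> one in the region of the rotated arc at \<open>x\<close>.\<close>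
  define K where "K = right_of (y, rot e)"
  define E where "E = right_of (x, d)"
  have K: "K = left_of (y, opposite e)" unfolding K_def corner_eq by simp
  have E: "E = left_of (x, rot d)" unfolding E_def corner_eq ..
  have enc: "inside A K \<longleftrightarrow> inside A E"
    if A: "stranded M\<^sub>1 A" "f \<in> {d, rot d}" "midpoint x f \<notin> A"
      "g = rot e \<or> g = opposite e" "circ M\<^sub>1 (midpoint y g) = circ M\<^sub>1 (midpoint x f)" for A f g
  proof -
    have p: "pt (x, f) \<notin> A" "circ M\<^sub>1 (pt (x, f)) = circ M\<^sub>1 (pt (y, g))"
      using A by (simp_all add: pt_def)
    note i = inside_same_circle[OF flat1 A(1) xs[of f] ys[of g] p(2) p(1)]
    note j = inside_same_circle[OF flat1 A(1) xs[of f] xs[of f] refl p(1)]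
    have "inside A K \<longleftrightarrow> inside A (left_of (x, f))"
      using A(4) i K K_def by metis
    also have "\<dots> \<longleftrightarrow> inside A E"
      using A(2) j E E_def by (metis insertE singletonD)
    finally show ?thesis .
  qed
  have n: "midpoint x (rot d) \<notin> b\<^sub>1" "midpoint x d \<notin> b\<^sub>2"
    using rd b_neq circ_eq_iff by metis+
  have 1: "inside b\<^sub>1 K \<longleftrightarrow> inside b\<^sub>1 E"
    using enc[OF st(1), of "rot d"] n rd y_circs y_circ_rot by auto
  have 2: "inside b\<^sub>2 K \<longleftrightarrow> inside b\<^sub>2 E"
    using enc[OF st(2), of d] n y_circs y_circ_rot by auto
  have "inside a K \<longleftrightarrow> inside a E"
    unfolding a_eq inside_Un[OF fin disj] 1 2 ..
  moreover have "inside a (right_of (x, rot d)) \<noteq> inside a E"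
  proof -
    have "circ M\<^sub>0 (midpoint x (rot d)) = a"
      using circ_joined[of d "rot d" M\<^sub>0 x] strands_x by simp
    then have "pt (x, rot d) \<in> a" by (metis circ_self fst_conv pt_def snd_conv)
    then show ?thesis
      using inside_across[OF flat0 stranded_circ, of "midpoint x d" "(x, rot d)"] E by simp
  qed
  ultimately show ?thesis unfolding K_def by blast
qed


text \<open>The hypotheses do not see the directions of the arrows, so every statement about a tail
  has a counterpart for the head.\<close>

lemma flip_d: "two_arcs M\<^sub>0 M\<^sub>1 x y (opposite d) e"
proof
  show "{opposite d, rot (opposite d)} \<in> strands (M\<^sub>0 x)"
    using strands_x by (rule_tac tile_cases; cases d; simp add: doubleton_eq_iff)
qed (use xy tile_y strands_y circ_x circ_y merge_y in simp_all)

lemma flip_e: "two_arcs M\<^sub>0 M\<^sub>1 x y d (opposite e)"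
proof
  show "{opposite e, rot (opposite e)} \<in> strands (M\<^sub>0 y)"
    using strands_y tile_y by (cases e) (auto simp: doubleton_eq_iff)
qed (use xy tile_y strands_x circ_x circ_y merge_y in auto)

text \<open>\<open>left_of (x, d)\<close> is the corner belonging to the reversed arrow, and both
  corners are on the other side from the arc at \<open>y\<close>. So the state \<open>(x, d)\<close>
  is counterclockwise exactly if the arc at \<open>x\<close> is inside.\<close>

lemma left_x: "inside a (left_of (x, d)) \<longleftrightarrow> inside a (right_of (x, rot d))"
proof -
  interpret f: two_arcs M\<^sub>0 M\<^sub>1 x y "opposite d" e by (rule flip_d)
  show ?thesis
    using f.inside_opposite inside_opposite circ_x corner_eq[of x "opposite (rot d)"] by auto
qed

abbreviation "b \<equiv> inside (points M\<^sub>0) (left_of (x, d))"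

lemma x_state: "(x, d) \<in> states M\<^sub>0 b"
  by (rule state_colour)

text \<open>Counterclockwise travel keeps the inside on the left. The arc at \<open>y\<close> is
  outside, so its tail strand is entered at \<open>rot e\<close>, where that arc is on the
  right.\<close>

lemma y_in_states:
  assumes "inside a (right_of (x, rot d))"
  shows "(y, rot e) \<in> states M\<^sub>0 b"
proof -
  have r: "circ M\<^sub>0 (midpoint y (rot e)) = a"
    using circ_joined[of e "rot e" M\<^sub>0 y] strands_y circ_y by simp
  then have "midpoint y (rot e) \<in> a" using circ_eq_iff by metis
  then have "inside a (left_of (y, rot e))"
    using inside_across[OF flat0 stranded_circ, of "midpoint x d" "(y, rot e)"] inside_opposite assms
    by (simp add: pt_def)
  then have "inside (points M\<^sub>0) (left_of (y, rot e)) = b"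
    using same_colour[OF flat0 x_state y_state] r assms left_x by (simp add: pt_def)
  then show ?thesis using y_state[of "rot e"] by simp
qed

lemma y_notin_states:
  assumes "inside a (right_of (x, rot d))"
  shows "(y, e) \<notin> states M\<^sub>0 b"
proof
  assume *: "(y, e) \<in> states M\<^sub>0 b"
  interpret f: two_arcs M\<^sub>0 M\<^sub>1 x y d "opposite e" by (rule flip_e)
  have "\<not> inside a (left_of (y, e))"
    using f.inside_opposite assms corner_eq[of y "opposite (rot e)"] by simp
  moreover have "(y, e) \<in> orbit (step M\<^sub>0 b) (x, d)"
    using circ_orbit_iff[OF flat0 x_state *] circ_y(1) by (simp add: pt_def)
  ultimately show False
    using inside_orbit[OF flat0 stranded_circ x_state, of "midpoint x d" "(y, e)"] assms left_x by simp
qed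

text \<open>A strand may be met through either of its sides, but the colour of the walk leaves only
  the entrance \<open>t\<close>; the time becomes one for the permutation
  \<open>step\<close>.\<close>

lemma meeting_time_eq:
  assumes "\<And>s. s \<in> S \<Longrightarrow> (c, s) \<in> states M\<^sub>0 b \<longleftrightarrow> s = t" "t \<in> S"
  shows "meeting_time M\<^sub>0 (x, d) c S = (LEAST n. 0 < n \<and> (step M\<^sub>0 b ^^ n) (x, d) = (c, t))"
proof -
  have n: "(next_state M\<^sub>0 ^^ n) (x, d) = (step M\<^sub>0 b ^^ n) (x, d) \<and> (step M\<^sub>0 b ^^ n) (x, d) \<in> states M\<^sub>0 b" for n
  proof (induction n)
    case (Suc n)
    then show ?case using next_state_in_states[OF flat0] by (simp add: step_def)
  qed (simp add: x_state)
  have "(next_state M\<^sub>0 ^^ n) (x, d) \<in> {c} \<times> S \<longleftrightarrow> (step M\<^sub>0 b ^^ n) (x, d) = (c, t)" for n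
    using n[of n] assms by (cases "(step M\<^sub>0 b ^^ n) (x, d)") auto
  then show ?thesis unfolding meeting_time_def by simp
qed

text \<open>Up to the head of the arrow at \<open>x\<close>, the walk covers what becomes the orbit
  of \<open>(x, opposite d)\<close> after the surgery, which is the circle \<open>b\<^sub>2\<close>.
  The tail strand of \<open>y\<close> is on it and the head strand is not, so one is met earlier and
  the other later.\<close>

lemma meeting_order:
  assumes i: "inside a (right_of (x, rot d))" and e: "circ M\<^sub>1 (midpoint y e) = b\<^sub>2"
  shows "meeting_time M\<^sub>0 (x, d) y {e, rot e} < meeting_time M\<^sub>0 (x, d) x (- {d, rot d})"
    "meeting_time M\<^sub>0 (x, d) x (- {d, rot d}) < meeting_time M\<^sub>0 (x, d) y (- {e, rot e})"
proof -
  interpret f: two_arcs M\<^sub>0 M\<^sub>1 x y d "opposite e" by (rule flip_e)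
  interpret s: swapped "step M\<^sub>0 b" "step M\<^sub>1 b" "(x, d)" "(x, opposite d)"
    by (rule swapped_steps[OF x_state])
  define k where "k = (LEAST n. 0 < n \<and> (step M\<^sub>0 b ^^ n) (x, d) = (x, opposite d))"
  have xo: "(x, opposite d) \<in> states M\<^sub>0 b" using x_state state_opposite by blast
  have ye: "(y, rot e) \<in> states M\<^sub>0 b" "(y, e) \<notin> states M\<^sub>0 b"
    "(y, opposite (rot e)) \<in> states M\<^sub>0 b" "(y, opposite e) \<notin> states M\<^sub>0 b"
    using y_in_states y_notin_states f.y_in_states f.y_notin_states i by simp_all
  have "(x, opposite d) \<in> orbit (step M\<^sub>0 b) (x, d)"
    using circ_orbit_iff[OF flat0 x_state xo] circ_x by (simp add: pt_def)
  note split = s.orbit_split[OF this, folded k_def]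
  have o1: "(y, f) \<in> orbit (step M\<^sub>1 b) (x, opposite d) \<longleftrightarrow> circ M\<^sub>1 (midpoint y f) = b\<^sub>2"
    if "(y, f) \<in> states M\<^sub>0 b" for f
    using circ_orbit_iff[OF flat1, of "(x, opposite d)" b "(y, f)"] xo that by (auto simp: states_eq pt_def)
  have "(y, rot e) \<in> orbit (step M\<^sub>1 b) (x, opposite d)"
    using o1[OF ye(1)] e y_circ_rot by simp
  then obtain j where j: "(step M\<^sub>0 b ^^ j) (x, d) = (y, rot e)" "0 < j" "j \<le> k"
    unfolding split(3) by auto
  have "j \<noteq> k" using j(1) split(2) xy by auto
  have "meeting_time M\<^sub>0 (x, d) y {e, rot e} = (LEAST n. 0 < n \<and> (step M\<^sub>0 b ^^ n) (x, d) = (y, rot e))"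
    by (rule meeting_time_eq) (use ye in auto)
  then have t1: "meeting_time M\<^sub>0 (x, d) y {e, rot e} \<le> j"
    using j by (simp add: Least_le)
  have t2: "meeting_time M\<^sub>0 (x, d) x (- {d, rot d}) = k"
    unfolding k_def side_compl
    by (rule meeting_time_eq) (use states_at[of _ b d] x_state in auto)
  show "meeting_time M\<^sub>0 (x, d) y {e, rot e} < meeting_time M\<^sub>0 (x, d) x (- {d, rot d})"
    using t1 t2 j \<open>j \<noteq> k\<close> by simp
  define m where "m = meeting_time M\<^sub>0 (x, d) y (- {e, rot e})"
  have m: "m = (LEAST n. 0 < n \<and> (step M\<^sub>0 b ^^ n) (x, d) = (y, opposite (rot e)))"
    unfolding m_def side_compl by (rule meeting_time_eq) (use ye in auto)
  have "circ M\<^sub>0 (midpoint y (opposite (rot e))) = a"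
    using circ_joined[of "opposite e" "opposite (rot e)" M\<^sub>0 y] f.strands_y circ_y(2) by simp
  then have "(y, opposite (rot e)) \<in> orbit (step M\<^sub>0 b) (x, d)"
    using circ_orbit_iff[OF flat0 x_state ye(3)] by (simp add: pt_def)
  then have "\<exists>n. 0 < n \<and> (step M\<^sub>0 b ^^ n) (x, d) = (y, opposite (rot e))"
    unfolding orbit_altdef by force
  then have m': "0 < m \<and> (step M\<^sub>0 b ^^ m) (x, d) = (y, opposite (rot e))"
    unfolding m by (rule LeastI_ex)
  have "(y, opposite (rot e)) \<notin> orbit (step M\<^sub>1 b) (x, opposite d)"
    using o1[OF ye(3)] f.y_circ_rot y_circs e b_neq by auto
  then have "k < m" using m' unfolding split(3) by force
  then show "meeting_time M\<^sub>0 (x, d) x (- {d, rot d}) < meeting_time M\<^sub>0 (x, d) y (- {e, rot e})"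
    using t2 by (simp add: m_def)
qed

lemma meeting_order':
  assumes i: "inside a (right_of (x, rot d))" and e: "circ M\<^sub>1 (midpoint y e) \<noteq> b\<^sub>2"
  shows "meeting_time M\<^sub>0 (x, d) y (- {e, rot e}) < meeting_time M\<^sub>0 (x, d) x (- {d, rot d})"
    "meeting_time M\<^sub>0 (x, d) x (- {d, rot d}) < meeting_time M\<^sub>0 (x, d) y {e, rot e}"
proof -
  interpret f: two_arcs M\<^sub>0 M\<^sub>1 x y d "opposite e" by (rule flip_e)
  have "- {e, rot e} = {opposite e, opposite (rot e)}" "{e, rot e} = - {opposite e, opposite (rot e)}"
    using side_compl by auto
  then show "meeting_time M\<^sub>0 (x, d) y (- {e, rot e}) < meeting_time M\<^sub>0 (x, d) x (- {d, rot d})"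
    "meeting_time M\<^sub>0 (x, d) x (- {d, rot d}) < meeting_time M\<^sub>0 (x, d) y {e, rot e}"
    using f.meeting_order[OF i] y_circs e by auto
qed

end

section \<open>The potential of a resolution and the reflection of its circles\<close>

definition flip_if :: "bool \<Rightarrow> 'g::ab_group_add \<Rightarrow> 'g"
  where "flip_if b v = (if b then - v else v)"

lemma flip_if_simps [simp]:
  "flip_if True v = - v" "flip_if False v = v" "flip_if b 0 = 0" "flip_if b v = 0 \<longleftrightarrow> v = 0"
  by (simp_all add: flip_if_def)

text \<open>The signs are such that the potential grows by the circle on the way from an even to an odd region.\<close>

definition circle_weight :: "diagram \<Rightarrow> point \<Rightarrow> circle \<Rightarrow>\<^sub>0 int"
  where "circle_weight M r = (if r \<in> points M
    then flip_if (inside (points M) (if odd (fst r) then r + (0, 1) else r - (1, 0))) (frag_of (circ M r))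
    else 0)"

lemma circle_weight_eq_0: "circle_weight M r = 0 \<longleftrightarrow> r \<notin> points M"
  by (simp add: circle_weight_def)

text \<open>The corner that decides the sign is the end of the side from which the increment in
  \<open>weight.potential_corners\<close> is counted.\<close>

lemma circle_weight_midpoint:
  "circle_weight M (midpoint c North) = (if midpoint c North \<in> points M
    then flip_if (inside (points M) (c + c + (- 1, 1))) (frag_of (circ M (midpoint c North))) else 0)"
  "circle_weight M (midpoint c South) = (if midpoint c South \<in> points M
    then flip_if (inside (points M) (c + c + (- 1, - 1))) (frag_of (circ M (midpoint c South))) else 0)"
  "circle_weight M (midpoint c East) = (if midpoint c East \<in> points M
    then flip_if (inside (points M) (c + c + (1, 1))) (frag_of (circ M (midpoint c East))) else 0)"
  "circle_weight M (midpoint c West) = (if midpoint c West \<in> points M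
    then flip_if (inside (points M) (c + c + (- 1, 1))) (frag_of (circ M (midpoint c West))) else 0)"
proof -
  have "(if odd (fst (midpoint c North)) then midpoint c North + (0, 1) else midpoint c North - (1, 0)) = c + c + (- 1, 1)"
    "(if odd (fst (midpoint c South)) then midpoint c South + (0, 1) else midpoint c South - (1, 0)) = c + c + (- 1, - 1)"
    "(if odd (fst (midpoint c East)) then midpoint c East + (0, 1) else midpoint c East - (1, 0)) = c + c + (1, 1)"
    "(if odd (fst (midpoint c West)) then midpoint c West + (0, 1) else midpoint c West - (1, 0)) = c + c + (- 1, 1)"
    by (cases c; simp add: midpoint_def)+
  note * = this
  show "circle_weight M (midpoint c North) = (if midpoint c North \<in> points M
    then flip_if (inside (points M) (c + c + (- 1, 1))) (frag_of (circ M (midpoint c North))) else 0)"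
    unfolding circle_weight_def * ..
  show "circle_weight M (midpoint c South) = (if midpoint c South \<in> points M
    then flip_if (inside (points M) (c + c + (- 1, - 1))) (frag_of (circ M (midpoint c South))) else 0)"
    unfolding circle_weight_def * ..
  show "circle_weight M (midpoint c East) = (if midpoint c East \<in> points M
    then flip_if (inside (points M) (c + c + (1, 1))) (frag_of (circ M (midpoint c East))) else 0)"
    unfolding circle_weight_def * ..
  show "circle_weight M (midpoint c West) = (if midpoint c West \<in> points M
    then flip_if (inside (points M) (c + c + (- 1, 1))) (frag_of (circ M (midpoint c West))) else 0)"
    unfolding circle_weight_def * ..
qed

lemma circ_tile:
  assumes "flat M"
  shows "case M c of
      Blank \<Rightarrow> True
    | Arc_NE \<Rightarrow> circ M (midpoint c North) = circ M (midpoint c East)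
    | Arc_NW \<Rightarrow> circ M (midpoint c North) = circ M (midpoint c West)
    | Arc_SW \<Rightarrow> circ M (midpoint c South) = circ M (midpoint c West)
    | Arc_SE \<Rightarrow> circ M (midpoint c South) = circ M (midpoint c East)
    | Line_H \<Rightarrow> circ M (midpoint c West) = circ M (midpoint c East)
    | Line_V \<Rightarrow> circ M (midpoint c North) = circ M (midpoint c South)
    | Arcs_NW_SE \<Rightarrow> circ M (midpoint c North) = circ M (midpoint c West) \<and> circ M (midpoint c South) = circ M (midpoint c East)
    | Arcs_NE_SW \<Rightarrow> circ M (midpoint c North) = circ M (midpoint c East) \<and> circ M (midpoint c South) = circ M (midpoint c West)
    | _ \<Rightarrow> False"
proof -
  have s: "{d, d'} \<in> strands (M c) \<longrightarrow> circ M (midpoint c d) = circ M (midpoint c d')" for d d'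
    using circ_joined by blast
  show ?thesis
    using s[of North East] s[of North West] s[of South East] s[of South West] s[of West East] s[of North South]
      flatD[OF assms, of c]
    by (cases "M c") simp_all
qed

text \<open>Along a strand the circle and the colours on both hands are constant, so the terms of
  its two ends cancel in the relation around the square.\<close>

lemma circle_weight:
  assumes M: "flat M"
  shows "weight (circle_weight M)"
proof
  show "finite {p. circle_weight M p \<noteq> 0}"
    by (simp add: circle_weight_eq_0 finite_points[OF flat_link_diagram[OF M]])
  show "odd (fst p + snd p)" if "circle_weight M p \<noteq> 0" for p
    using that midpoint_odd unfolding circle_weight_eq_0 not_not points_def by blast
  show "circle_weight M (midpoint c South) - circle_weight M (midpoint c North)
      = circle_weight M (midpoint c East) - circle_weight M (midpoint c West)" for c
    using circ_tile[OF M, of c] stranded_tile[OF M stranded_points, of c]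
      inside_corners[OF M stranded_points, of c]
    unfolding circle_weight_midpoint flip_if_def
    by (cases "M c") auto
qed

definition level :: "diagram \<Rightarrow> point \<Rightarrow> circle \<Rightarrow>\<^sub>0 int"
  where "level M = potential (circle_weight M)"

lemma level_corners:
  assumes "flat M"
  shows "level M (c + c + (1, 1)) = level M (c + c + (- 1, 1)) + circle_weight M (midpoint c North)"
  "level M (c + c + (1, - 1)) = level M (c + c + (- 1, - 1)) + circle_weight M (midpoint c South)"
  "level M (c + c + (1, - 1)) = level M (c + c + (1, 1)) + circle_weight M (midpoint c East)"
  "level M (c + c + (- 1, - 1)) = level M (c + c + (- 1, 1)) + circle_weight M (midpoint c West)"
  unfolding level_def by (rule weight.potential_corners[OF circle_weight[OF assms]])+

lemma level_across:
  assumes M: "flat M" and p: "pt \<sigma> \<in> points M"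
  shows "level M (right_of \<sigma>) =
    level M (left_of \<sigma>) + flip_if (inside (points M) (left_of \<sigma>)) (frag_of (circ M (pt \<sigma>)))"
proof -
  obtain c d where \<sigma>: "\<sigma> = (c, d)" by (metis surj_pair)
  show ?thesis
    using level_corners[OF M, of c] inside_corners[OF M stranded_points, of c] p
    unfolding \<sigma> pt_def circle_weight_midpoint
    by (cases d) (auto simp: corner_simps flip_if_def)
qed

lemma tile_strand_cases:
  assumes "flat M" "{d, d'} \<in> strands (M c)"
  obtains "M c = Arc_NE" "d = North" "d' = East" | "M c = Arc_NE" "d = East" "d' = North"
  | "M c = Arc_NW" "d = North" "d' = West" | "M c = Arc_NW" "d = West" "d' = North"
  | "M c = Arc_SW" "d = South" "d' = West" | "M c = Arc_SW" "d = West" "d' = South"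
  | "M c = Arc_SE" "d = South" "d' = East" | "M c = Arc_SE" "d = East" "d' = South"
  | "M c = Line_H" "d = West" "d' = East" | "M c = Line_H" "d = East" "d' = West"
  | "M c = Line_V" "d = North" "d' = South" | "M c = Line_V" "d = South" "d' = North"
  | "M c = Arcs_NW_SE" "d = North" "d' = West" | "M c = Arcs_NW_SE" "d = West" "d' = North"
  | "M c = Arcs_NW_SE" "d = South" "d' = East" | "M c = Arcs_NW_SE" "d = East" "d' = South"
  | "M c = Arcs_NE_SW" "d = North" "d' = East" | "M c = Arcs_NE_SW" "d = East" "d' = North"
  | "M c = Arcs_NE_SW" "d = South" "d' = West" | "M c = Arcs_NE_SW" "d = West" "d' = South"
  using assms(2) flatD[OF assms(1), of c] by (cases "M c"; auto simp: doubleton_eq_iff)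

text \<open>So the potential is constant beside a strand and becomes a function on regions.
  \<open>right_of (c, d')\<close> is the left-hand corner on leaving through
  \<open>d'\<close>.\<close>

lemma level_along:
  assumes M: "flat M" and dd: "{d, d'} \<in> strands (M c)"
  shows "level M (right_of (c, d')) = level M (left_of (c, d))"
proof -
  note facts = level_corners[OF M, of c] inside_corners[OF M stranded_points, of c]
    stranded_tile[OF M stranded_points, of c] circ_tile[OF M, of c]
  from M dd show ?thesis
    by (cases rule: tile_strand_cases)
      (use facts in \<open>simp add: corner_simps circle_weight_midpoint flip_if_def split: if_splits\<close>)+
qed


text \<open>A circle goes to the sum of the potentials on its two sides.  As the potential on the odd side is
  larger by the circle, a difference of circles bordering a common region is fixed or negated.\<close>

definition reflected :: "diagram \<Rightarrow> point \<Rightarrow> circle \<Rightarrow>\<^sub>0 int"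
  where "reflected M r = (if odd (fst r) then level M (r + (0, 1)) + level M (r - (0, 1))
    else level M (r + (1, 0)) + level M (r - (1, 0)))"

lemma reflected_pt: "reflected M (pt \<sigma>) = level M (left_of \<sigma>) + level M (right_of \<sigma>)"
proof -
  obtain a b d where \<sigma>: "\<sigma> = ((a, b), d)" by (metis surj_pair)
  show ?thesis
    unfolding \<sigma> by (cases d) (simp_all add: reflected_def pt_def left_of_def right_of_def midpoint_def add.commute)
qed

text \<open>Applied to a strand and to its reverse, \<open>level_along\<close> keeps the potentials
  on both hands, and therefore their sum.\<close>

lemma reflected_circ:
  assumes M: "flat M" and c: "circ M p = circ M q"
  shows "reflected M p = reflected M q"
proof -
  have *: "reflected M p = reflected M q" if j: "(p, q) \<in> joined M" for p q
  proof -
    obtain c d d' where pq: "p = midpoint c d" "q = midpoint c d'" "{d, d'} \<in> strands (M c)"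
      using j unfolding joined_def by blast
    have "{d', d} \<in> strands (M c)" using pq(3) by (simp add: insert_commute)
    then show ?thesis
      using level_along[OF M pq(3)] level_along[OF M, of d' d c]
        reflected_pt[of M "(c, d)"] reflected_pt[of M "(c, d')"]
      by (simp add: pq(1,2) pt_def add.commute)
  qed
  have "(p, q) \<in> (joined M)\<^sup>*" using c circ_eq_iff[of M p q] by (simp add: in_circ)
  then show ?thesis
    by (induction rule: rtrancl_induct) (simp_all add: *)
qed

definition reflection :: "diagram \<Rightarrow> circle \<Rightarrow> circle \<Rightarrow>\<^sub>0 int"
  where "reflection M a = reflected M (SOME r. r \<in> a)"

lemma reflection_circ:
  assumes "flat M"
  shows "reflection M (circ M r) = reflected M r"
proof -
  have "(SOME q. q \<in> circ M r) \<in> circ M r" by (rule someI) (rule circ_self)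
  then show ?thesis
    using reflected_circ[OF assms] circ_eq_iff unfolding reflection_def by metis
qed

lemma frag_extend_flip_if: "frag_extend h (flip_if b v) = flip_if b (frag_extend h v)"
  by (cases b) (simp_all add: frag_extend_minus)

text \<open>The eigenvalues of the reflection on potentials. The induction goes down a column from
  above the diagram, where the potential is 0. When a circle is passed, the colour changes, the
  circle is the difference of the two potentials up to sign, and it goes to their sum; this reverses
  the eigenvalue.\<close>

lemma reflection_level:
  assumes M: "flat M" and odd: "odd X" "odd Y"
  shows "frag_extend (reflection M) (level M (X, Y)) = - flip_if (inside (points M) (X, Y)) (level M (X, Y))"
proof -
  interpret weight "circle_weight M" by (rule circle_weight[OF M])
  have "finite (snd ` points M)" using finite_points[OF flat_link_diagram[OF M]] by simp
  then obtain N where N: "\<And>y. y \<in> snd ` points M \<Longrightarrow> y < N"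
    by (metis bdd_above_finite bdd_above.unfold gt_ex order_le_less_trans)
  have N: "(X, y) \<notin> points M" if "N \<le> y" for X y
    using N[of y] that by force
  have large: "level M (X, B) = 0" if "N \<le> B" for B
  proof -
    have "{y. B < y \<and> circle_weight M (X, y) \<noteq> 0} = {}"
      using N that unfolding circle_weight_eq_0 by fastforce
    then show ?thesis by (simp add: level_def potential_def)
  qed
  have step: "frag_extend (reflection M) (level M (X, Y)) = - flip_if (inside (points M) (X, Y)) (level M (X, Y))"
    if Y: "odd Y"
      and IH: "frag_extend (reflection M) (level M (X, Y + 2)) = - flip_if (inside (points M) (X, Y + 2)) (level M (X, Y + 2))"
    for Y
  proof -
    obtain m k where "X = 2 * m + 1" "Y = 2 * k + 1" using odd(1) Y by (meson oddE)
    then obtain n where mn: "X = 2 * m + 1" "Y = 2 * n - 1" using that[of "k + 1"] by simp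
    \<comment> \<open>\<open>(X, Y)\<close> is the lower right corner of the square
      \<open>(m, n)\<close>, so the step passes the east side of this square.\<close>
    define c where "c = (m, n)"
    have l: "left_of (c, East) = (X, Y)" "right_of (c, East) = (X, Y + 2)"
      by (simp_all add: corner_simps c_def mn)
    note A = level_across[OF M, of "(c, East)"] inside_across[OF M stranded_points, of "(c, East)"]
    show ?thesis
    proof (cases "pt (c, East) \<in> points M")
      case True
      let ?C = "circ M (pt (c, East))" and ?i = "inside (points M) (X, Y)"
      have R: "reflection M ?C = level M (X, Y) + level M (X, Y + 2)"
        using reflection_circ[OF M] reflected_pt[of M "(c, East)"] l by simp
      have lev: "level M (X, Y) = level M (X, Y + 2) - flip_if ?i (frag_of ?C)"
        using A(1) True l by simp
      have i: "inside (points M) (X, Y + 2) \<longleftrightarrow> \<not> ?i"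
        using A(2) True l by simp
      have "frag_extend (reflection M) (level M (X, Y)) =
          frag_extend (reflection M) (level M (X, Y + 2)) - flip_if ?i (reflection M ?C)"
        by (subst lev) (simp add: frag_extend_diff frag_extend_flip_if)
      also have "\<dots> = - flip_if (\<not> ?i) (level M (X, Y + 2)) - flip_if ?i (level M (X, Y) + level M (X, Y + 2))"
        unfolding IH i R ..
      also have "\<dots> = - flip_if ?i (level M (X, Y))" by (cases ?i) simp_all
      finally show ?thesis .
    next
      case False
      then have "level M (X, Y) = level M (X, Y + 2)"
        using potential_vertical[of X "Y + 1"] odd Y circle_weight_eq_0[of M "(X, Y + 1)"]
        by (simp add: level_def c_def pt_def midpoint_def mn add.commute)
      moreover have "inside (points M) (X, Y + 2) \<longleftrightarrow> inside (points M) (X, Y)"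
        using A(2) False l by simp
      ultimately show ?thesis using IH by simp
    qed
  qed
  have "frag_extend (reflection M) (level M (X, B - 2 * int n))
      = - flip_if (inside (points M) (X, B - 2 * int n)) (level M (X, B - 2 * int n))"
    if "N \<le> B" "odd B" for n B
  proof (induction n)
    case 0
    then show ?case using large that by simp
  next
    case (Suc n)
    then show ?case using step[of "B - 2 * int (Suc n)"] that by (simp add: algebra_simps)
  qed
  \<comment> \<open>The starting height has the parity of \<open>Y\<close> and is at least
    \<open>N\<close>.\<close>
  from this[of "Y + 2 * int (nat \<bar>N - Y\<bar>)" "nat \<bar>N - Y\<bar>"] odd show ?thesis
    by (simp add: abs_if split: if_splits)
qed

lemma reflection_level_corner:
  assumes M: "flat M"
  shows "frag_extend (reflection M) (level M (left_of \<sigma>)) = - flip_if (inside (points M) (left_of \<sigma>)) (level M (left_of \<sigma>))"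
    "frag_extend (reflection M) (level M (right_of \<sigma>)) = - flip_if (inside (points M) (right_of \<sigma>)) (level M (right_of \<sigma>))"
proof -
  obtain a b d where \<sigma>: "\<sigma> = ((a, b), d)" by (metis surj_pair)
  have "odd (fst (left_of \<sigma>))" "odd (snd (left_of \<sigma>))" "odd (fst (right_of \<sigma>))" "odd (snd (right_of \<sigma>))"
    unfolding \<sigma> by (cases d; simp add: corner_simps)+
  then show "frag_extend (reflection M) (level M (left_of \<sigma>)) = - flip_if (inside (points M) (left_of \<sigma>)) (level M (left_of \<sigma>))"
    "frag_extend (reflection M) (level M (right_of \<sigma>)) = - flip_if (inside (points M) (right_of \<sigma>)) (level M (right_of \<sigma>))"
    using reflection_level[OF M] by (metis prod.collapse)+
qed

text \<open>A circle is the difference of the potentials on its two sides and goes to their sum.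
  These are eigenvectors for opposite signs, so the second application returns the
  difference.\<close>

lemma reflection_involution:
  assumes M: "flat M" and r: "r \<in> points M"
  shows "frag_extend (reflection M) (reflection M (circ M r)) = frag_of (circ M r)"
proof -
  obtain c d where "r = midpoint c d" using r unfolding points_def by blast
  then have r': "r = pt (c, d)" by (simp add: pt_def)
  then show ?thesis
    using reflection_level_corner[OF M, of "(c, d)"] level_across[OF M, of "(c, d)"]
      inside_across[OF M stranded_points, of "(c, d)"] r
    unfolding reflection_circ[OF M] r' reflected_pt frag_extend_add
    by (cases "inside (points M) (left_of (c, d))") simp_all
qed

text \<open>The two strands border the region containing \<open>left_of (x, d)\<close>. Its
  potential cancels from the difference of the circles as well as from the difference of their
  images, and only the sign depends on its colour.\<close>

lemma reflection_diff:
  assumes M: "flat M" and t: "M x \<in> {Arcs_NW_SE, Arcs_NE_SW}" "{d, rot d} \<in> strands (M x)"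
  shows "reflected M (midpoint x d) - reflected M (midpoint x (opposite d)) =
    flip_if (inside (points M) (left_of (x, d)))
      (frag_of (circ M (midpoint x d)) - frag_of (circ M (midpoint x (opposite d))))"
proof -
  have "\<Union> (strands Arcs_NW_SE) = UNIV" "\<Union> (strands Arcs_NE_SW) = UNIV"
    by (auto simp: UNIV_side)
  then have p: "pt (x, f) \<in> points M" for f
    using midpoint_in_points[OF flat_link_diagram[OF M], of x f] t(1) by (auto simp: pt_def)
  have "{rot d, d} \<in> strands (M x)" using t by (simp add: insert_commute)
  then have "level M (right_of (x, rot d)) = level M (left_of (x, d))"
    using level_along[OF M t(2)] by simp
  moreover have "inside (points M) (right_of (x, rot d)) = inside (points M) (left_of (x, d))"
    using inside_along[OF M stranded_points t(2)] by simp
  moreover have "right_of (x, rot d) = left_of (x, opposite d)"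
    using corner_eq[of x "rot d"] by simp
  ultimately show ?thesis
    using reflected_pt[of M "(x, d)"] reflected_pt[of M "(x, opposite d)"]
      level_across[OF M p, of d] level_across[OF M p, of "opposite d"]
    by (cases "inside (points M) (left_of (x, d))") (simp_all add: pt_def)
qed

text \<open>Colours and signs come from the points alone, so the potentials of both diagrams are
  given by the same sums, with the circles renamed.\<close>

lemma reflected_natural:
  assumes P: "points M' = points M"
    and m: "\<And>r. r \<in> points M \<Longrightarrow> m (circ M r) = circ M' r"
  shows "frag_extend (\<lambda>a. frag_of (m a)) (reflected M r) = reflected M' r"
proof -
  have w: "frag_extend (\<lambda>a. frag_of (m a)) (circle_weight M r) = circle_weight M' r" for r
    using m by (simp add: circle_weight_def P frag_extend_flip_if)
  have "frag_extend (\<lambda>a. frag_of (m a)) (level M p) = level M' p" for p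
  proof (cases "finite {y. snd p < y \<and> circle_weight M (fst p, y) \<noteq> 0}")
    case True
    then show ?thesis
      unfolding level_def potential_def
      by (simp add: frag_extend_sum o_def w) (simp add: circle_weight_eq_0 P)
  next
    case False
    then show ?thesis
      unfolding level_def potential_def
      by (simp add: circle_weight_eq_0 P)
  qed
  then show ?thesis by (simp add: reflected_def frag_extend_add)
qed

text \<open>Keeps the \<open>1\<close> of \<open>I(x := 1)\<close> in the form used by the
  definitions.\<close>

declare One_nat_def [simp del]

section \<open>The edge maps\<close>

lemma sides_smoothing: "\<Union> (strands (smoothing i t)) = \<Union> (strands t)"
  by (cases t) auto

lemma sides_resolution: "\<Union> (strands (resolution D I c)) = \<Union> (strands (D c))"
  by (simp add: resolution_def sides_smoothing del: Union_iff)

lemma points_resolution [simp]: "points (resolution D I) = points D"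
  unfolding points_def sides_resolution ..

lemma flat_resolution:
  assumes "link_diagram D"
  shows "flat (resolution D I)"
  unfolding flat_def link_diagram_def sides_resolution
proof (intro conjI allI)
  show "finite {c. resolution D I c \<noteq> Blank}"
  proof (rule finite_subset)
    have "smoothing i Blank = Blank" for i by simp
    then show "{c. resolution D I c \<noteq> Blank} \<subseteq> {c. D c \<noteq> Blank}"
      by (auto simp: resolution_def split: if_splits)
    show "finite {c. D c \<noteq> Blank}" using assms by (simp add: link_diagram_def)
  qed
  show "(d \<in> \<Union> (strands (D c))) = (opposite d \<in> \<Union> (strands (D (c + vec d))))" for c d
    using assms unfolding link_diagram_def by blast
  show "resolution D I c \<notin> {CrossH, CrossV}" for c
    by (cases "D c") (auto simp: resolution_def crossings_def)
qed

lemma surgery_resolution: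
  assumes "link_diagram D" "x \<in> crossings D" "I x = 0"
  shows "surgery (resolution D I) (resolution D (I(x := 1))) x"
proof
  show "{resolution D I x, resolution D (I(x := 1)) x} = {Arcs_NW_SE, Arcs_NE_SW}"
    using assms(2,3) by (auto simp: resolution_def crossings_def)
qed (use flat_resolution[OF assms(1)] in \<open>auto simp: resolution_def\<close>)

text \<open>A strand of a smoothed crossing is a quarter arc \<open>{d, rot d}\<close> for exactly
  one \<open>d\<close>. Named by this side, an arrow is reversed by \<open>opposite\<close>.\<close>

definition tail :: "side set \<Rightarrow> side"
  where "tail A = (THE d. A = {d, rot d})"

lemma tail_eq [simp]: "tail {d, rot d} = d"
  unfolding tail_def by (rule the_equality) (simp_all add: corner_set_eq)

lemma arrow_tail:
  assumes "arrow_choice D arr" "x \<in> crossings D"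
  shows "arr x = {tail (arr x), rot (tail (arr x))}"
    "{tail (arr x), rot (tail (arr x))} \<in> strands (smoothing 0 (D x))"
proof -
  have *: "arr x \<in> strands (smoothing 0 (D x))"
    using assms unfolding arrow_choice_def by blast
  have "D x = CrossH \<or> D x = CrossV"
    using assms(2) unfolding crossings_def by blast
  then have "\<exists>d. arr x = {d, rot d}"
  proof -
    have "\<exists>d. {North, West} = {d, rot d}" "\<exists>d. {South, East} = {d, rot d}"
      "\<exists>d. {North, East} = {d, rot d}" "\<exists>d. {South, West} = {d, rot d}"
      by (rule exI[of _ North], simp) (rule exI[of _ South], simp, rule exI[of _ East], simp add: insert_commute,
        rule exI[of _ West], simp add: insert_commute)
    then show ?thesis using * \<open>D x = CrossH \<or> D x = CrossV\<close> by auto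
  qed
  then obtain d where "arr x = {d, rot d}" by blast
  then show "arr x = {tail (arr x), rot (tail (arr x))}"
    "{tail (arr x), rot (tail (arr x))} \<in> strands (smoothing 0 (D x))" using * by simp_all
qed

lemma arrow_compl:
  assumes "arrow_choice D arr" "arrow_choice D arr'" "x \<in> crossings D"
  shows "tail (arr' x) = tail (arr x) \<or> tail (arr' x) = opposite (tail (arr x))"
  using arrow_tail(2)[OF assms(1,3)] arrow_tail(2)[OF assms(2,3)] assms(3)
  unfolding crossings_def
  by (cases "tail (arr x)"; cases "tail (arr' x)") (auto simp: doubleton_eq_iff)

text \<open>East and West belong to different strands in either smoothing, so one test serves both
  kinds of crossings.\<close>

definition splits :: "diagram \<Rightarrow> (square \<Rightarrow> nat) \<Rightarrow> square \<Rightarrow> bool"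
  where "splits D I x \<longleftrightarrow>
    circ (resolution D I) (midpoint x East) = circ (resolution D I) (midpoint x West)"

lemma (in surgery) circ_opposite_iff:
  "circ M\<^sub>0 (midpoint x d) = circ M\<^sub>0 (midpoint x (opposite d)) \<longleftrightarrow>
   circ M\<^sub>0 (midpoint x East) = circ M\<^sub>0 (midpoint x West)"
  using circ_tile[OF flat0, of x] by (rule_tac tile_cases; cases d; auto)

lemma splits_iff:
  assumes "link_diagram D" "x \<in> crossings D" "I x = 0"
  shows "splits D I x \<longleftrightarrow>
    circ (resolution D I) (midpoint x d) = circ (resolution D I) (midpoint x (opposite d))"
  using surgery.circ_opposite_iff[OF surgery_resolution[of D x I, OF assms]] by (simp add: splits_def)

lemma (in surgery) circ_refines:
  assumes "circ M\<^sub>0 (midpoint x d) \<noteq> circ M\<^sub>0 (midpoint x (opposite d))"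
    "p \<in> points M\<^sub>0" "q \<in> points M\<^sub>0" "circ M\<^sub>0 p = circ M\<^sub>0 q"
  shows "circ M\<^sub>1 p = circ M\<^sub>1 q"
proof -
  have "p \<in> circ M\<^sub>0 r \<longleftrightarrow> q \<in> circ M\<^sub>0 r" for r using assms(4) circ_eq_iff by metis
  then show ?thesis
    using circ_merge[OF assms(1,2)] circ_merge[OF assms(1,3)] assms(4) by simp
qed

lemma (in surgery) card_circles:
  assumes "circ M\<^sub>0 (midpoint x d) \<noteq> circ M\<^sub>0 (midpoint x (opposite d))"
  shows "card (circles M\<^sub>0) = Suc (card (circles M\<^sub>1))"
proof -
  let ?A = "circ M\<^sub>0 (midpoint x d)" and ?B = "circ M\<^sub>0 (midpoint x (opposite d))"
  have AB: "?A \<inter> ?B = {}" "?A \<noteq> {}" "?B \<noteq> {}"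
    using circ_disjoint[OF assms] circ_self by blast+
  have fin: "finite (circles M\<^sub>0)"
    unfolding circles_eq by (rule finite_imageI) (rule finite_points[OF flat_link_diagram[OF flat0]])
  have sub: "{?A, ?B} \<subseteq> circles M\<^sub>0" by (auto simp: circles_eq)
  have "circles M\<^sub>1 = insert (?A \<union> ?B) (circles M\<^sub>0 - {?A, ?B})"
  proof
    show "circles M\<^sub>1 \<subseteq> insert (?A \<union> ?B) (circles M\<^sub>0 - {?A, ?B})"
    proof
      fix a assume "a \<in> circles M\<^sub>1"
      then obtain p where p: "p \<in> points M\<^sub>0" "a = circ M\<^sub>1 p" by (auto simp: circles_eq points_eq)
      show "a \<in> insert (?A \<union> ?B) (circles M\<^sub>0 - {?A, ?B})"
      proof (cases "p \<in> ?A \<union> ?B")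
        case True
        then show ?thesis using circ_merge[OF assms p(1)] p(2) by simp
      next
        case False
        then have "circ M\<^sub>0 p \<noteq> ?A" "circ M\<^sub>0 p \<noteq> ?B" using circ_self by blast+
        then show ?thesis using circ_merge[OF assms p(1)] p False by (simp add: circles_eq)
      qed
    qed
    have "circ M\<^sub>1 (midpoint x d) = ?A \<union> ?B"
      using circ_merge[OF assms, of "midpoint x d"] by simp
    then have "?A \<union> ?B \<in> circles M\<^sub>1"
      unfolding circles_eq by (metis image_eqI midpoint_point(2))
    moreover have "a \<in> circles M\<^sub>1" if a: "a \<in> circles M\<^sub>0 - {?A, ?B}" for a
    proof -
      obtain p where p: "p \<in> points M\<^sub>0" "a = circ M\<^sub>0 p" using a by (auto simp: circles_eq)
      then have "p \<notin> ?A \<union> ?B"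
        using a circ_eq_iff[of M\<^sub>0 "midpoint x d" p] circ_eq_iff[of M\<^sub>0 "midpoint x (opposite d)" p] by auto
      then show ?thesis using circ_merge[OF assms p(1)] p unfolding circles_eq points_eq by auto
    qed
    ultimately show "insert (?A \<union> ?B) (circles M\<^sub>0 - {?A, ?B}) \<subseteq> circles M\<^sub>1" by blast
  qed
  moreover have "?A \<union> ?B \<notin> circles M\<^sub>0"
  proof
    assume "?A \<union> ?B \<in> circles M\<^sub>0"
    then obtain p where "?A \<union> ?B = circ M\<^sub>0 p" unfolding circles_eq by blast
    then have "circ M\<^sub>0 p = ?A" "circ M\<^sub>0 p = ?B"
      using circ_eq_iff[of M\<^sub>0 p "midpoint x d"] circ_eq_iff[of M\<^sub>0 p "midpoint x (opposite d)"] circ_self by blast+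
    then show False using assms by simp
  qed
  ultimately have "card (circles M\<^sub>1) = Suc (card (circles M\<^sub>0 - {?A, ?B}))"
    using fin by simp
  moreover have "card (circles M\<^sub>0 - {?A, ?B}) = card (circles M\<^sub>0) - 2"
    using card_Diff_subset[OF _ sub] assms by simp
  moreover have "card {?A, ?B} \<le> card (circles M\<^sub>0)" using card_mono[OF fin sub] .
  ultimately show ?thesis using assms by simp
qed

text \<open>The map of circles induced by the identity on points; it is independent of the chosen
  point when the target circles are coarser, that is, in the direction of a merge.\<close>

definition transfer_circle :: "diagram \<Rightarrow> circle \<Rightarrow> circle"
  where "transfer_circle M a = circ M (SOME r. r \<in> a)"

lemma transfer_circle_eq:
  assumes "\<And>p q. p \<in> points M \<Longrightarrow> q \<in> points M \<Longrightarrow> circ M p = circ M q \<Longrightarrow> circ M' p = circ M' q"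
    and "p \<in> points M"
  shows "transfer_circle M' (circ M p) = circ M' p"
proof -
  define q where "q = (SOME r. r \<in> circ M p)"
  have q: "q \<in> circ M p" unfolding q_def by (rule someI) (rule circ_self)
  then have "q \<in> points M" "circ M q = circ M p" using circ_subset[OF assms(2)] circ_eq_iff[of M p q] by auto
  then show ?thesis unfolding transfer_circle_def q_def[symmetric] using assms by blast
qed

text \<open>One algebra, generated by the points, maps onto the state spaces of all vertices, so
  factors occurring at different edges can be multiplied and compared.\<close>

abbreviation quot :: "diagram \<Rightarrow> (square \<Rightarrow> nat) \<Rightarrow> point exterior \<Rightarrow> circle exterior"
  where "quot D I \<equiv> exterior_map (circ (resolution D I))"

lemma state_space_eq: "state_space D I = quot D I ` exterior_on (points D)"
  unfolding state_space_def circles_eq exterior_map_image by simp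

lemma quot_state: "w \<in> exterior_on (points D) \<Longrightarrow> quot D I w \<in> state_space D I"
  unfolding state_space_eq by blast

locale cube_edge =
  fixes D :: diagram and arr :: arrows and I :: "square \<Rightarrow> nat" and x :: square
  assumes D: "link_diagram D" and arr: "arrow_choice D arr"
    and x: "x \<in> crossings D" and Ix: "I x = 0"
begin

sublocale surgery "resolution D I" "resolution D (I(x := 1))" x
  by (rule surgery_resolution[of D x I, OF D x Ix])

abbreviation "J \<equiv> I(x := 1)"
abbreviation "t \<equiv> tail (arr x)"

lemma arr_eq: "arr x = {t, rot t}"
  by (rule arrow_tail(1)[OF arr x])

lemma strand_t: "{t, rot t} \<in> strands (resolution D I x)"
  using arrow_tail(2)[OF arr x] Ix x by (simp add: resolution_def)

lemma strand_t': "{opposite t, rot (opposite t)} \<in> strands (resolution D I x)"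
  using strand_t by (rule_tac tile_cases; cases t; simp add: doubleton_eq_iff)

lemma point_x [simp]: "midpoint x d \<in> points D"
  using midpoint_point(1) by simp

lemma splits_circ: "splits D I x \<longleftrightarrow>
    circ (resolution D I) (midpoint x d) = circ (resolution D I) (midpoint x (opposite d))"
  by (rule splits_iff[of D x I, OF D x Ix])

text \<open>The rotated arrow has its tail on the strand through \<open>opposite t\<close> and its
  head on the one through \<open>t\<close>; this fixes the sign of the difference at a
  split.\<close>

lemma circle_tail:
  "circle_through (resolution D I) x (arr x) = circ (resolution D I) (midpoint x t)"
  "circle_through (resolution D I) x (- arr x) = circ (resolution D I) (midpoint x (opposite t))"
  "circle_through (resolution D J) x (rot ` arr x) = circ (resolution D J) (midpoint x (opposite t))"
  "circle_through (resolution D J) x (- (rot ` arr x)) = circ (resolution D J) (midpoint x t)"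
proof -
  show "circle_through (resolution D I) x (arr x) = circ (resolution D I) (midpoint x t)"
    using circle_through_strand[of t "rot t" "resolution D I" x] strand_t arr_eq by simp
  have "- arr x = {opposite t, rot (opposite t)}" using arr_eq side_compl[of t] by simp
  then show "circle_through (resolution D I) x (- arr x) = circ (resolution D I) (midpoint x (opposite t))"
    using circle_through_strand[of "opposite t" "rot (opposite t)" "resolution D I" x] strand_t' by simp
  have "rot ` {t, rot t} = {opposite t, rot t}" by (simp add: insert_commute)
  then have r: "rot ` arr x = {opposite t, rot t}" using arr_eq by simp
  have "{opposite t, rot t} \<in> strands (resolution D J x)"
    using strand_switch[of "opposite t" "rot t"] strand_t by simp
  then show "circle_through (resolution D J) x (rot ` arr x) = circ (resolution D J) (midpoint x (opposite t))"
    unfolding r using circle_through_strand[of "opposite t" "rot t" "resolution D J" x] by simp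
  have r': "- (rot ` arr x) = {t, opposite (rot t)}"
    unfolding r using side_compl[of "rot t"] by (simp add: insert_commute)
  have "{t, opposite (rot t)} \<in> strands (resolution D J x)"
    using strand_switch[of t "opposite (rot t)"] strand_t' by simp
  then show "circle_through (resolution D J) x (- (rot ` arr x)) = circ (resolution D J) (midpoint x t)"
    unfolding r' using circle_through_strand[of t "opposite (rot t)" "resolution D J" x] by simp
qed

lemma edge_map_merge:
  assumes "\<not> splits D I x" and v: "v \<in> state_space D I"
    and m: "\<And>p. p \<in> points D \<Longrightarrow> m (circ (resolution D I) p) = circ (resolution D J) p"
  shows "edge_map D arr (I, x) v = exterior_map m v"
proof -
  have neq: "circ (resolution D I) (midpoint x t) \<noteq> circ (resolution D I) (midpoint x (opposite t))"
    using assms(1) splits_circ by blast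
  have "edge_map D arr (I, x) v = exterior_map (\<lambda>a. if a \<in> {circ (resolution D I) (midpoint x t),
      circ (resolution D I) (midpoint x (opposite t))} then circ (resolution D J) (midpoint x (opposite t)) else a) v"
    unfolding edge_map_def Let_def fst_conv snd_conv circle_tail using neq by (rule if_P)
  also have "\<dots> = exterior_map m v"
  proof (rule exterior_map_cong[OF v[unfolded state_space_def]])
    fix a assume "a \<in> circles (resolution D I)"
    then obtain p where p: "p \<in> points D" "a = circ (resolution D I) p" by (auto simp: circles_eq)
    note circ_merge[OF neq, of p] circ_merge[OF neq, of "midpoint x (opposite t)"]
    moreover have "a = circ (resolution D I) q \<longleftrightarrow> p \<in> circ (resolution D I) q" for q
      using circ_eq_iff[of "resolution D I" q p] p(2) by auto
    ultimately show "(if a \<in> {circ (resolution D I) (midpoint x t), circ (resolution D I) (midpoint x (opposite t))}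
        then circ (resolution D J) (midpoint x (opposite t)) else a) = m a"
      using m[OF p(1)] p by (auto simp: circ_self)
  qed
  finally show ?thesis .
qed

text \<open>\<open>edge_map\<close> picks some lift. By \<open>diff_times_cong\<close> the product
  does not notice when it is replaced by a known lift \<open>w\<close>.\<close>

lemma edge_map_split:
  assumes s: "splits D I x" and w: "w \<in> state_space D J"
    and m: "\<And>p. p \<in> points D \<Longrightarrow> m (circ (resolution D J) p) = circ (resolution D I) p"
  shows "edge_map D arr (I, x) (exterior_map m w) =
    (gen (circ (resolution D J) (midpoint x (opposite t))) - gen (circ (resolution D J) (midpoint x t))) * w"
proof -
  interpret s: surgery "resolution D J" "resolution D I" x by (rule surgery_sym)
  let ?a = "circ (resolution D I) (midpoint x t)"
  let ?b\<^sub>1 = "circ (resolution D J) (midpoint x (opposite t))" and ?b\<^sub>2 = "circ (resolution D J) (midpoint x t)"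
  have eq: "circ (resolution D I) (midpoint x (opposite t)) = ?a"
    using s splits_circ by blast
  have neq: "?b\<^sub>1 \<noteq> ?b\<^sub>2" using circ_split[OF eq[symmetric]] by blast
  define n where "n = (\<lambda>b. if b \<in> {?b\<^sub>1, ?b\<^sub>2} then ?a else b)"
  have nm: "n b = m b" if b: "b \<in> circles (resolution D J)" for b
  proof -
    obtain p where p: "p \<in> points D" "b = circ (resolution D J) p" using b by (auto simp: circles_eq)
    note s.circ_merge[OF neq[symmetric], of p] s.circ_merge[OF neq[symmetric], of "midpoint x t"]
    moreover have "b = circ (resolution D J) q \<longleftrightarrow> p \<in> circ (resolution D J) q" for q
      using circ_eq_iff[of "resolution D J" q p] p(2) by auto
    ultimately show ?thesis
      using m[OF p(1)] p by (auto simp: n_def circ_self)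
  qed
  \<comment> \<open>Sending \<open>?a\<close> to \<open>?b\<^sub>1\<close> below must not affect the
    circles away from the surgery, so none of them may equal \<open>?a\<close>.\<close>
  have a_old: "?a \<noteq> b" if b: "b \<in> circles (resolution D J)" "b \<notin> {?b\<^sub>1, ?b\<^sub>2}" for b
  proof
    assume "?a = b"
    then have "midpoint x t \<in> b" by auto
    moreover obtain p where "b = circ (resolution D J) p" using b(1) by (auto simp: circles_eq)
    ultimately have "b = ?b\<^sub>2" using circ_eq_iff[of "resolution D J" p "midpoint x t"] by simp
    then show False using b(2) by simp
  qed
  define w' where "w' = (SOME w'. w' \<in> state_space D J \<and> exterior_map n w' = exterior_map m w)"
  have nmw: "exterior_map n u = exterior_map m u" if "u \<in> state_space D J" for u
    using exterior_map_cong[OF that[unfolded state_space_def]] nm by blast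
  have "w' \<in> state_space D J \<and> exterior_map n w' = exterior_map m w"
    unfolding w'_def by (rule someI[of _ w]) (simp add: w nmw)
  then have w': "w' \<in> state_space D J" "exterior_map n w' = exterior_map n w" using nmw[OF w] by simp_all
  \<comment> \<open>Identifying \<open>?b\<^sub>2\<close> with \<open>?b\<^sub>1\<close> factors
    through \<open>n\<close>. So lifts with the same image under \<open>n\<close> satisfy the
    hypothesis of \<open>diff_times_cong\<close>.\<close>
  have r: "exterior_map (\<lambda>b. if b = ?b\<^sub>2 then ?b\<^sub>1 else b) u =
      exterior_map (\<lambda>c. if c = ?a then ?b\<^sub>1 else c) (exterior_map n u)" if "u \<in> state_space D J" for u
    unfolding exterior_map_comp
  proof (rule exterior_map_cong[OF that[unfolded state_space_def]])
    fix b assume b: "b \<in> circles (resolution D J)"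
    show "(if b = ?b\<^sub>2 then ?b\<^sub>1 else b) = (if n b = ?a then ?b\<^sub>1 else n b)"
      using a_old[OF b] by (auto simp: n_def)
  qed
  have "(gen ?b\<^sub>1 - gen ?b\<^sub>2) * w' = (gen ?b\<^sub>1 - gen ?b\<^sub>2) * w"
    by (rule diff_times_cong) (simp add: r w w')
  moreover have "edge_map D arr (I, x) (exterior_map m w) = (gen ?b\<^sub>1 - gen ?b\<^sub>2) * w'"
    unfolding edge_map_def Let_def fst_conv snd_conv circle_tail w'_def n_def
    by (rule if_not_P) (simp add: eq)
  ultimately show ?thesis by simp
qed

text \<open>The element of the algebra on the points by which the edge acts from the left.\<close>

definition \<theta> :: "point exterior"
  where "\<theta> = (if splits D I x then gen (midpoint x (opposite t)) - gen (midpoint x t) else 1)"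

lemma \<theta>_in: "\<theta> \<in> exterior_on (points D)"
  by (simp add: \<theta>_def exterior_on_gen)

lemma merge_map:
  assumes "\<not> splits D I x" "p \<in> points D"
  shows "transfer_circle (resolution D J) (circ (resolution D I) p) = circ (resolution D J) p"
proof -
  have "circ (resolution D I) (midpoint x t) \<noteq> circ (resolution D I) (midpoint x (opposite t))"
    using assms(1) splits_circ by blast
  note ref = circ_refines[OF this]
  show ?thesis by (rule transfer_circle_eq) (rule ref, use assms(2) in simp_all)
qed

lemma split_map:
  assumes "splits D I x" "p \<in> points D"
  shows "transfer_circle (resolution D I) (circ (resolution D J) p) = circ (resolution D I) p"
proof -
  interpret s: surgery "resolution D J" "resolution D I" x by (rule surgery_sym)
  have "circ (resolution D J) (midpoint x t) \<noteq> circ (resolution D J) (midpoint x (opposite t))"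
    using circ_split assms(1) splits_circ by blast
  note ref = s.circ_refines[OF this]
  show ?thesis by (rule transfer_circle_eq) (rule ref, use assms(2) in simp_all)
qed

lemma edge_map_quot:
  assumes w: "w \<in> exterior_on (points D)"
  shows "edge_map D arr (I, x) (quot D I w) = quot D J (\<theta> * w)"
proof (cases "splits D I x")
  case True
  \<comment> \<open>At a split the circles of \<open>J\<close> refine those of \<open>I\<close>, so
    \<open>quot D J w\<close> is a lift of \<open>quot D I w\<close>.\<close>
  have "quot D I w = exterior_map (transfer_circle (resolution D I)) (quot D J w)"
    unfolding exterior_map_comp by (rule exterior_map_cong[OF w]) (simp add: split_map True)
  then show ?thesis
    using edge_map_split[OF True quot_state[OF w] split_map[OF True]] by (simp add: \<theta>_def True)
next
  case False
  have "edge_map D arr (I, x) (quot D I w) = exterior_map (transfer_circle (resolution D J)) (quot D I w)"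
    by (rule edge_map_merge[OF False quot_state[OF w] merge_map[OF False]])
  also have "\<dots> = quot D J w"
    unfolding exterior_map_comp by (rule exterior_map_cong[OF w]) (simp add: merge_map False)
  finally show ?thesis by (simp add: \<theta>_def False)
qed

lemma edge_map_in:
  assumes "v \<in> state_space D I"
  shows "edge_map D arr (I, x) v \<in> state_space D J"
proof -
  obtain w where w: "w \<in> exterior_on (points D)" "v = quot D I w"
    using assms unfolding state_space_eq by blast
  show ?thesis
    unfolding w(2) edge_map_quot[OF w(1)] by (rule quot_state[OF exterior_on_times[OF \<theta>_in w(1)]])
qed

lemma edge_map_add:
  assumes "u \<in> state_space D I" "v \<in> state_space D I"
  shows "edge_map D arr (I, x) (u + v) = edge_map D arr (I, x) u + edge_map D arr (I, x) v"
proof -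
  obtain w w' where w: "w \<in> exterior_on (points D)" "u = quot D I w"
    "w' \<in> exterior_on (points D)" "v = quot D I w'"
    using assms unfolding state_space_eq by blast
  have "edge_map D arr (I, x) (u + v) = quot D J (\<theta> * (w + w'))"
    using edge_map_quot[OF exterior_on_closed(3)[OF w(1,3)]] w(2,4) by simp
  also have "\<dots> = quot D J (\<theta> * w) + quot D J (\<theta> * w')"
    by (simp only: distrib_left exterior_map_simps)
  finally show ?thesis unfolding w(2,4) edge_map_quot[OF w(1)] edge_map_quot[OF w(3)] .
qed

end

section \<open>Squares of the hypercube\<close>

lemma (in cube_edge) split_neq:
  assumes "splits D I x"
  shows "circ (resolution D J) (midpoint x d) \<noteq> circ (resolution D J) (midpoint x (opposite d))"
  using circ_split assms splits_circ by blast

lemma (in cube_edge) merge_eq: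
  assumes "\<not> splits D I x"
  shows "circ (resolution D J) (midpoint x d) = circ (resolution D J) (midpoint x (opposite d))"
proof -
  have "circ (resolution D I) (midpoint x d) \<noteq> circ (resolution D I) (midpoint x (opposite d))"
    using assms splits_circ by blast
  from circ_merge[OF this, of "midpoint x d"] circ_merge[OF this, of "midpoint x (opposite d)"]
  show ?thesis by simp
qed

lemma (in cube_edge) card_circles_step:
  "int (card (circles (resolution D J))) = int (card (circles (resolution D I))) + (if splits D I x then 1 else - 1)"
proof (cases "splits D I x")
  case True
  interpret s: surgery "resolution D J" "resolution D I" x by (rule surgery_sym)
  show ?thesis using s.card_circles[OF split_neq[OF True]] True by simp
next
  case False
  then have "circ (resolution D I) (midpoint x East) \<noteq> circ (resolution D I) (midpoint x (opposite East))"
    using splits_circ by blast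
  from card_circles[OF this] show ?thesis using False by simp
qed

definition arrow_diff :: "arrows \<Rightarrow> square \<Rightarrow> point exterior"
  where "arrow_diff arr x = gen (midpoint x (opposite (tail (arr x)))) - gen (midpoint x (tail (arr x)))"

lemma arrow_diff_anticommute: "arrow_diff arr x * arrow_diff arr y = - (arrow_diff arr y * arrow_diff arr x)"
  using vect_anticommute[of "frag_of (midpoint x (opposite (tail (arr x)))) - frag_of (midpoint x (tail (arr x)))"
      "frag_of (midpoint y (opposite (tail (arr y)))) - frag_of (midpoint y (tail (arr y)))"]
  by (simp add: arrow_diff_def)

lemma (in cube_edge) \<theta>_eq: "\<theta> = (if splits D I x then arrow_diff arr x else 1)"
  by (simp add: \<theta>_def arrow_diff_def)

locale cube_square =
  fixes D :: diagram and I :: "square \<Rightarrow> nat" and x y :: square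
  assumes D: "link_diagram D"
    and xc: "x \<in> crossings D" and yc: "y \<in> crossings D" and xy: "x \<noteq> y"
    and Ix: "I x = 0" and Iy: "I y = 0"
begin

abbreviation "I\<^sub>1\<^sub>0 \<equiv> I(x := 1)"
abbreviation "I\<^sub>0\<^sub>1 \<equiv> I(y := 1)"
abbreviation "I\<^sub>1\<^sub>1 \<equiv> I(x := 1, y := 1)"

lemma I11: "I(y := 1, x := 1) = I\<^sub>1\<^sub>1"
  using xy by (simp add: fun_upd_twist)

lemma square_sym: "cube_square D I y x"
  by standard (use D xc yc xy Ix Iy in auto)

lemma edges:
  assumes "arrow_choice D arr"
  shows "cube_edge D arr I x" "cube_edge D arr I y" "cube_edge D arr I\<^sub>1\<^sub>0 y" "cube_edge D arr I\<^sub>0\<^sub>1 x"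
  by (standard; use assms D xc yc xy Ix Iy in simp)+

lemma some_arrows: "\<exists>arr. arrow_choice D arr"
proof
  show "arrow_choice D (\<lambda>x. SOME s. s \<in> strands (smoothing 0 (D x)))"
    unfolding arrow_choice_def
  proof
    fix x assume "x \<in> crossings D"
    then have "\<exists>s. s \<in> strands (smoothing 0 (D x))"
      by (auto simp: crossings_def intro: exI[of _ "{North, West}"] exI[of _ "{North, East}"])
    then show "(SOME s. s \<in> strands (smoothing 0 (D x))) \<in> strands (smoothing 0 (D x))"
      by (rule someI_ex)
  qed
qed

lemma split_cases:
  obtains (same) "splits D I\<^sub>0\<^sub>1 x \<longleftrightarrow> splits D I x" "splits D I\<^sub>1\<^sub>0 y \<longleftrightarrow> splits D I y"
  | (parallel) "\<not> splits D I x" "\<not> splits D I y" "splits D I\<^sub>0\<^sub>1 x" "splits D I\<^sub>1\<^sub>0 y"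
  | (interleaved) "splits D I x" "splits D I y" "\<not> splits D I\<^sub>0\<^sub>1 x" "\<not> splits D I\<^sub>1\<^sub>0 y"
proof -
  obtain arr where arr: "arrow_choice D arr" using some_arrows by blast
  note e = edges[OF arr]
  \<comment> \<open>Both sides are the change in the number of circles from \<open>I\<close> to
    \<open>I\<^sub>1\<^sub>1\<close>, along the two paths of the face.\<close>
  have "(if splits D I x then 1 else - 1 :: int) + (if splits D I\<^sub>1\<^sub>0 y then 1 else - 1) =
      (if splits D I y then 1 else - 1) + (if splits D I\<^sub>0\<^sub>1 x then 1 else - 1)"
    using e[THEN cube_edge.card_circles_step] unfolding I11 by linarith
  then show ?thesis
    using that by (cases "splits D I x"; cases "splits D I y"; cases "splits D I\<^sub>1\<^sub>0 y"; cases "splits D I\<^sub>0\<^sub>1 x"; simp)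
qed

text \<open>The later edge contributes the left factor, so two paths with the same splits differ
  only in the order of the factors.\<close>

lemma composite_quot:
  assumes arr: "arrow_choice D arr" and w: "w \<in> exterior_on (points D)"
  shows "composite D arr I x y (quot D I w) = quot D I\<^sub>1\<^sub>1
    ((if splits D I\<^sub>1\<^sub>0 y then arrow_diff arr y else 1) * (if splits D I x then arrow_diff arr x else 1) * w)"
proof -
  note e = edges[OF arr]
  have "composite D arr I x y (quot D I w) = edge_map D arr (I\<^sub>1\<^sub>0, y) (quot D I\<^sub>1\<^sub>0 (cube_edge.\<theta> D arr I x * w))"
    unfolding composite_def cube_edge.edge_map_quot[OF e(1) w] ..
  also have "\<dots> = quot D I\<^sub>1\<^sub>1 (cube_edge.\<theta> D arr I\<^sub>1\<^sub>0 y * (cube_edge.\<theta> D arr I x * w))"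
    by (rule cube_edge.edge_map_quot[OF e(3) exterior_on_times[OF cube_edge.\<theta>_in[OF e(1)] w]])
  finally show ?thesis
    unfolding cube_edge.\<theta>_eq[OF e(1)] cube_edge.\<theta>_eq[OF e(3)] mult.assoc .
qed

lemma composite_quot':
  assumes arr: "arrow_choice D arr" and w: "w \<in> exterior_on (points D)"
  shows "composite D arr I y x (quot D I w) = quot D I\<^sub>1\<^sub>1
    ((if splits D I\<^sub>0\<^sub>1 x then arrow_diff arr x else 1) * (if splits D I y then arrow_diff arr y else 1) * w)"
  using cube_square.composite_quot[OF square_sym assms] unfolding I11 .

lemma quot_diff:
  "quot D I' (arrow_diff arr z) = gen (circ (resolution D I') (midpoint z (opposite (tail (arr z)))))
    - gen (circ (resolution D I') (midpoint z (tail (arr z))))"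
  by (simp add: arrow_diff_def)

text \<open>Both paths multiply by the same two differences, in opposite orders, whence the sign.
  The product is nonzero because the two splits cannot separate the same pair of circles.\<close>

lemma type_A_I:
  assumes arr: "arrow_choice D arr"
    and s: "splits D I x" "splits D I y" "splits D I\<^sub>0\<^sub>1 x" "splits D I\<^sub>1\<^sub>0 y"
  shows "type_A D arr I x y"
proof -
  note e = edges[OF arr]
  interpret s: surgery "resolution D I\<^sub>1\<^sub>1" "resolution D I\<^sub>1\<^sub>0" y
    by (rule surgery.surgery_sym, rule surgery_resolution) (use D yc xy Iy in auto)
  let ?c = "circ (resolution D I\<^sub>1\<^sub>1)"
  let ?a = "?c (midpoint x (tail (arr x)))" and ?a' = "?c (midpoint x (opposite (tail (arr x))))"
  let ?b = "?c (midpoint y (tail (arr y)))" and ?b' = "?c (midpoint y (opposite (tail (arr y))))"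
  have a: "?a \<noteq> ?a'" using cube_edge.split_neq[OF e(4) s(3)] unfolding I11 .
  have b: "?b \<noteq> ?b'" using cube_edge.split_neq[OF e(3) s(4)] .
  \<comment> \<open>Otherwise undoing the split at \<open>y\<close> would rejoin the circles that
    \<open>x\<close> has separated in \<open>I\<^sub>1\<^sub>0\<close>.\<close>
  have ab: "{?b', ?b} \<noteq> {?a', ?a}"
  proof
    assume "{?b', ?b} = {?a', ?a}"
    then have "midpoint x (tail (arr x)) \<in> ?b \<union> ?b'" "midpoint x (opposite (tail (arr x))) \<in> ?b \<union> ?b'"
      by (metis Un_iff circ_self doubleton_eq_iff)+
    then have "circ (resolution D I\<^sub>1\<^sub>0) (midpoint x (tail (arr x))) =
        circ (resolution D I\<^sub>1\<^sub>0) (midpoint x (opposite (tail (arr x))))"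
      using s.circ_merge[OF b] cube_edge.point_x[OF e(1)] by simp
    then show False using cube_edge.split_neq[OF e(1) s(1)] by blast
  qed
  have q: "composite D arr I x y (quot D I w) = quot D I\<^sub>1\<^sub>1 (arrow_diff arr y * arrow_diff arr x * w)"
    "composite D arr I y x (quot D I w) = - quot D I\<^sub>1\<^sub>1 (arrow_diff arr y * arrow_diff arr x * w)"
    if "w \<in> exterior_on (points D)" for w
    using composite_quot[OF arr that] composite_quot'[OF arr that] s arrow_diff_anticommute[of arr x y] by simp_all
  have nz: "quot D I\<^sub>1\<^sub>1 (arrow_diff arr y * arrow_diff arr x * 1) \<noteq> 0"
    using gen_diff_times_nonzero[OF b[symmetric] a[symmetric] ab] by (simp add: quot_diff)
  have one: "1 \<in> exterior_on (points D)" by simp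
  have "composites_nonzero D arr I x y"
    unfolding composites_nonzero_def
    using q[OF one] nz quot_state[OF one] by (metis neg_equal_0_iff_equal)
  moreover have "composite D arr I x y v = - composite D arr I y x v" if "v \<in> state_space D I" for v
    using that q unfolding state_space_eq by auto
  ultimately show ?thesis unfolding type_A_def by blast
qed

lemma type_C_I:
  assumes arr: "arrow_choice D arr"
    and s: "splits D I\<^sub>0\<^sub>1 x \<longleftrightarrow> splits D I x" "splits D I\<^sub>1\<^sub>0 y \<longleftrightarrow> splits D I y" "\<not> (splits D I x \<and> splits D I y)"
  shows "type_C D arr I x y"
proof -
  note e = edges[OF arr]
  let ?k = "if splits D I y then arrow_diff arr y else if splits D I x then arrow_diff arr x else 1"
  have q: "composite D arr I x y (quot D I w) = quot D I\<^sub>1\<^sub>1 (?k * w)"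
    "composite D arr I y x (quot D I w) = quot D I\<^sub>1\<^sub>1 (?k * w)"
    if "w \<in> exterior_on (points D)" for w
    using composite_quot[OF arr that] composite_quot'[OF arr that] s by simp_all
  have nz: "quot D I\<^sub>1\<^sub>1 (?k * 1) \<noteq> 0"
  proof -
    have "gen (circ (resolution D I\<^sub>1\<^sub>1) (midpoint y (opposite (tail (arr y)))))
        - gen (circ (resolution D I\<^sub>1\<^sub>1) (midpoint y (tail (arr y)))) \<noteq> 0" if "splits D I y"
      by (rule gen_diff_nonzero) (use cube_edge.split_neq[OF e(3), of "tail (arr y)"] s that in auto)
    moreover have "gen (circ (resolution D I\<^sub>1\<^sub>1) (midpoint x (opposite (tail (arr x)))))
        - gen (circ (resolution D I\<^sub>1\<^sub>1) (midpoint x (tail (arr x)))) \<noteq> 0" if "splits D I x"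
      by (rule gen_diff_nonzero) (use cube_edge.split_neq[OF e(4), of "tail (arr x)", unfolded I11] s that in auto)
    ultimately show ?thesis by (simp add: quot_diff)
  qed
  have one: "1 \<in> exterior_on (points D)" by simp
  have "composites_nonzero D arr I x y"
    unfolding composites_nonzero_def using q[OF one] nz quot_state[OF one] by metis
  moreover have "composite D arr I x y v = composite D arr I y x v" if "v \<in> state_space D I" for v
    using that q unfolding state_space_eq by auto
  ultimately show ?thesis unfolding type_C_def by blast
qed

text \<open>\<open>y\<close> merges at \<open>I\<close> but splits after \<open>x\<close>, so it
  cuts the circle that \<open>x\<close> has just formed. Both ends of the rotated arc at
  \<open>x\<close> lie on the two pieces, and on different ones since \<open>x\<close> splits in
  \<open>I\<^sub>0\<^sub>1\<close>.\<close>

lemma parallel_circles: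
  assumes "\<not> splits D I x" "\<not> splits D I y" "splits D I\<^sub>0\<^sub>1 x" "splits D I\<^sub>1\<^sub>0 y"
  shows "circ (resolution D I\<^sub>1\<^sub>1) (midpoint x d) = circ (resolution D I\<^sub>1\<^sub>1) (midpoint y e) \<and>
      circ (resolution D I\<^sub>1\<^sub>1) (midpoint x (opposite d)) = circ (resolution D I\<^sub>1\<^sub>1) (midpoint y (opposite e)) \<or>
    circ (resolution D I\<^sub>1\<^sub>1) (midpoint x d) = circ (resolution D I\<^sub>1\<^sub>1) (midpoint y (opposite e)) \<and>
      circ (resolution D I\<^sub>1\<^sub>1) (midpoint x (opposite d)) = circ (resolution D I\<^sub>1\<^sub>1) (midpoint y e)"
proof -
  obtain arr where arr: "arrow_choice D arr" using some_arrows by blast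
  note e = edges[OF arr]
  interpret x: surgery "resolution D I" "resolution D I\<^sub>1\<^sub>0" x
    by (rule surgery_resolution) (use D xc Ix in auto)
  interpret s: surgery "resolution D I\<^sub>1\<^sub>1" "resolution D I\<^sub>1\<^sub>0" y
    by (rule surgery.surgery_sym, rule surgery_resolution) (use D yc xy Iy in auto)
  have a: "circ (resolution D I\<^sub>1\<^sub>1) (midpoint x d) \<noteq> circ (resolution D I\<^sub>1\<^sub>1) (midpoint x (opposite d))"
    using cube_edge.split_neq[OF e(4) assms(3)] unfolding I11 .
  have b: "circ (resolution D I\<^sub>1\<^sub>1) (midpoint y e) \<noteq> circ (resolution D I\<^sub>1\<^sub>1) (midpoint y (opposite e))"
    using cube_edge.split_neq[OF e(3) assms(4)] .
  have nx: "circ (resolution D I) (midpoint x d) \<noteq> circ (resolution D I) (midpoint x (opposite d))"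
    using cube_edge.splits_circ[OF e(1)] assms(1) by blast
  have ny: "circ (resolution D I) (midpoint y e) \<noteq> circ (resolution D I) (midpoint y (opposite e))"
    using cube_edge.splits_circ[OF e(2)] assms(2) by blast
  have y10: "circ (resolution D I\<^sub>1\<^sub>0) (midpoint y e) = circ (resolution D I\<^sub>1\<^sub>0) (midpoint y (opposite e))"
    using cube_edge.splits_circ[OF e(3)] assms(4) by blast
  let ?Z = "circ (resolution D I) (midpoint x d) \<union> circ (resolution D I) (midpoint x (opposite d))"
  have pts: "midpoint x f \<in> points D" "midpoint y f \<in> points D" for f
    using cube_edge.point_x[OF e(1)] cube_edge.point_x[OF e(2)] by auto
  note mx = x.circ_merge[OF nx, unfolded points_resolution]
  \<comment> \<open>Otherwise the surgery at \<open>x\<close> would leave the circles at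
    \<open>y\<close> alone, and \<open>y\<close> would still merge.\<close>
  have "midpoint y e \<in> ?Z \<or> midpoint y (opposite e) \<in> ?Z"
  proof (rule ccontr)
    assume "\<not> (midpoint y e \<in> ?Z \<or> midpoint y (opposite e) \<in> ?Z)"
    then show False using mx[OF pts(2), of e] mx[OF pts(2), of "opposite e"] y10 ny by simp
  qed
  then have "circ (resolution D I\<^sub>1\<^sub>0) (midpoint y e) = ?Z"
    using mx[OF pts(2), of e] mx[OF pts(2), of "opposite e"] y10 by auto
  moreover have "circ (resolution D I\<^sub>1\<^sub>0) (midpoint y e) =
      circ (resolution D I\<^sub>1\<^sub>1) (midpoint y e) \<union> circ (resolution D I\<^sub>1\<^sub>1) (midpoint y (opposite e))"
    using s.circ_merge[OF b, of "midpoint y e"] pts by simp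
  ultimately have Z: "?Z = circ (resolution D I\<^sub>1\<^sub>1) (midpoint y e) \<union> circ (resolution D I\<^sub>1\<^sub>1) (midpoint y (opposite e))"
    by simp
  have "midpoint x d \<in> ?Z" "midpoint x (opposite d) \<in> ?Z" by auto
  then show ?thesis
    using a unfolding Z
    using circ_eq_iff[of "resolution D I\<^sub>1\<^sub>1" "midpoint y e"] circ_eq_iff[of "resolution D I\<^sub>1\<^sub>1" "midpoint y (opposite e)"]
    by (metis Un_iff)
qed

text \<open>Each path multiplies by one difference. By \<open>parallel_circles\<close> the two agree
  up to a sign, which is read off from the circles at the tails.\<close>

lemma parallel_type:
  assumes arr: "arrow_choice D arr"
    and s: "\<not> splits D I x" "\<not> splits D I y" "splits D I\<^sub>0\<^sub>1 x" "splits D I\<^sub>1\<^sub>0 y"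
  shows "if circ (resolution D I\<^sub>1\<^sub>1) (midpoint x (tail (arr x))) = circ (resolution D I\<^sub>1\<^sub>1) (midpoint y (tail (arr y)))
    then type_C D arr I x y else type_A D arr I x y"
proof -
  note e = edges[OF arr]
  have q: "composite D arr I x y (quot D I w) = quot D I\<^sub>1\<^sub>1 (arrow_diff arr y) * quot D I\<^sub>1\<^sub>1 w"
    "composite D arr I y x (quot D I w) = quot D I\<^sub>1\<^sub>1 (arrow_diff arr x) * quot D I\<^sub>1\<^sub>1 w"
    if "w \<in> exterior_on (points D)" for w
    using composite_quot[OF arr that] composite_quot'[OF arr that] s by simp_all
  have nz_y: "quot D I\<^sub>1\<^sub>1 (arrow_diff arr y) \<noteq> 0"
    unfolding quot_diff by (rule gen_diff_nonzero) (use cube_edge.split_neq[OF e(3) s(4), of "tail (arr y)"] in auto)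
  have nz_x: "quot D I\<^sub>1\<^sub>1 (arrow_diff arr x) \<noteq> 0"
    unfolding quot_diff
    by (rule gen_diff_nonzero) (use cube_edge.split_neq[OF e(4) s(3), of "tail (arr x)", unfolded I11] in auto)
  have one: "1 \<in> exterior_on (points D)" by simp
  have n: "composites_nonzero D arr I x y"
    unfolding composites_nonzero_def using q[OF one] nz_x nz_y quot_state[OF one]
    by (metis exterior_map_simps(2) mult.right_neutral)
  note p = parallel_circles[OF s, of "tail (arr x)" "tail (arr y)"]
  have ne: "circ (resolution D I\<^sub>1\<^sub>1) (midpoint y (tail (arr y))) \<noteq> circ (resolution D I\<^sub>1\<^sub>1) (midpoint y (opposite (tail (arr y))))"
    using cube_edge.split_neq[OF e(3) s(4)] .
  show ?thesis
  proof (cases "circ (resolution D I\<^sub>1\<^sub>1) (midpoint x (tail (arr x))) = circ (resolution D I\<^sub>1\<^sub>1) (midpoint y (tail (arr y)))")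
    case True
    then have "quot D I\<^sub>1\<^sub>1 (arrow_diff arr x) = quot D I\<^sub>1\<^sub>1 (arrow_diff arr y)"
      using p ne unfolding quot_diff by auto
    then show ?thesis using True n q unfolding type_C_def state_space_eq by auto
  next
    case False
    then have "quot D I\<^sub>1\<^sub>1 (arrow_diff arr x) = - quot D I\<^sub>1\<^sub>1 (arrow_diff arr y)"
      using p unfolding quot_diff by auto
    then show ?thesis using False n q unfolding type_A_def state_space_eq by auto
  qed
qed

text \<open>Whichever crossing splits first, the other one merges the two circles again, and their
  difference becomes 0.\<close>

lemma interleaved_zero:
  assumes arr: "arrow_choice D arr" and v: "v \<in> state_space D I"
    and s: "splits D I x" "splits D I y" "\<not> splits D I\<^sub>0\<^sub>1 x" "\<not> splits D I\<^sub>1\<^sub>0 y"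
  shows "composite D arr I x y v = 0" "composite D arr I y x v = 0"
proof -
  note e = edges[OF arr]
  obtain w where w: "w \<in> exterior_on (points D)" "v = quot D I w" using v unfolding state_space_eq by blast
  have "quot D I\<^sub>1\<^sub>1 (arrow_diff arr x) = 0" "quot D I\<^sub>1\<^sub>1 (arrow_diff arr y) = 0"
    unfolding quot_diff
    using cube_edge.merge_eq[OF e(4) s(3), of "tail (arr x)"] cube_edge.merge_eq[OF e(3) s(4), of "tail (arr y)"]
    unfolding I11 by simp_all
  then show "composite D arr I x y v = 0" "composite D arr I y x v = 0"
    unfolding w(2) composite_quot[OF arr w(1)] composite_quot'[OF arr w(1)] using s by simp_all
qed

text \<open>A surgery at \<open>x\<close> that turns the split at \<open>y\<close> into a merge must
  cut the circle at \<open>y\<close>; so all four ends lie on this circle.\<close>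

lemma two_arcs_I:
  assumes arr: "arrow_choice D arr"
    and s: "splits D I x" "splits D I y" "\<not> splits D I\<^sub>0\<^sub>1 x" "\<not> splits D I\<^sub>1\<^sub>0 y"
  shows "two_arcs (resolution D I) (resolution D I\<^sub>1\<^sub>0) x y (tail (arr x)) (tail (arr y))"
proof -
  note e = edges[OF arr]
  interpret x: surgery "resolution D I" "resolution D I\<^sub>1\<^sub>0" x
    by (rule surgery_resolution) (use D xc Ix in auto)
  interpret y: surgery "resolution D I" "resolution D I\<^sub>0\<^sub>1" y
    by (rule surgery_resolution) (use D yc Iy in auto)
  interpret x': surgery "resolution D I\<^sub>1\<^sub>0" "resolution D I" x by (rule x.surgery_sym)
  let ?d = "tail (arr x)" and ?e = "tail (arr y)"
  have pts: "midpoint x f \<in> points D" "midpoint y f \<in> points D" for f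
    using cube_edge.point_x[OF e(1)] cube_edge.point_x[OF e(2)] by auto
  have nx: "circ (resolution D I\<^sub>1\<^sub>0) (midpoint x ?d) \<noteq> circ (resolution D I\<^sub>1\<^sub>0) (midpoint x (opposite ?d))"
    using cube_edge.split_neq[OF e(1) s(1)] .
  have ny: "circ (resolution D I\<^sub>1\<^sub>0) (midpoint y ?e) \<noteq> circ (resolution D I\<^sub>1\<^sub>0) (midpoint y (opposite ?e))"
    using cube_edge.splits_circ[OF e(3)] s(4) by blast
  have cx: "circ (resolution D I) (midpoint x ?d) = circ (resolution D I) (midpoint x (opposite ?d))"
    using cube_edge.splits_circ[OF e(1)] s(1) by blast
  have cy: "circ (resolution D I) (midpoint y ?e) = circ (resolution D I) (midpoint y (opposite ?e))"
    using cube_edge.splits_circ[OF e(2)] s(2) by blast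
  note m = x'.circ_merge[OF nx, unfolded points_resolution]
  have "circ (resolution D I) (midpoint y ?e) = circ (resolution D I) (midpoint x ?d)"
    using m[OF pts(2), of ?e] m[OF pts(2), of "opposite ?e"] m[OF pts(1), of ?d] cy ny
    by (auto split: if_splits)
  then show ?thesis
    using y.tiles cx cy ny xy cube_edge.strand_t[OF e(1)] cube_edge.strand_t[OF e(2)] by unfold_locales auto
qed

end

lemma (in two_arcs) inside_iff:
  "circle_through M\<^sub>0 x {d, rot d} = a" "circle_through M\<^sub>0 x (- {d, rot d}) = a"
  "circle_through M\<^sub>0 y {e, rot e} = a" "circle_through M\<^sub>0 y (- {e, rot e}) = a"
proof -
  interpret fd: two_arcs M\<^sub>0 M\<^sub>1 x y "opposite d" e by (rule flip_d)
  interpret fe: two_arcs M\<^sub>0 M\<^sub>1 x y d "opposite e" by (rule flip_e)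
  show "circle_through M\<^sub>0 x {d, rot d} = a" "circle_through M\<^sub>0 y {e, rot e} = a"
    using circle_through_strand[of d "rot d" M\<^sub>0 x] circle_through_strand[of e "rot e" M\<^sub>0 y]
      strands_x strands_y circ_y by simp_all
  show "circle_through M\<^sub>0 x (- {d, rot d}) = a" "circle_through M\<^sub>0 y (- {e, rot e}) = a"
    unfolding side_compl
    using circle_through_strand[of "opposite d" "rot (opposite d)" M\<^sub>0 x]
      circle_through_strand[of "opposite e" "rot (opposite e)" M\<^sub>0 y]
      fd.strands_x fe.strands_y circ_x circ_y by simp_all
qed

lemma (in two_arcs) interleaved_via_I:
  assumes M: "M\<^sub>0 = resolution D I" and arr: "arr x = {d, rot d}" "arr y = {e, rot e}"
    and i: "inside a (right_of (x, rot d))"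
  shows "if circ M\<^sub>1 (midpoint y e) = circ M\<^sub>1 (midpoint x (opposite d))
    then interleaved_via D arr I x y (arr y) else interleaved_via D arr I x y (- arr y)"
proof -
  have ai: "arc_inside a arr x" "\<not> arc_inside a arr y"
    using arc_inside_corner[of arr x d a] arc_inside_corner[of arr y e a] arr i inside_opposite by auto
  have cc: "d \<in> arr x" "counterclockwise a (x, d)"
    using arr i left_x by (simp_all add: counterclockwise_left)
  note c = inside_iff[folded arr]
  show ?thesis
  proof (cases "circ M\<^sub>1 (midpoint y e) = circ M\<^sub>1 (midpoint x (opposite d))")
    case True
    have "interleaved_via D arr I x y (arr y)"
      unfolding interleaved_via_def Let_def M[symmetric] c
      using ai cc meeting_order[OF i True, folded arr] by blast
    then show ?thesis using True by simp
  next
    case False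
    have "interleaved_via D arr I x y (- arr y)"
      unfolding interleaved_via_def Let_def M[symmetric] c double_complement
      using ai cc meeting_order'[OF i False, folded arr] by blast
    then show ?thesis using False by simp
  qed
qed

context cube_square
begin

text \<open>Whether the next endpoint met after the tail of the inside arc is the tail of the outside one:
  surgery along the inside arc cuts the circle into the two parts between its endpoints.\<close>

definition tail_next :: "arrows \<Rightarrow> bool"
  where "tail_next arr \<longleftrightarrow>
    (if inside (circ (resolution D I) (midpoint x (tail (arr x)))) (right_of (x, rot (tail (arr x))))
     then circ (resolution D I\<^sub>1\<^sub>0) (midpoint y (tail (arr y))) = circ (resolution D I\<^sub>1\<^sub>0) (midpoint x (opposite (tail (arr x))))
     else circ (resolution D I\<^sub>0\<^sub>1) (midpoint x (tail (arr x))) = circ (resolution D I\<^sub>0\<^sub>1) (midpoint y (opposite (tail (arr y)))))"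

lemma interleaved_type:
  assumes arr: "arrow_choice D arr"
    and s: "splits D I x" "splits D I y" "\<not> splits D I\<^sub>0\<^sub>1 x" "\<not> splits D I\<^sub>1\<^sub>0 y"
  shows "if tail_next arr then type_X D arr I x y else type_Y D arr I x y"
proof -
  interpret t: two_arcs "resolution D I" "resolution D I\<^sub>1\<^sub>0" x y "tail (arr x)" "tail (arr y)"
    by (rule two_arcs_I[OF arr s])
  interpret t': two_arcs "resolution D I" "resolution D I\<^sub>0\<^sub>1" y x "tail (arr y)" "tail (arr x)"
    by (rule cube_square.two_arcs_I[OF square_sym arr s(2,1,4,3)])
  note a = arrow_tail(1)[OF arr xc] arrow_tail(1)[OF arr yc]
  show ?thesis
  proof (cases "inside t.a (right_of (x, rot (tail (arr x))))")
    case True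
    then show ?thesis
      using t.interleaved_via_I[OF refl a True] unfolding tail_next_def type_X_def type_Y_def by auto
  next
    case False
    then have "inside t'.a (right_of (y, rot (tail (arr y))))"
      using t.inside_opposite t.circ_y(1) by auto
    from t'.interleaved_via_I[OF refl a(2,1) this] show ?thesis
      using False unfolding tail_next_def type_X_def type_Y_def by auto
  qed
qed

text \<open>Which arc is inside does not depend on the arrows. Reversing the arrow of one crossing
  either exchanges the two parts of the circle or the two ends lying on them, so each reversal
  toggles the condition.\<close>

lemma tail_next_flip:
  assumes arr: "arrow_choice D arr" and arr': "arrow_choice D arr'"
    and s: "splits D I x" "splits D I y" "\<not> splits D I\<^sub>0\<^sub>1 x" "\<not> splits D I\<^sub>1\<^sub>0 y"
  shows "tail_next arr' \<longleftrightarrow>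
    ((tail_next arr \<longleftrightarrow> tail (arr' x) = tail (arr x)) \<longleftrightarrow> tail (arr' y) = tail (arr y))"
proof -
  interpret t: two_arcs "resolution D I" "resolution D I\<^sub>1\<^sub>0" x y "tail (arr x)" "tail (arr y)"
    by (rule two_arcs_I[OF arr s])
  interpret t': two_arcs "resolution D I" "resolution D I\<^sub>0\<^sub>1" y x "tail (arr y)" "tail (arr x)"
    by (rule cube_square.two_arcs_I[OF square_sym arr s(2,1,4,3)])
  interpret fx: two_arcs "resolution D I" "resolution D I\<^sub>1\<^sub>0" x y "opposite (tail (arr x))" "tail (arr y)"
    by (rule t.flip_d)
  from arrow_compl[OF arr arr' xc]
  have c: "circ (resolution D I) (midpoint x (tail (arr' x))) = t.a"
  proof
    assume "tail (arr' x) = opposite (tail (arr x))"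
    then show ?thesis unfolding t.circ_x by (simp only:)
  qed (simp only:)
  have o: "inside t.a (right_of (x, rot (opposite (tail (arr x))))) = inside t.a (right_of (x, rot (tail (arr x))))"
    using t.inside_opposite fx.inside_opposite unfolding t.circ_x[symmetric] by blast
  from arrow_compl[OF arr arr' xc]
  have i: "inside t.a (right_of (x, rot (tail (arr' x)))) = inside t.a (right_of (x, rot (tail (arr x))))"
  proof
    assume "tail (arr' x) = opposite (tail (arr x))"
    then show ?thesis using o by (simp only:)
  qed (simp only:)
  have "circ (resolution D I\<^sub>1\<^sub>0) (midpoint y (tail (arr' y))) = circ (resolution D I\<^sub>1\<^sub>0) (midpoint x (opposite (tail (arr' x))))
    \<longleftrightarrow> ((circ (resolution D I\<^sub>1\<^sub>0) (midpoint y (tail (arr y))) = t.b\<^sub>2 \<longleftrightarrow> tail (arr' x) = tail (arr x))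
      \<longleftrightarrow> tail (arr' y) = tail (arr y))"
    using arrow_compl[OF arr arr' xc] arrow_compl[OF arr arr' yc]
    by (elim disjE; use t.y_circs t.b_neq in \<open>elim disjE conjE; simp\<close>)
  moreover have "circ (resolution D I\<^sub>0\<^sub>1) (midpoint x (tail (arr' x))) = circ (resolution D I\<^sub>0\<^sub>1) (midpoint y (opposite (tail (arr' y))))
    \<longleftrightarrow> ((circ (resolution D I\<^sub>0\<^sub>1) (midpoint x (tail (arr x))) = t'.b\<^sub>2 \<longleftrightarrow> tail (arr' x) = tail (arr x))
      \<longleftrightarrow> tail (arr' y) = tail (arr y))"
    using arrow_compl[OF arr arr' xc] arrow_compl[OF arr arr' yc]
    by (elim disjE; use t'.y_circs t'.b_neq in \<open>elim disjE conjE; simp\<close>)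
  ultimately show ?thesis
    unfolding tail_next_def c i by simp
qed

end

section \<open>Signs\<close>

definition square_sign :: "(edge \<Rightarrow> int) \<Rightarrow> (square \<Rightarrow> nat) \<Rightarrow> square \<Rightarrow> square \<Rightarrow> int"
  where "square_sign \<epsilon> I x y = \<epsilon> (I, x) * \<epsilon> (I(x := 1), y) * (\<epsilon> (I, y) * \<epsilon> (I(y := 1), x))"

lemma square_sign_mult: "square_sign (\<lambda>e. \<epsilon> e * \<eta> e) I x y = square_sign \<epsilon> I x y * square_sign \<eta> I x y"
  by (simp add: square_sign_def)

text \<open>The four edges are distinct, so the cardinality in \<open>even_square\<close> counts the
  negative factors of the product.\<close>

lemma even_square_iff:
  assumes "x \<noteq> y" "I x = 0" "I y = 0"
    and "\<epsilon> (I, x) \<in> {1, - 1}" "\<epsilon> (I(x := 1), y) \<in> {1, - 1}" "\<epsilon> (I, y) \<in> {1, - 1}" "\<epsilon> (I(y := 1), x) \<in> {1, - 1}"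
  shows "even_square \<epsilon> I x y \<longleftrightarrow> square_sign \<epsilon> I x y = 1"
proof -
  let ?e\<^sub>1 = "(I, x)" and ?e\<^sub>2 = "(I(x := 1), y)" and ?e\<^sub>3 = "(I, y)" and ?e\<^sub>4 = "(I(y := 1), x)"
  have "I \<noteq> I(x := 1)" "I \<noteq> I(y := 1)" using assms(2,3) by (metis fun_upd_same zero_neq_one)+
  then have d: "distinct [?e\<^sub>1, ?e\<^sub>2, ?e\<^sub>3, ?e\<^sub>4]" using assms(1) by auto
  have "card {e \<in> {?e\<^sub>1, ?e\<^sub>2, ?e\<^sub>3, ?e\<^sub>4}. \<epsilon> e = - 1} = (\<Sum>e\<in>{?e\<^sub>1, ?e\<^sub>2, ?e\<^sub>3, ?e\<^sub>4}. if \<epsilon> e = - 1 then 1 else 0)"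
    by (simp only: card_eq_sum) (rule sum.inter_filter, simp)
  also have "\<dots> = (if \<epsilon> ?e\<^sub>1 = - 1 then 1 else 0) + ((if \<epsilon> ?e\<^sub>2 = - 1 then 1 else 0)
      + ((if \<epsilon> ?e\<^sub>3 = - 1 then 1 else 0) + (if \<epsilon> ?e\<^sub>4 = - 1 then 1 else 0)))"
    using d by simp
  finally show ?thesis
    using assms(4-7) unfolding even_square_def square_sign_def by auto
qed

lemma (in cube_square) square_edges:
  assumes "I \<in> vertices D"
  shows "(I, x) \<in> edges D" "(I(x := 1), y) \<in> edges D" "(I, y) \<in> edges D" "(I(y := 1), x) \<in> edges D"
    "(I, x, y) \<in> squares D"
proof -
  have "I(z := 1) \<in> vertices D" if "z \<in> crossings D" for z
    using assms that unfolding vertices_def by (auto simp: PiE_iff extensional_def)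
  then show "(I, x) \<in> edges D" "(I(x := 1), y) \<in> edges D" "(I, y) \<in> edges D" "(I(y := 1), x) \<in> edges D"
    "(I, x, y) \<in> squares D"
    using assms xc yc xy Ix Iy unfolding edges_def squares_def by auto
qed

text \<open>The face sign forced by an assignment of type X, in terms of splits instead of types.
  The cases are faces with equal paths (types A and C), interleaved faces (X and Y) and parallel
  faces (C and A).\<close>

definition (in cube_square) sign_X :: "arrows \<Rightarrow> int"
  where "sign_X arr =
    (if splits D I\<^sub>0\<^sub>1 x = splits D I x then (if splits D I x \<and> splits D I y then 1 else - 1)
     else if splits D I x then (if tail_next arr then 1 else - 1)
     else (if circ (resolution D I\<^sub>1\<^sub>1) (midpoint x (tail (arr x))) = circ (resolution D I\<^sub>1\<^sub>1) (midpoint y (tail (arr y)))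
       then - 1 else 1))"

definition (in cube_square) sign_Y :: "arrows \<Rightarrow> int"
  where "sign_Y arr = (if splits D I x \<and> splits D I y \<and> \<not> splits D I\<^sub>1\<^sub>0 y then - sign_X arr else sign_X arr)"

lemma (in cube_square) square_sign_AC:
  assumes arr: "arrow_choice D arr" and I: "I \<in> vertices D"
    and pm: "\<And>e. e \<in> edges D \<Longrightarrow> \<epsilon> e \<in> {1, - 1}"
    and A: "type_A D arr I x y \<longrightarrow> even_square \<epsilon> I x y" and C: "type_C D arr I x y \<longrightarrow> \<not> even_square \<epsilon> I x y"
  shows "square_sign \<epsilon> I x y = (if even_square \<epsilon> I x y then 1 else - 1)"
    "\<not> (splits D I x \<and> splits D I y \<and> \<not> splits D I\<^sub>1\<^sub>0 y) \<Longrightarrow> square_sign \<epsilon> I x y = sign_X arr"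
proof -
  note e = square_edges[OF I]
  have "square_sign \<epsilon> I x y \<in> {1, - 1}"
    using pm[OF e(1)] pm[OF e(2)] pm[OF e(3)] pm[OF e(4)] unfolding square_sign_def by auto
  moreover have "even_square \<epsilon> I x y \<longleftrightarrow> square_sign \<epsilon> I x y = 1"
    by (rule even_square_iff) (use xy Ix Iy pm e in auto)
  ultimately show s: "square_sign \<epsilon> I x y = (if even_square \<epsilon> I x y then 1 else - 1)" by auto
  show "square_sign \<epsilon> I x y = sign_X arr" if "\<not> (splits D I x \<and> splits D I y \<and> \<not> splits D I\<^sub>1\<^sub>0 y)"
  proof (cases rule: split_cases)
    case same
    then show ?thesis using s A C type_A_I[OF arr] type_C_I[OF arr] unfolding sign_X_def by auto
  next
    case parallel
    then show ?thesis
      using s A C parallel_type[OF arr parallel] unfolding sign_X_def by (auto split: if_splits)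
  qed (use that in blast)
qed

lemma (in cube_square) square_sign_X:
  assumes arr: "arrow_choice D arr" and a: "edge_assignment_X D arr \<epsilon>" and I: "I \<in> vertices D"
  shows "square_sign \<epsilon> I x y = sign_X arr"
proof -
  have pm: "\<And>e. e \<in> edges D \<Longrightarrow> \<epsilon> e \<in> {1, - 1}"
    and t: "type_A D arr I x y \<or> type_X D arr I x y \<longrightarrow> even_square \<epsilon> I x y"
      "type_C D arr I x y \<or> type_Y D arr I x y \<longrightarrow> \<not> even_square \<epsilon> I x y"
    using a square_edges(5)[OF I] unfolding edge_assignment_X_def by blast+
  have AC: "type_A D arr I x y \<longrightarrow> even_square \<epsilon> I x y" "type_C D arr I x y \<longrightarrow> \<not> even_square \<epsilon> I x y"
    using t by blast+
  note s = square_sign_AC[OF arr I pm AC]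
  show ?thesis
  proof (cases rule: split_cases)
    case interleaved
    then show ?thesis
      using s(1) t interleaved_type[OF arr interleaved] unfolding sign_X_def by (auto split: if_splits)
  qed (use s(2) in blast)+
qed

lemma (in cube_square) square_sign_Y:
  assumes arr: "arrow_choice D arr" and a: "edge_assignment_Y D arr \<epsilon>" and I: "I \<in> vertices D"
  shows "square_sign \<epsilon> I x y = sign_Y arr"
proof -
  have pm: "\<And>e. e \<in> edges D \<Longrightarrow> \<epsilon> e \<in> {1, - 1}"
    and t: "type_A D arr I x y \<or> type_Y D arr I x y \<longrightarrow> even_square \<epsilon> I x y"
      "type_C D arr I x y \<or> type_X D arr I x y \<longrightarrow> \<not> even_square \<epsilon> I x y"
    using a square_edges(5)[OF I] unfolding edge_assignment_Y_def by blast+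
  have AC: "type_A D arr I x y \<longrightarrow> even_square \<epsilon> I x y" "type_C D arr I x y \<longrightarrow> \<not> even_square \<epsilon> I x y"
    using t by blast+
  note s = square_sign_AC[OF arr I pm AC]
  show ?thesis
  proof (cases rule: split_cases)
    case interleaved
    then show ?thesis
      using s(1) t interleaved_type[OF arr interleaved] unfolding sign_X_def sign_Y_def
      by (auto split: if_splits)
  qed (use s(2) in \<open>auto simp: sign_Y_def\<close>)+
qed

text \<open>The ratio of the edge maps for two choices of arrows: reversal negates the difference at
  a split and leaves merges unchanged.\<close>

definition reversal :: "diagram \<Rightarrow> arrows \<Rightarrow> arrows \<Rightarrow> edge \<Rightarrow> int"
  where "reversal D arr arr' = (\<lambda>(I, x). if splits D I x \<and> tail (arr' x) \<noteq> tail (arr x) then - 1 else 1)"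

text \<open>On a face with equal paths the splits of a crossing come in pairs, and its signs cancel.
  Otherwise each crossing splits on exactly one edge, and reversing its arrow toggles the condition
  in \<open>sign_X\<close>.\<close>

lemma (in cube_square) sign_X_reversal:
  assumes arr: "arrow_choice D arr" and arr': "arrow_choice D arr'"
  shows "sign_X arr' = sign_X arr * square_sign (reversal D arr arr') I x y"
proof (cases rule: split_cases)
  case same
  then show ?thesis unfolding sign_X_def square_sign_def reversal_def by auto
next
  case parallel
  have ne: "circ (resolution D I\<^sub>1\<^sub>1) (midpoint x d) \<noteq> circ (resolution D I\<^sub>1\<^sub>1) (midpoint x (opposite d))" for d
    using cube_edge.split_neq[OF edges(4)[OF arr] parallel(3)] unfolding I11 .
  show ?thesis
    using parallel parallel_circles[OF parallel, of "tail (arr x)" "tail (arr y)"] ne[of "tail (arr x)"]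
      arrow_compl[OF arr arr' xc] arrow_compl[OF arr arr' yc]
    unfolding sign_X_def square_sign_def reversal_def by auto
next
  case interleaved
  then show ?thesis
    using tail_next_flip[OF arr arr' interleaved]
    unfolding sign_X_def square_sign_def reversal_def by auto
qed

lemma (in cube_square) sign_Y_reversal:
  assumes arr: "arrow_choice D arr" and arr': "arrow_choice D arr'"
  shows "sign_Y arr' = sign_Y arr * square_sign (reversal D arr arr') I x y"
  unfolding sign_Y_def using sign_X_reversal[OF assms] by simp

section \<open>Comparing type X with type Y\<close>

text \<open>The side is chosen so that the corner is in the region of the rotated arc at \<open>z\<close>.\<close>

definition odd_arc :: "diagram \<Rightarrow> square \<Rightarrow> bool"
  where "odd_arc D z \<longleftrightarrow> inside (points D) (left_of (z, if D z = CrossH then East else North))"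

text \<open>The sign up to which the reflection commutes with an edge map, see
  \<open>edge_map_reflect\<close>.\<close>

definition colour_sign :: "diagram \<Rightarrow> edge \<Rightarrow> int"
  where "colour_sign D = (\<lambda>(I, z). if splits D I z \<and> odd_arc D z then - 1 else 1)"

lemma reflected_diff_all:
  assumes M: "flat M" and t: "M x \<in> {Arcs_NW_SE, Arcs_NE_SW}" "{d, rot d} \<in> strands (M x)"
  shows "reflected M (midpoint x f) - reflected M (midpoint x (opposite f)) =
    flip_if (inside (points M) (left_of (x, d)))
      (frag_of (circ M (midpoint x f)) - frag_of (circ M (midpoint x (opposite f))))"
proof -
  have s: "{opposite d, opposite (rot d)} \<in> strands (M x)"
    using t by (cases d) (auto simp: doubleton_eq_iff)
  have c: "circ M (midpoint x (rot d)) = circ M (midpoint x d)"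
    "circ M (midpoint x (opposite (rot d))) = circ M (midpoint x (opposite d))"
    using circ_joined[of d "rot d" M x] circ_joined[of "opposite d" "opposite (rot d)" M x] t(2) s by simp_all
  have r: "reflected M (midpoint x (rot d)) = reflected M (midpoint x d)"
    "reflected M (midpoint x (opposite (rot d))) = reflected M (midpoint x (opposite d))"
    using reflected_circ[OF M] c by blast+
  note base = reflection_diff[OF M t]
  have base': "reflected M (midpoint x (opposite d)) - reflected M (midpoint x d) =
    flip_if (inside (points M) (left_of (x, d)))
      (frag_of (circ M (midpoint x (opposite d))) - frag_of (circ M (midpoint x d)))"
    using arg_cong[OF base, of uminus] by (simp add: flip_if_def split: if_splits)
  have "f = d \<or> f = opposite d \<or> f = rot d \<or> f = opposite (rot d)"
    by (cases d; cases f) simp_all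
  then show ?thesis using base base' c r by auto
qed

context cube_edge
begin

lemma reflected_after:
  "reflected (resolution D J) (midpoint x d) - reflected (resolution D J) (midpoint x (opposite d)) =
    flip_if (odd_arc D x) (frag_of (circ (resolution D J) (midpoint x d))
      - frag_of (circ (resolution D J) (midpoint x (opposite d))))"
proof (cases "D x = CrossH")
  case True
  then have "resolution D J x = Arcs_NE_SW" using x by (simp add: resolution_def)
  then show ?thesis
    using reflected_diff_all[OF flat1, of x East d] True by (simp add: odd_arc_def insert_commute)
next
  case False
  then have "D x = CrossV" using x by (simp add: crossings_def)
  then have "resolution D J x = Arcs_NW_SE" using x by (simp add: resolution_def)
  then show ?thesis
    using reflected_diff_all[OF flat1, of x North d] False by (simp add: odd_arc_def)
qed

text \<open>The arc and the rotated arc lie in adjacent regions at the crossing, of opposite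
  colours; this is the negation by which the formula differs from
  \<open>reflected_after\<close>.\<close>

lemma reflected_before:
  "reflected (resolution D I) (midpoint x d) - reflected (resolution D I) (midpoint x (opposite d)) =
    flip_if (\<not> odd_arc D x) (frag_of (circ (resolution D I) (midpoint x d))
      - frag_of (circ (resolution D I) (midpoint x (opposite d))))"
proof -
  note c = inside_corners[OF flat0 stranded_points, of x, unfolded points_resolution]
  show ?thesis
  proof (cases "D x = CrossH")
    case True
    then have "resolution D I x = Arcs_NW_SE" using x Ix by (simp add: resolution_def)
    then show ?thesis
      using reflected_diff_all[OF flat0, of x North d] True c
      by (simp add: odd_arc_def corner_simps)
  next
    case False
    then have "D x = CrossV" using x by (simp add: crossings_def)
    then have "resolution D I x = Arcs_NE_SW" using x Ix by (simp add: resolution_def)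
    then show ?thesis
      using reflected_diff_all[OF flat0, of x East d] False c
      by (simp add: odd_arc_def corner_simps insert_commute)
  qed
qed

end

text \<open>A difference of distinct circles is not its own negative. So two arcs joining the same
  pair of circles lie in regions of the same colour, which the reflection shows without any
  geometry.\<close>

lemma flip_if_unique:
  assumes M: "flat M" and neq: "circ M p \<noteq> circ M q"
    and eq: "circ M p = circ M p' \<and> circ M q = circ M q' \<or> circ M p = circ M q' \<and> circ M q = circ M p'"
    and f: "reflected M p - reflected M q = flip_if r (frag_of (circ M p) - frag_of (circ M q))"
      "reflected M p' - reflected M q' = flip_if r' (frag_of (circ M p') - frag_of (circ M q'))"
  shows "r = r'"
proof -
  let ?v = "frag_of (circ M p) - frag_of (circ M q)"
  have nz: "?v \<noteq> - ?v"
  proof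
    assume "?v = - ?v"
    then have "Poly_Mapping.lookup ?v (circ M p) = Poly_Mapping.lookup (- ?v) (circ M p)" by simp
    then show False using neq by (simp add: lookup_minus lookup_frag_of)
  qed
  from eq have "flip_if r ?v = flip_if r' ?v"
  proof
    assume *: "circ M p = circ M p' \<and> circ M q = circ M q'"
    then have "reflected M p = reflected M p'" "reflected M q = reflected M q'"
      using reflected_circ[OF M] by blast+
    then show ?thesis using f * by simp
  next
    assume *: "circ M p = circ M q' \<and> circ M q = circ M p'"
    then have "reflected M p = reflected M q'" "reflected M q = reflected M p'"
      using reflected_circ[OF M] by blast+
    then have "flip_if r ?v = - (flip_if r' (- ?v))" using f * by (metis minus_diff_eq)
    then show ?thesis by (cases r') simp_all
  qed
  then show ?thesis using nz by (cases r; cases r') auto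
qed

lemma (in cube_square) odd_arc_parallel:
  assumes s: "\<not> splits D I x" "\<not> splits D I y" "splits D I\<^sub>0\<^sub>1 x" "splits D I\<^sub>1\<^sub>0 y"
  shows "odd_arc D x = odd_arc D y"
proof -
  obtain arr where arr: "arrow_choice D arr" using some_arrows by blast
  note e = edges[OF arr]
  note rx = cube_edge.reflected_after[OF e(4), unfolded I11] and ry = cube_edge.reflected_after[OF e(3)]
  show ?thesis
    using flip_if_unique[OF flat_resolution[OF D] cube_edge.split_neq[OF e(4) s(3), unfolded I11]
        parallel_circles[OF s] rx ry] by blast
qed

text \<open>In \<open>I\<^sub>1\<^sub>0\<close> the rotated arc at \<open>x\<close> and the
  unrotated arc at \<open>y\<close> join the same circles, so their regions have one colour;
  rotating the arc at \<open>y\<close> changes it.\<close>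

lemma (in cube_square) odd_arc_interleaved:
  assumes s: "splits D I x" "splits D I y" "\<not> splits D I\<^sub>0\<^sub>1 x" "\<not> splits D I\<^sub>1\<^sub>0 y"
  shows "odd_arc D x \<noteq> odd_arc D y"
proof -
  obtain arr where arr: "arrow_choice D arr" using some_arrows by blast
  note e = edges[OF arr]
  interpret t: two_arcs "resolution D I" "resolution D I\<^sub>1\<^sub>0" x y "tail (arr x)" "tail (arr y)"
    by (rule two_arcs_I[OF arr s])
  note rx = cube_edge.reflected_after[OF e(1)] and ry = cube_edge.reflected_before[OF e(3)]
  have "circ (resolution D I\<^sub>1\<^sub>0) (midpoint x (tail (arr x))) = circ (resolution D I\<^sub>1\<^sub>0) (midpoint y (tail (arr y))) \<and>
      circ (resolution D I\<^sub>1\<^sub>0) (midpoint x (opposite (tail (arr x)))) = circ (resolution D I\<^sub>1\<^sub>0) (midpoint y (opposite (tail (arr y)))) \<or>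
    circ (resolution D I\<^sub>1\<^sub>0) (midpoint x (tail (arr x))) = circ (resolution D I\<^sub>1\<^sub>0) (midpoint y (opposite (tail (arr y)))) \<and>
      circ (resolution D I\<^sub>1\<^sub>0) (midpoint x (opposite (tail (arr x)))) = circ (resolution D I\<^sub>1\<^sub>0) (midpoint y (tail (arr y)))"
    using t.y_circs by auto
  from flip_if_unique[OF flat_resolution[OF D] t.b_neq this rx ry] show ?thesis by blast
qed

lemma (in cube_square) sign_Y_eq: "sign_Y arr = sign_X arr * square_sign (colour_sign D) I x y"
proof (cases rule: split_cases)
  case same
  then show ?thesis unfolding sign_Y_def square_sign_def colour_sign_def by auto
next
  case parallel
  then show ?thesis
    using odd_arc_parallel[OF parallel] unfolding sign_Y_def square_sign_def colour_sign_def by auto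
next
  case interleaved
  then show ?thesis
    using odd_arc_interleaved[OF interleaved] unfolding sign_Y_def square_sign_def colour_sign_def by auto
qed

section \<open>Signs on the cube\<close>

text \<open>The vanishing of the first cohomology of a cube with signs as coefficients. Directions
  are treated one at a time.\<close>

lemma coboundary:
  fixes \<eta> :: "edge \<Rightarrow> int"
  assumes fin: "finite (crossings D)"
    and pm: "\<And>I x. (I, x) \<in> edges D \<Longrightarrow> \<eta> (I, x) \<in> {1, - 1}"
    and sq: "\<And>I x y. (I, x, y) \<in> squares D \<Longrightarrow> square_sign \<eta> I x y = 1"
  obtains \<tau> where "\<And>I. \<tau> I \<in> {1, - 1 :: int}" "\<And>I x. (I, x) \<in> edges D \<Longrightarrow> \<eta> (I, x) = \<tau> I * \<tau> (I(x := 1))"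
proof -
  have "\<exists>\<tau> :: (square \<Rightarrow> nat) \<Rightarrow> int. (\<forall>I. \<tau> I \<in> {1, - 1}) \<and>
      (\<forall>I x. (I, x) \<in> edges D \<longrightarrow> x \<in> Y \<longrightarrow> \<eta> (I, x) = \<tau> I * \<tau> (I(x := 1)))"
    if "Y \<subseteq> crossings D" for Y
    using finite_subset[OF that fin] that
  proof (induction Y rule: finite_induct)
    case empty
    then show ?case by (intro exI[of _ "\<lambda>_. 1"]) simp
  next
    case (insert z Y)
    then have "\<exists>\<tau> :: (square \<Rightarrow> nat) \<Rightarrow> int. (\<forall>I. \<tau> I \<in> {1, - 1}) \<and>
      (\<forall>I x. (I, x) \<in> edges D \<longrightarrow> x \<in> Y \<longrightarrow> \<eta> (I, x) = \<tau> I * \<tau> (I(x := 1)))" by blast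
    then obtain \<tau> :: "(square \<Rightarrow> nat) \<Rightarrow> int" where \<tau>: "\<And>I. \<tau> I \<in> {1, - 1}"
      "\<And>I x. (I, x) \<in> edges D \<Longrightarrow> x \<in> Y \<Longrightarrow> \<eta> (I, x) = \<tau> I * \<tau> (I(x := 1))" by blast
    have tt: "\<tau> I * \<tau> I = 1" for I using \<tau>(1)[of I] by auto
    have ee: "\<eta> (I, x) * \<eta> (I, x) = 1" if "(I, x) \<in> edges D" for I x using pm[OF that] by auto
    \<comment> \<open>The defect of \<open>\<tau>\<close> on the edges in the new direction
      \<open>z\<close>. Multiplying by it on the half with entry 1 at \<open>z\<close> repairs these
      edges.\<close>
    define \<zeta> where "\<zeta> = (\<lambda>I. if (I, z) \<in> edges D then \<eta> (I, z) * (\<tau> I * \<tau> (I(z := 1))) else 1)"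
    have \<zeta>: "\<zeta> I \<in> {1, - 1}" for I
      using pm[of I z] \<tau>(1)[of I] \<tau>(1)[of "I(z := 1)"] by (auto simp: \<zeta>_def)
    define \<tau>' where "\<tau>' = (\<lambda>I. if I z = 0 then \<tau> I else \<tau> I * \<zeta> (I(z := 0)))"
    have 1: "\<tau>' I \<in> {1, - 1}" for I
      using \<tau>(1)[of I] \<zeta>[of "I(z := 0)"] by (auto simp: \<tau>'_def)
    have 2: "\<eta> (I, x) = \<tau>' I * \<tau>' (I(x := 1))" if e: "(I, x) \<in> edges D" and x: "x \<in> insert z Y" for I x
    proof (cases "x = z")
      case True
      have I: "I z = 0" "I(z := 0) = I" using e True by (auto simp: edges_def)
      then have "\<tau>' I * \<tau>' (I(x := 1)) = \<tau> I * (\<tau> (I(z := 1)) * (\<eta> (I, z) * (\<tau> I * \<tau> (I(z := 1)))))"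
        using e True by (simp add: \<tau>'_def \<zeta>_def)
      also have "\<dots> = \<eta> (I, z) * (\<tau> I * \<tau> I) * (\<tau> (I(z := 1)) * \<tau> (I(z := 1)))"
        by (simp only: mult_ac)
      finally show ?thesis using True tt by simp
    next
      case False
      then have xY: "x \<in> Y" using x by simp
      note eq = \<tau>(2)[OF e xY]
      show ?thesis
      proof (cases "I z = 0")
        case True
        then show ?thesis using eq False by (simp add: \<tau>'_def)
      next
        case nz: False
        have I: "I \<in> vertices D" "x \<in> crossings D" "I x = 0" using e by (auto simp: edges_def)
        have zc: "z \<in> crossings D" using insert.prems by simp
        have "I z \<in> {0, 1}" using I(1) zc unfolding vertices_def by (auto simp: PiE_iff)
        then have Iz: "I z = 1" using nz by simp
        define I\<^sub>0 where "I\<^sub>0 = I(z := 0)"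
        have I0: "I\<^sub>0(z := 1) = I" "I\<^sub>0 z = 0" "I\<^sub>0 x = 0" using Iz I(3) False by (auto simp: I\<^sub>0_def)
        have I0v: "I\<^sub>0 \<in> vertices D"
          using I(1) zc unfolding vertices_def I\<^sub>0_def by (auto simp: PiE_iff extensional_def)
        have "I\<^sub>0(x := 1) \<in> vertices D"
          using I0v I(2) unfolding vertices_def by (auto simp: PiE_iff extensional_def)
        then have es: "(I\<^sub>0, z) \<in> edges D" "(I\<^sub>0(x := 1), z) \<in> edges D" "(I\<^sub>0, x) \<in> edges D"
          using I0v I(2) zc I0 False by (auto simp: edges_def)
        have sq1: "square_sign \<eta> I\<^sub>0 x z = 1"
          by (rule sq) (use I0v I(2) zc I0 False in \<open>auto simp: squares_def\<close>)
        have c: "I\<^sub>0(x := 1, z := 1) = I(x := 1)" using I0(1) False by (metis fun_upd_twist)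
        have c': "(I(x := 1))(z := 0) = I\<^sub>0(x := 1)" unfolding I\<^sub>0_def using False by (simp add: fun_upd_twist)
        \<comment> \<open>The defect is the same at both ends of an edge in an earlier direction, by
          the condition on the face. So the repair does not disturb that edge.\<close>
        have "\<zeta> I\<^sub>0 * \<zeta> (I\<^sub>0(x := 1)) =
            (\<eta> (I\<^sub>0, z) * (\<tau> I\<^sub>0 * \<tau> I)) * (\<eta> (I\<^sub>0(x := 1), z) * (\<tau> (I\<^sub>0(x := 1)) * \<tau> (I(x := 1))))"
          using es by (simp add: \<zeta>_def I0 c)
        also have "\<dots> = \<eta> (I\<^sub>0, z) * \<eta> (I\<^sub>0(x := 1), z) * (\<tau> I\<^sub>0 * \<tau> (I\<^sub>0(x := 1))) * (\<tau> I * \<tau> (I(x := 1)))"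
          by (simp only: mult_ac)
        also have "\<dots> = square_sign \<eta> I\<^sub>0 x z"
          using \<tau>(2)[OF es(3) xY] eq by (simp add: square_sign_def I0(1) mult_ac)
        finally have z1: "\<zeta> I\<^sub>0 * \<zeta> (I\<^sub>0(x := 1)) = 1" using sq1 by simp
        have "\<tau>' I * \<tau>' (I(x := 1)) = (\<tau> I * \<zeta> I\<^sub>0) * (\<tau> (I(x := 1)) * \<zeta> (I\<^sub>0(x := 1)))"
          using Iz False by (simp add: \<tau>'_def c' I\<^sub>0_def[symmetric])
        also have "\<dots> = \<tau> I * \<tau> (I(x := 1)) * (\<zeta> I\<^sub>0 * \<zeta> (I\<^sub>0(x := 1)))" by (simp only: mult_ac)
        finally show ?thesis using eq z1 by simp
      qed
    qed
    show ?case using 1 2 by blast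
  qed
  from this[of "crossings D"] obtain \<tau> :: "(square \<Rightarrow> nat) \<Rightarrow> int" where
    "\<forall>I. \<tau> I \<in> {1, - 1}" "\<forall>I x. (I, x) \<in> edges D \<longrightarrow> x \<in> crossings D \<longrightarrow> \<eta> (I, x) = \<tau> I * \<tau> (I(x := 1))"
    by blast
  then show ?thesis using that[of \<tau>] by (auto simp: edges_def)
qed


section \<open>Independence of the choices\<close>

lemma keys_level: "Poly_Mapping.keys (level M p) \<subseteq> circles M"
proof -
  have "Poly_Mapping.keys (circle_weight M r) \<subseteq> circles M" for r
    by (auto simp: circle_weight_def flip_if_def circles_eq split: if_splits)
  then show ?thesis
    unfolding level_def potential_def by (rule_tac order_trans[OF keys_sum]) blast
qed

lemma keys_reflection: "Poly_Mapping.keys (reflection M a) \<subseteq> circles M"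
proof -
  have "Poly_Mapping.keys (level M p + level M q) \<subseteq> circles M" for p q
    using keys_add[of "level M p" "level M q"] keys_level[of M p] keys_level[of M q] by blast
  then show ?thesis unfolding reflection_def reflected_def by simp
qed

abbreviation reflect :: "diagram \<Rightarrow> (square \<Rightarrow> nat) \<Rightarrow> circle exterior \<Rightarrow> circle exterior"
  where "reflect D I \<equiv> exterior_lin (reflection (resolution D I))"

lemma reflect_in: "v \<in> state_space D I \<Longrightarrow> reflect D I v \<in> state_space D I"
  unfolding state_space_def by (rule exterior_lin_in, assumption, rule keys_reflection)

lemma reflect_reflect:
  assumes "link_diagram D" "v \<in> state_space D I"
  shows "reflect D I (reflect D I v) = v"
  unfolding exterior_lin_comp
  by (rule exterior_lin_id[OF assms(2)[unfolded state_space_def]])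
    (auto simp: circles_eq intro: reflection_involution flat_resolution[OF assms(1)])

lemma reflect_natural:
  assumes D: "link_diagram D" and v: "v \<in> state_space D I"
    and m: "\<And>r. r \<in> points D \<Longrightarrow> m (circ (resolution D I) r) = circ (resolution D J) r"
  shows "exterior_map m (reflect D I v) = reflect D J (exterior_map m v)"
  unfolding exterior_map_eq_lin exterior_lin_comp
proof (rule exterior_lin_cong[OF v[unfolded state_space_def]])
  fix a assume "a \<in> circles (resolution D I)"
  then obtain r where r: "r \<in> points D" "a = circ (resolution D I) r" by (auto simp: circles_eq)
  have "frag_extend (\<lambda>a. frag_of (m a)) (reflected (resolution D I) r) = reflected (resolution D J) r"
    by (rule reflected_natural) (use m in auto)
  then show "frag_extend (\<lambda>a. frag_of (m a)) (reflection (resolution D I) a) =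
      frag_extend (reflection (resolution D J)) (frag_of (m a))"
    using r m by (simp add: reflection_circ[OF flat_resolution[OF D]])
qed

lemma vect_flip_if: "vect (flip_if b v) = (if b then - vect v else vect v)"
  by (simp add: flip_if_def)

text \<open>A merge is induced by the identity on points and commutes with the reflection. The
  factor of a split is a difference across the region of the rotated arc, which is fixed or negated
  according to its colour.\<close>

lemma (in cube_edge) edge_map_reflect:
  assumes v: "v \<in> state_space D I"
  shows "edge_map D arr (I, x) (reflect D I v) =
    of_int (colour_sign D (I, x)) * reflect D J (edge_map D arr (I, x) v)"
proof (cases "splits D I x")
  case True
  obtain w\<^sub>0 where w0: "w\<^sub>0 \<in> exterior_on (points D)" "v = quot D I w\<^sub>0"
    using v unfolding state_space_eq by blast
  define w where "w = quot D J w\<^sub>0"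
  let ?m = "transfer_circle (resolution D I)"
  let ?b = "circ (resolution D J) (midpoint x (opposite t))" and ?b' = "circ (resolution D J) (midpoint x t)"
  have w: "w \<in> state_space D J" unfolding w_def by (rule quot_state[OF w0(1)])
  have vw: "v = exterior_map ?m w"
    unfolding w0(2) w_def exterior_map_comp
    by (rule exterior_map_cong[OF w0(1)]) (simp add: split_map True)
  have "exterior_map ?m (reflect D J w) = reflect D I (exterior_map ?m w)"
    by (rule reflect_natural[OF D w]) (rule split_map[OF True])
  then have "edge_map D arr (I, x) (reflect D I v) = edge_map D arr (I, x) (exterior_map ?m (reflect D J w))"
    unfolding vw by (simp only:)
  also have "\<dots> = (gen ?b - gen ?b') * reflect D J w"
    by (rule edge_map_split[OF True reflect_in[OF w] split_map[OF True]])
  finally have 1: "edge_map D arr (I, x) (reflect D I v) = (gen ?b - gen ?b') * reflect D J w" .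
  have "reflect D J (edge_map D arr (I, x) v) = reflect D J ((gen ?b - gen ?b') * w)"
    unfolding vw using edge_map_split[OF True w split_map[OF True]] by simp
  also have "\<dots> = vect (reflection (resolution D J) ?b - reflection (resolution D J) ?b') * reflect D J w"
    by simp
  also have "reflection (resolution D J) ?b - reflection (resolution D J) ?b' =
      flip_if (odd_arc D x) (frag_of ?b - frag_of ?b')"
    using reflected_after[of "opposite t"] by (simp add: reflection_circ[OF flat1])
  finally have 2: "reflect D J (edge_map D arr (I, x) v) =
      (if odd_arc D x then - (gen ?b - gen ?b') else gen ?b - gen ?b') * reflect D J w"
    unfolding vect_flip_if vect_simps .
  show ?thesis unfolding 1 2
    by (cases "odd_arc D x") (simp_all add: colour_sign_def True left_diff_distrib)
next
  case False
  have "edge_map D arr (I, x) (reflect D I v) = exterior_map (transfer_circle (resolution D J)) (reflect D I v)"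
    by (rule edge_map_merge[OF False reflect_in[OF v] merge_map[OF False]])
  also have "\<dots> = reflect D J (exterior_map (transfer_circle (resolution D J)) v)"
    by (rule reflect_natural[OF D v merge_map[OF False]])
  also have "exterior_map (transfer_circle (resolution D J)) v = edge_map D arr (I, x) v"
    by (rule edge_map_merge[OF False v merge_map[OF False], symmetric])
  moreover have "colour_sign D (I, x) = 1" by (simp add: colour_sign_def False)
  ultimately show ?thesis by (simp only: of_int_1 mult_1_left)
qed

lemma (in cube_edge) edge_map_reversal:
  assumes arr': "arrow_choice D arr'" and v: "v \<in> state_space D I"
  shows "edge_map D arr' (I, x) v = of_int (reversal D arr arr' (I, x)) * edge_map D arr (I, x) v"
proof -
  interpret e': cube_edge D arr' I x by standard (use D arr' x Ix in auto)
  obtain w where w: "w \<in> exterior_on (points D)" "v = quot D I w"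
    using v unfolding state_space_eq by blast
  show ?thesis
    unfolding w(2) edge_map_quot[OF w(1)] e'.edge_map_quot[OF w(1)]
    using arrow_compl[OF arr arr' x]
    by (auto simp: \<theta>_def e'.\<theta>_def reversal_def algebra_simps)
qed

lemma (in cube_edge) edge_map_minus:
  assumes v: "v \<in> state_space D I"
  shows "edge_map D arr (I, x) (- v) = - edge_map D arr (I, x) v"
proof -
  have "0 \<in> state_space D I" "- v \<in> state_space D I" using v by (simp_all add: state_space_def)
  then have "edge_map D arr (I, x) (0 + 0) = edge_map D arr (I, x) 0 + edge_map D arr (I, x) 0"
    "edge_map D arr (I, x) (- v + v) = edge_map D arr (I, x) (- v) + edge_map D arr (I, x) v"
    using edge_map_add v by blast+
  then show ?thesis by (simp add: eq_neg_iff_add_eq_0)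
qed

lemma finite_crossings: "link_diagram D \<Longrightarrow> finite (crossings D)"
  unfolding link_diagram_def crossings_def by (rule finite_subset[of _ "{c. D c \<noteq> Blank}"]) auto

lemma edge_cube_edge:
  assumes "link_diagram D" "arrow_choice D arr" "(I, x) \<in> edges D"
  shows "cube_edge D arr I x"
  by standard (use assms in \<open>auto simp: edges_def\<close>)

lemma square_cube_square:
  assumes "link_diagram D" "(I, x, y) \<in> squares D"
  shows "cube_square D I x y"
  by standard (use assms in \<open>auto simp: squares_def\<close>)

lemma data_signs:
  assumes "odd_khovanov_data D arr \<epsilon>" "e \<in> edges D"
  shows "\<epsilon> e \<in> {1, - 1}"
  using assms unfolding odd_khovanov_data_def edge_assignment_X_def edge_assignment_Y_def by blast

text \<open>Afterwards an assignment enters the comparison only through its values being signs and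
  through its face signs.\<close>

lemma data_square_sign:
  assumes D: "link_diagram D" and data: "odd_khovanov_data D arr \<epsilon>"
  shows "(\<forall>(I, x, y) \<in> squares D. square_sign \<epsilon> I x y = cube_square.sign_X D I x y arr) \<or>
    (\<forall>(I, x, y) \<in> squares D. square_sign \<epsilon> I x y = cube_square.sign_Y D I x y arr)"
proof -
  have arr: "arrow_choice D arr" using data unfolding odd_khovanov_data_def by blast
  have v: "I \<in> vertices D" if "(I, x, y) \<in> squares D" for I x y using that by (auto simp: squares_def)
  from data have "edge_assignment_X D arr \<epsilon> \<or> edge_assignment_Y D arr \<epsilon>"
    unfolding odd_khovanov_data_def by blast
  then show ?thesis
    using cube_square.square_sign_X[OF square_cube_square[OF D] arr] v
      cube_square.square_sign_Y[OF square_cube_square[OF D] arr] by blast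
qed

text \<open>Two choices give isomorphic complexes, by a map that is the reflection of circles up to sign
  if the types of the assignments differ.\<close>

lemma compare_data:
  assumes D: "link_diagram D"
    and data: "odd_khovanov_data D arr \<epsilon>" and data': "odd_khovanov_data D arr' \<epsilon>'"
  obtains \<Phi> \<Psi> :: "(square \<Rightarrow> nat) \<Rightarrow> circle exterior \<Rightarrow> circle exterior" where
    "\<And>I u v. \<Phi> I (u + v) = \<Phi> I u + \<Phi> I v"
    "\<And>I v. v \<in> state_space D I \<Longrightarrow> \<Phi> I v \<in> state_space D I"
    "\<And>I v. v \<in> state_space D I \<Longrightarrow> \<Psi> I v \<in> state_space D I"
    "\<And>I v. v \<in> state_space D I \<Longrightarrow> \<Phi> I (\<Psi> I v) = v"
    "\<And>I v. v \<in> state_space D I \<Longrightarrow> \<Psi> I (\<Phi> I v) = v"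
    "\<And>I x v. (I, x) \<in> edges D \<Longrightarrow> v \<in> state_space D I \<Longrightarrow>
      of_int (\<epsilon>' (I, x)) * edge_map D arr' (I, x) (\<Phi> I v) =
      \<Phi> (I(x := 1)) (of_int (\<epsilon> (I, x)) * edge_map D arr (I, x) v)"
proof -
  have arr: "arrow_choice D arr" and arr': "arrow_choice D arr'"
    using data data' unfolding odd_khovanov_data_def by blast+
  note sq = square_cube_square[OF D]
  \<comment> \<open>\<open>T\<close> is the identity if the types agree and the reflection
    otherwise; \<open>\<kappa>\<close> holds the signs up to which it commutes with the edge
    maps.\<close>
  obtain T :: "(square \<Rightarrow> nat) \<Rightarrow> circle exterior \<Rightarrow> circle exterior" and \<kappa> where
    T: "\<And>I u v. T I (u + v) = T I u + T I v" "\<And>I v. T I (- v) = - T I v"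
      "\<And>I v. v \<in> state_space D I \<Longrightarrow> T I v \<in> state_space D I"
      "\<And>I v. v \<in> state_space D I \<Longrightarrow> T I (T I v) = v"
    and \<kappa>: "\<And>e. \<kappa> e \<in> {1, - 1 :: int}"
      "\<And>I x v. (I, x) \<in> edges D \<Longrightarrow> v \<in> state_space D I \<Longrightarrow>
        edge_map D arr (I, x) (T I v) = of_int (\<kappa> (I, x)) * T (I(x := 1)) (edge_map D arr (I, x) v)"
      "\<And>I x y. (I, x, y) \<in> squares D \<Longrightarrow>
        square_sign \<epsilon>' I x y = square_sign \<epsilon> I x y * square_sign (reversal D arr arr') I x y * square_sign \<kappa> I x y"
  proof -
    note goal = that
    have same: ?thesis
      if *: "\<And>I x y. (I, x, y) \<in> squares D \<Longrightarrow>
        square_sign \<epsilon>' I x y = square_sign \<epsilon> I x y * square_sign (reversal D arr arr') I x y"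
    proof (rule goal[of "\<lambda>I v. v" "\<lambda>_. 1"])
      have "square_sign (\<lambda>_. 1) I x y = 1" for I x y by (simp add: square_sign_def)
      then show "square_sign \<epsilon>' I x y = square_sign \<epsilon> I x y * square_sign (reversal D arr arr') I x y *
          square_sign (\<lambda>_. 1) I x y" if "(I, x, y) \<in> squares D" for I x y
        using *[OF that] by simp
    qed simp_all
    have different: ?thesis
      if *: "\<And>I x y. (I, x, y) \<in> squares D \<Longrightarrow> square_sign \<epsilon>' I x y =
        square_sign \<epsilon> I x y * square_sign (reversal D arr arr') I x y * square_sign (colour_sign D) I x y"
    proof (rule goal[of "reflect D" "colour_sign D"])
      show "colour_sign D e \<in> {1, - 1}" for e by (cases e) (simp add: colour_sign_def)
      show "edge_map D arr (I, x) (reflect D I v) =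
          of_int (colour_sign D (I, x)) * reflect D (I(x := 1)) (edge_map D arr (I, x) v)"
        if "(I, x) \<in> edges D" "v \<in> state_space D I" for I x v
        by (rule cube_edge.edge_map_reflect[OF edge_cube_edge[OF D arr that(1)] that(2)])
    qed (use * reflect_in reflect_reflect[OF D] in simp_all)
    note rX = cube_square.sign_X_reversal[OF sq arr arr'] and rY = cube_square.sign_Y_reversal[OF sq arr arr']
    note YX = cube_square.sign_Y_eq[OF sq]
    have cc: "square_sign (colour_sign D) I x y * square_sign (colour_sign D) I x y = 1" for I x y
      by (auto simp: square_sign_def colour_sign_def)
    from data_square_sign[OF D data] data_square_sign[OF D data'] show ?thesis
    proof (elim disjE)
      assume "\<forall>(I, x, y) \<in> squares D. square_sign \<epsilon> I x y = cube_square.sign_X D I x y arr"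
        "\<forall>(I, x, y) \<in> squares D. square_sign \<epsilon>' I x y = cube_square.sign_X D I x y arr'"
      then show ?thesis using rX by (intro same) fastforce
    next
      assume "\<forall>(I, x, y) \<in> squares D. square_sign \<epsilon> I x y = cube_square.sign_Y D I x y arr"
        "\<forall>(I, x, y) \<in> squares D. square_sign \<epsilon>' I x y = cube_square.sign_Y D I x y arr'"
      then show ?thesis using rY by (intro same) fastforce
    next
      assume *: "\<forall>(I, x, y) \<in> squares D. square_sign \<epsilon> I x y = cube_square.sign_X D I x y arr"
        "\<forall>(I, x, y) \<in> squares D. square_sign \<epsilon>' I x y = cube_square.sign_Y D I x y arr'"
      show ?thesis
      proof (rule different)
        fix I x y assume s: "(I, x, y) \<in> squares D"
        have "square_sign \<epsilon> I x y = cube_square.sign_X D I x y arr"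
          "square_sign \<epsilon>' I x y = cube_square.sign_Y D I x y arr'" using * s by auto
        then show "square_sign \<epsilon>' I x y =
          square_sign \<epsilon> I x y * square_sign (reversal D arr arr') I x y * square_sign (colour_sign D) I x y"
          using YX[OF s, of arr'] rX[OF s] by simp
      qed
    next
      assume *: "\<forall>(I, x, y) \<in> squares D. square_sign \<epsilon> I x y = cube_square.sign_Y D I x y arr"
        "\<forall>(I, x, y) \<in> squares D. square_sign \<epsilon>' I x y = cube_square.sign_X D I x y arr'"
      show ?thesis
      proof (rule different)
        fix I x y assume s: "(I, x, y) \<in> squares D"
        have "square_sign \<epsilon> I x y = cube_square.sign_Y D I x y arr"
          "square_sign \<epsilon>' I x y = cube_square.sign_X D I x y arr'" using * s by auto
        then show "square_sign \<epsilon>' I x y =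
          square_sign \<epsilon> I x y * square_sign (reversal D arr arr') I x y * square_sign (colour_sign D) I x y"
          using YX[OF s, of arr] rX[OF s] cc[of I x y] by (simp add: mult_ac)
      qed
    qed
  qed
  define \<rho> where "\<rho> = reversal D arr arr'"
  have \<rho>: "\<rho> e \<in> {1, - 1}" for e by (cases e) (simp add: \<rho>_def reversal_def)
  \<comment> \<open>The ratio of the two assignments, corrected by the reversed arrows and by
    \<open>T\<close>. The third property of \<open>\<kappa>\<close> makes it a cocycle.\<close>
  define \<eta> where "\<eta> = (\<lambda>e. (\<epsilon> e * \<epsilon>' e) * (\<rho> e * \<kappa> e))"
  have pm: "\<eta> e \<in> {1, - 1}" if "e \<in> edges D" for e
    using data_signs[OF data that] data_signs[OF data' that] \<rho>[of e] \<kappa>(1)[of e] by (auto simp: \<eta>_def)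
  have ss: "square_sign \<eta> I x y = 1" if s: "(I, x, y) \<in> squares D" for I x y
  proof -
    have e: "(I, x) \<in> edges D" "(I(x := 1), y) \<in> edges D" "(I, y) \<in> edges D" "(I(y := 1), x) \<in> edges D"
      using cube_square.square_edges[OF sq[OF s]] s by (auto simp: squares_def)
    have "square_sign \<epsilon>' I x y * square_sign \<epsilon>' I x y = 1"
      using e[THEN data_signs[OF data']] unfolding square_sign_def by auto
    moreover have "square_sign \<eta> I x y = square_sign \<epsilon>' I x y *
        (square_sign \<epsilon> I x y * square_sign \<rho> I x y * square_sign \<kappa> I x y)"
      unfolding \<eta>_def square_sign_mult by (simp only: mult_ac)
    ultimately show ?thesis using \<kappa>(3)[OF s] by (simp add: \<rho>_def)
  qed
  obtain \<tau> where \<tau>: "\<And>I. \<tau> I \<in> {1, - 1 :: int}" "\<And>I x. (I, x) \<in> edges D \<Longrightarrow> \<eta> (I, x) = \<tau> I * \<tau> (I(x := 1))"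
    using coboundary[OF finite_crossings[OF D] pm ss] by blast
  \<comment> \<open>Rescaling by \<open>\<tau>\<close> absorbs the remaining signs. \<open>T\<close>
    is an involution and commutes with signs, so \<open>\<Phi>\<close> is its own inverse.\<close>
  define \<Phi> where "\<Phi> = (\<lambda>I v. of_int (\<tau> I) * T I v)"
  have \<Phi>_cases: "(\<tau> I = 1 \<and> \<Phi> I = T I) \<or> (\<tau> I = - 1 \<and> \<Phi> I = (\<lambda>v. - T I v))" for I
    using \<tau>(1)[of I] by (auto simp: \<Phi>_def)
  have \<Phi>_state: "\<Phi> I v \<in> state_space D I" if "v \<in> state_space D I" for I v
    using \<Phi>_cases[of I] T(3)[OF that] by (auto simp: state_space_def)
  have \<Phi>_inv: "\<Phi> I (\<Phi> I v) = v" if "v \<in> state_space D I" for I v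
    using \<Phi>_cases[of I] T(4)[OF that] T(2) by auto
  show ?thesis
  proof (rule that[of \<Phi> \<Phi>])
    show "\<Phi> I (u + v) = \<Phi> I u + \<Phi> I v" for I u v
      by (simp add: \<Phi>_def T(1) distrib_left)
    fix I x v assume e: "(I, x) \<in> edges D" and v: "v \<in> state_space D I"
    interpret c: cube_edge D arr I x by (rule edge_cube_edge[OF D arr e])
    let ?z = "T (I(x := 1)) (edge_map D arr (I, x) v)"
    have "edge_map D arr' (I, x) (\<Phi> I v) = of_int (\<rho> (I, x)) * edge_map D arr (I, x) (\<Phi> I v)"
      unfolding \<rho>_def by (rule c.edge_map_reversal[OF arr' \<Phi>_state[OF v]])
    also have "edge_map D arr (I, x) (\<Phi> I v) = of_int (\<tau> I) * edge_map D arr (I, x) (T I v)"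
      using \<Phi>_cases[of I] c.edge_map_minus[OF T(3)[OF v]] by auto
    also have "edge_map D arr (I, x) (T I v) = of_int (\<kappa> (I, x)) * ?z" by (rule \<kappa>(2)[OF e v])
    finally have "of_int (\<epsilon>' (I, x)) * edge_map D arr' (I, x) (\<Phi> I v) =
        of_int (\<epsilon>' (I, x) * (\<rho> (I, x) * (\<tau> I * \<kappa> (I, x)))) * ?z"
      by (simp only: of_int_mult mult.assoc)
    also have "\<epsilon>' (I, x) * (\<rho> (I, x) * (\<tau> I * \<kappa> (I, x))) = \<tau> (I(x := 1)) * \<epsilon> (I, x)"
    proof -
      have "\<epsilon> (I, x) * \<epsilon>' (I, x) * (\<rho> (I, x) * \<kappa> (I, x)) = \<tau> I * \<tau> (I(x := 1))"
        using \<tau>(2)[OF e] by (simp add: \<eta>_def)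
      \<comment> \<open>The factor \<open>\<epsilon> (I, x) * \<tau> I\<close> solves for the wanted
        product, since squares of signs are 1.\<close>
      then have "(\<epsilon> (I, x) * \<tau> I) * (\<epsilon> (I, x) * \<epsilon>' (I, x) * (\<rho> (I, x) * \<kappa> (I, x))) =
          (\<epsilon> (I, x) * \<tau> I) * (\<tau> I * \<tau> (I(x := 1)))" by simp
      then have "(\<epsilon> (I, x) * \<epsilon> (I, x)) * (\<epsilon>' (I, x) * (\<rho> (I, x) * (\<tau> I * \<kappa> (I, x)))) =
          (\<tau> I * \<tau> I) * (\<tau> (I(x := 1)) * \<epsilon> (I, x))" by (simp only: mult_ac)
      moreover have "\<epsilon> (I, x) * \<epsilon> (I, x) = 1" using data_signs[OF data e] by auto
      moreover have "\<tau> I * \<tau> I = 1" using \<tau>(1)[of I] by auto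
      ultimately show ?thesis by simp
    qed
    also have "of_int (\<tau> (I(x := 1)) * \<epsilon> (I, x)) * ?z = of_int (\<tau> (I(x := 1))) * (of_int (\<epsilon> (I, x)) * ?z)"
      by (simp only: of_int_mult mult.assoc)
    also have "of_int (\<epsilon> (I, x)) * ?z = T (I(x := 1)) (of_int (\<epsilon> (I, x)) * edge_map D arr (I, x) v)"
      using data_signs[OF data e] T(2) by auto
    finally show "of_int (\<epsilon>' (I, x)) * edge_map D arr' (I, x) (\<Phi> I v) =
        \<Phi> (I(x := 1)) (of_int (\<epsilon> (I, x)) * edge_map D arr (I, x) v)"
      unfolding \<Phi>_def .
  qed (use \<Phi>_state \<Phi>_inv in auto)
qed

section \<open>The long exact sequence of a short exact sequence of complexes\<close>

definition additive_group :: "'a::ab_group_add set \<Rightarrow> 'a monoid"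
  where "additive_group S = \<lparr>carrier = S, monoid.mult = (+), one = 0\<rparr>"

lemma additive_group_simps [simp]:
  "carrier (additive_group S) = S" "monoid.mult (additive_group S) = (+)" "one (additive_group S) = 0"
  by (simp_all add: additive_group_def)

text \<open>Without gradings a complex is a group with one endomorphism of square zero. The laws are
  relative to \<open>S\<close>, because edge maps are additive on state spaces.\<close>

locale additive_complex =
  fixes S :: "'a::ab_group_add set" and d :: "'a \<Rightarrow> 'a"
  assumes zero: "0 \<in> S" and add: "\<And>x y. x \<in> S \<Longrightarrow> y \<in> S \<Longrightarrow> x + y \<in> S" and minus: "\<And>x. x \<in> S \<Longrightarrow> - x \<in> S"
    and d_in: "\<And>x. x \<in> S \<Longrightarrow> d x \<in> S" and d_add: "\<And>x y. x \<in> S \<Longrightarrow> y \<in> S \<Longrightarrow> d (x + y) = d x + d y"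
    and dd: "\<And>x. x \<in> S \<Longrightarrow> d (d x) = 0"
begin

abbreviation "G \<equiv> additive_group S"
abbreviation "Z \<equiv> {z \<in> S. d z = 0}"
abbreviation "B \<equiv> d ` S"
abbreviation "H \<equiv> homology_of G d"

definition cls :: "'a \<Rightarrow> 'a set"
  where "cls z = B #>\<^bsub>G\<^esub> z"

lemma diff: "x \<in> S \<Longrightarrow> y \<in> S \<Longrightarrow> x - y \<in> S"
  using add minus by (metis add_uminus_conv_diff)

lemma d_zero: "d 0 = 0"
  using d_add[OF zero zero] by simp

lemma d_minus: "x \<in> S \<Longrightarrow> d (- x) = - d x"
  using d_add[of x "- x"] minus d_zero by (simp add: eq_neg_iff_add_eq_0 add.commute)

lemma d_diff: "x \<in> S \<Longrightarrow> y \<in> S \<Longrightarrow> d (x - y) = d x - d y"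
  using d_add[of x "- y"] d_minus minus by simp

lemma group: "Group.group G"
  by (rule groupI) (auto simp: zero add minus add.assoc intro: exI[of _ "- _"] bexI[of _ "- _"])

lemma inv: "x \<in> S \<Longrightarrow> inv\<^bsub>G\<^esub> x = - x"
  by (rule group.inv_equality[OF group]) (simp_all add: minus)

lemma kernel_eq: "kernel G G d = Z"
  by (simp add: kernel_def)

lemma Z_subgroup: "subgroup Z G"
  by (rule group.subgroupI[OF group]) (use zero d_zero in \<open>auto simp: add minus inv d_add d_minus\<close>)

lemma carrier_cycles: "carrier (subgroup_generated G Z) = Z"
  by (rule subgroup.carrier_subgroup_generated_subgroup[OF Z_subgroup])

lemma cycles_group: "comm_group (subgroup_generated G Z)"
  by (rule group.abelian_subgroup_generated[OF group])
    (rule group.group_comm_groupI[OF group], simp add: add.commute)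

lemma B_subgroup: "subgroup B (subgroup_generated G Z)"
proof (rule group.subgroupI)
  show "Group.group (subgroup_generated G Z)" by (rule group.group_subgroup_generated[OF group])
  show "B \<subseteq> carrier (subgroup_generated G Z)" unfolding carrier_cycles using d_in dd by auto
  show "B \<noteq> {}" using zero by auto
  show "inv\<^bsub>subgroup_generated G Z\<^esub> b \<in> B" if b: "b \<in> B" for b
  proof -
    have "b \<in> Z" using b d_in dd by auto
    then have "inv\<^bsub>subgroup_generated G Z\<^esub> b = - b"
      using group.inv_subgroup_generated[OF group, of b Z] inv carrier_cycles by auto
    moreover obtain u where "u \<in> S" "b = d u" using b by blast
    then have "- b = d (- u)" "- u \<in> S" by (simp_all add: d_minus minus)
    ultimately show ?thesis by auto
  qed
  show "a \<otimes>\<^bsub>subgroup_generated G Z\<^esub> b \<in> B" if ab: "a \<in> B" "b \<in> B" for a b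
  proof -
    obtain x y where "x \<in> S" "y \<in> S" "a = d x" "b = d y" using ab by blast
    then have "a + b = d (x + y)" "x + y \<in> S" by (simp_all add: d_add add)
    then show ?thesis by simp
  qed
qed

lemma B_normal: "B \<lhd> subgroup_generated G Z"
  using comm_group.subgroup_imp_normal[OF cycles_group B_subgroup] .

lemma H_group: "Group.group H"
  unfolding homology_of_def kernel_eq additive_group_simps by (rule normal.factorgroup_is_group[OF B_normal])

lemma cls_eq_coset: "B #>\<^bsub>subgroup_generated G Z\<^esub> z = cls z"
  by (simp add: cls_def r_coset_def)

lemma H_carrier: "carrier H = cls ` Z"
  unfolding homology_of_def kernel_eq additive_group_simps FactGroup_def RCOSETS_def
  by (simp add: carrier_cycles cls_eq_coset) blast

lemma H_mult: "z \<in> Z \<Longrightarrow> w \<in> Z \<Longrightarrow> cls z \<otimes>\<^bsub>H\<^esub> cls w = cls (z + w)"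
  using normal.rcos_sum[OF B_normal, of z w]
  unfolding homology_of_def kernel_eq FactGroup_def carrier_cycles cls_eq_coset by simp

lemma cls_eq: "cls z = (\<lambda>b. b + z) ` B"
  by (auto simp: cls_def r_coset_def)

lemma cls_zero: "cls 0 = B"
  by (simp add: cls_eq)

lemma H_one: "\<one>\<^bsub>H\<^esub> = cls 0"
  by (simp add: homology_of_def FactGroup_def cls_zero)

lemma cls_iff:
  assumes "z \<in> S" "w \<in> S"
  shows "cls z = cls w \<longleftrightarrow> (\<exists>c \<in> S. z = w + d c)"
proof
  assume "cls z = cls w"
  moreover have "z \<in> cls z" unfolding cls_eq by (rule image_eqI[of _ _ 0]) (use zero d_zero in \<open>auto intro: image_eqI[of _ _ 0]\<close>)
  ultimately show "\<exists>c \<in> S. z = w + d c" unfolding cls_eq by (auto simp: add.commute)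
next
  assume "\<exists>c \<in> S. z = w + d c"
  then obtain c where c: "c \<in> S" "z = w + d c" by blast
  have "cls z \<subseteq> cls w"
  proof
    fix y assume "y \<in> cls z"
    then obtain e where "e \<in> S" "y = d e + z" unfolding cls_eq by blast
    then have "y = d (e + c) + w" "e + c \<in> S" using c by (simp_all add: d_add add algebra_simps)
    then show "y \<in> cls w" unfolding cls_eq by blast
  qed
  moreover have "cls w \<subseteq> cls z"
  proof
    fix y assume "y \<in> cls w"
    then obtain e where "e \<in> S" "y = d e + w" unfolding cls_eq by blast
    then have "y = d (e - c) + z" "e - c \<in> S" using c by (simp_all add: d_diff diff)
    then show "y \<in> cls z" unfolding cls_eq by blast
  qed
  ultimately show "cls z = cls w" by blast
qed

end

locale additive_chain_map = A: additive_complex S d + B: additive_complex T e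
  for S :: "'a::ab_group_add set" and d and T :: "'b::ab_group_add set" and e +
  fixes f :: "'a \<Rightarrow> 'b"
  assumes f_in: "\<And>x. x \<in> S \<Longrightarrow> f x \<in> T" and f_add: "\<And>x y. x \<in> S \<Longrightarrow> y \<in> S \<Longrightarrow> f (x + y) = f x + f y"
    and f_d: "\<And>x. x \<in> S \<Longrightarrow> f (d x) = e (f x)"
begin

lemma f_zero: "f 0 = 0"
  using f_add[OF A.zero A.zero] by simp

lemma f_minus: "x \<in> S \<Longrightarrow> f (- x) = - f x"
  using f_add[of x "- x"] A.minus f_zero by (simp add: eq_neg_iff_add_eq_0 add.commute)

lemma f_diff: "x \<in> S \<Longrightarrow> y \<in> S \<Longrightarrow> f (x - y) = f x - f y"
  using f_add[of x "- y"] f_minus A.minus by simp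

lemma chain_map: "chain_map A.G d B.G e f"
  unfolding chain_map_def hom_def using f_in f_add f_d by auto

lemma f_Z: "z \<in> A.Z \<Longrightarrow> f z \<in> B.Z"
  using f_in f_d f_zero by (metis (mono_tags, lifting) mem_Collect_eq)

text \<open>Members of a class differ by boundaries, which \<open>f\<close> takes to boundaries; so
  \<open>the_elem\<close> in \<open>induced_map\<close> meets a singleton.\<close>

lemma induced_cls:
  assumes "z \<in> S"
  shows "induced_map B.G e f (A.cls z) = B.cls (f z)"
proof -
  have c: "B.cls (f y) = B.cls (f z)" if "y \<in> A.cls z" for y
  proof -
    obtain c where c: "c \<in> S" "y = d c + z" using \<open>y \<in> A.cls z\<close> unfolding A.cls_eq by blast
    have "f y = f z + e (f c)" using c assms f_add f_d A.d_in by (simp add: add.commute)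
    then have e: "\<exists>t \<in> T. f y = f z + e t" using f_in[OF c(1)] by blast
    have "y \<in> S" unfolding c(2) by (rule A.add[OF A.d_in[OF c(1)] assms])
    then have "f y \<in> T" "f z \<in> T" using f_in assms by simp_all
    then show ?thesis using e B.cls_iff by simp
  qed
  have z: "z \<in> A.cls z"
    using A.zero A.d_zero unfolding A.cls_eq by (metis add_0 image_eqI)
  have "(\<lambda>y. B.cls (f y)) ` A.cls z = (\<lambda>_. B.cls (f z)) ` A.cls z"
    by (rule image_cong[OF refl c])
  then have "(\<lambda>y. B.cls (f y)) ` A.cls z = {B.cls (f z)}"
    using image_constant[OF z] by simp
  then show ?thesis unfolding induced_map_def by (simp add: B.cls_def)
qed

lemma induced_hom: "induced_map B.G e f \<in> hom A.H B.H"
proof (rule homI)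
  show "induced_map B.G e f x \<in> carrier B.H" if x: "x \<in> carrier A.H" for x
  proof -
    obtain z where z: "z \<in> A.Z" "x = A.cls z" using x unfolding A.H_carrier by blast
    then have "induced_map B.G e f x = B.cls (f z)" using induced_cls by simp
    then show ?thesis unfolding B.H_carrier using f_Z[OF z(1)] by blast
  qed
  show "induced_map B.G e f (x \<otimes>\<^bsub>A.H\<^esub> y) = induced_map B.G e f x \<otimes>\<^bsub>B.H\<^esub> induced_map B.G e f y"
    if xy: "x \<in> carrier A.H" "y \<in> carrier A.H" for x y
  proof -
    obtain z w where z: "z \<in> A.Z" "x = A.cls z" "w \<in> A.Z" "y = A.cls w"
      using xy unfolding A.H_carrier by blast
    then show ?thesis
      using A.H_mult[OF z(1,3)] B.H_mult[OF f_Z[OF z(1)] f_Z[OF z(3)]] induced_cls f_add A.add by simp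
  qed
qed

end

locale short_exact = i: additive_chain_map S\<^sub>1 d\<^sub>1 S d i + p: additive_chain_map S d S\<^sub>0 d\<^sub>0 p
  for S\<^sub>1 d\<^sub>1 S d i S\<^sub>0 d\<^sub>0 p +
  assumes i_inj: "inj_on i S\<^sub>1" and p_surj: "p ` S = S\<^sub>0"
    and exact: "\<And>c. c \<in> S \<Longrightarrow> p c = 0 \<longleftrightarrow> c \<in> i ` S\<^sub>1"
begin

text \<open>The zigzag as a relation that allows every lift \<open>c\<close> of every
  representative. On homology classes the set is a singleton by
  \<open>connecting_cls\<close>.\<close>

definition connecting :: "'c set \<Rightarrow> 'a set"
  where "connecting A = the_elem {i.A.cls w | w c. w \<in> S\<^sub>1 \<and> c \<in> S \<and> i w = d c \<and> p c \<in> A}"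

lemma i_eq_0: "w \<in> S\<^sub>1 \<Longrightarrow> i w = 0 \<Longrightarrow> w = 0"
  using i_inj i.f_zero i.A.zero by (metis inj_onD)

lemma p_i: "w \<in> S\<^sub>1 \<Longrightarrow> p (i w) = 0"
  using exact i.f_in by blast

lemma lift_cycle:
  assumes "z \<in> p.B.Z"
  obtains c w where "c \<in> S" "w \<in> S\<^sub>1" "p c = z" "i w = d c"
proof -
  obtain c where c: "c \<in> S" "p c = z" using assms p_surj by blast
  have "p (d c) = 0" using c assms p.f_d by simp
  then obtain w where "w \<in> S\<^sub>1" "d c = i w" using exact[of "d c"] c(1) i.B.d_in by blast
  then show ?thesis using that c by metis
qed

lemma lift_Z:
  assumes "w \<in> S\<^sub>1" "c \<in> S" "i w = d c"
  shows "w \<in> i.A.Z" "p c \<in> p.B.Z"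
proof -
  have "i (d\<^sub>1 w) = 0" using i.f_d assms i.B.dd by simp
  then show "w \<in> i.A.Z" using assms(1) i_eq_0 i.A.d_in by blast
  have "d\<^sub>0 (p c) = p (i w)" using p.f_d[OF assms(2)] assms(3) by simp
  then have "d\<^sub>0 (p c) = 0" using p_i[OF assms(1)] by simp
  then show "p c \<in> p.B.Z" using p.f_in assms(2) by blast
qed

lemma connecting_well_defined:
  assumes "w \<in> S\<^sub>1" "c \<in> S" "i w = d c" "w' \<in> S\<^sub>1" "c' \<in> S" "i w' = d c'"
    and "p.B.cls (p c) = p.B.cls (p c')"
  shows "i.A.cls w = i.A.cls w'"
proof -
  obtain b\<^sub>0 where b0: "b\<^sub>0 \<in> S\<^sub>0" "p c = p c' + d\<^sub>0 b\<^sub>0"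
    using p.B.cls_iff[of "p c" "p c'"] assms p.f_in by auto
  \<comment> \<open>The boundary between the two cycles is lifted along \<open>p\<close>; with this
    correction the difference of the lifts comes from \<open>S\<^sub>1\<close>.\<close>
  obtain b where b: "b \<in> S" "b\<^sub>0 = p b" using b0(1) p_surj by blast
  have "p (c - c' - d b) = 0"
    using b0(2) b assms p.f_diff p.f_d i.B.diff i.B.d_in by simp
  moreover have "c - c' - d b \<in> S"
    by (intro i.B.diff i.B.d_in assms b)
  ultimately obtain a where a: "a \<in> S\<^sub>1" "c - c' - d b = i a"
    using exact by blast
  have "d (i a) = d c - d c'"
    unfolding a(2)[symmetric] using assms b i.B.d_diff i.B.diff i.B.d_in i.B.dd by simp
  then have "i (d\<^sub>1 a) = i (w - w')" using i.f_d[OF a(1)] assms i.f_diff by simp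
  then have "d\<^sub>1 a = w - w'"
    using i_inj i.A.d_in[OF a(1)] i.A.diff[OF assms(1,4)] by (metis inj_onD)
  then have "w = w' + d\<^sub>1 a" by simp
  then show ?thesis using i.A.cls_iff assms a(1) by blast
qed

lemma connecting_cls:
  assumes "w \<in> S\<^sub>1" "c \<in> S" "i w = d c"
  shows "connecting (p.B.cls (p c)) = i.A.cls w"
proof -
  have "i.A.cls w' = i.A.cls w"
    if w': "w' \<in> S\<^sub>1" "c' \<in> S" "i w' = d c'" "p c' \<in> p.B.cls (p c)" for w' c'
  proof -
    obtain e where "e \<in> S\<^sub>0" "p c' = d\<^sub>0 e + p c" using w'(4) unfolding p.B.cls_eq by blast
    then have "p.B.cls (p c') = p.B.cls (p c)"
      using p.B.cls_iff[OF p.f_in[OF w'(2)] p.f_in[OF assms(2)]] by (metis add.commute)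
    then show ?thesis using connecting_well_defined w'(1-3) assms by blast
  qed
  moreover have "p c \<in> p.B.cls (p c)"
    using p.B.zero p.B.d_zero unfolding p.B.cls_eq by (metis add_0 image_eqI)
  ultimately have "{i.A.cls w' | w' c'. w' \<in> S\<^sub>1 \<and> c' \<in> S \<and> i w' = d c' \<and> p c' \<in> p.B.cls (p c)} = {i.A.cls w}"
    using assms by blast
  then show ?thesis by (simp add: connecting_def)
qed

lemma connecting_hom: "connecting \<in> hom p.B.H i.A.H"
proof (rule homI)
  show "connecting x \<in> carrier i.A.H" if x: "x \<in> carrier p.B.H" for x
  proof -
    obtain z where z: "z \<in> p.B.Z" "x = p.B.cls z" using x unfolding p.B.H_carrier by blast
    obtain c w where c: "c \<in> S" "w \<in> S\<^sub>1" "p c = z" "i w = d c" using lift_cycle[OF z(1)] .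
    show ?thesis
      unfolding z(2) c(3)[symmetric] connecting_cls[OF c(2,1,4)] i.A.H_carrier using lift_Z[OF c(2,1,4)] by blast
  qed
  show "connecting (x \<otimes>\<^bsub>p.B.H\<^esub> y) = connecting x \<otimes>\<^bsub>i.A.H\<^esub> connecting y"
    if xy: "x \<in> carrier p.B.H" "y \<in> carrier p.B.H" for x y
  proof -
    obtain z z' where z: "z \<in> p.B.Z" "x = p.B.cls z" "z' \<in> p.B.Z" "y = p.B.cls z'"
      using xy unfolding p.B.H_carrier by blast
    obtain c w where c: "c \<in> S" "w \<in> S\<^sub>1" "p c = z" "i w = d c" using lift_cycle[OF z(1)] .
    obtain c' w' where c': "c' \<in> S" "w' \<in> S\<^sub>1" "p c' = z'" "i w' = d c'" using lift_cycle[OF z(3)] .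
    have s: "w + w' \<in> S\<^sub>1" "c + c' \<in> S" "i (w + w') = d (c + c')"
      using c c' i.A.add i.B.add i.f_add i.B.d_add by simp_all
    have "x \<otimes>\<^bsub>p.B.H\<^esub> y = p.B.cls (p (c + c'))"
      using p.B.H_mult[OF z(1,3)] z c c' p.f_add by simp
    then have "connecting (x \<otimes>\<^bsub>p.B.H\<^esub> y) = i.A.cls (w + w')" using connecting_cls[OF s] by simp
    also have "\<dots> = connecting x \<otimes>\<^bsub>i.A.H\<^esub> connecting y"
      unfolding z(2,4) c(3)[symmetric] c'(3)[symmetric] connecting_cls[OF c(2,1,4)] connecting_cls[OF c'(2,1,4)]
      using i.A.H_mult lift_Z(1)[OF c(2,1,4)] lift_Z(1)[OF c'(2,1,4)] by simp
    finally show ?thesis .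
  qed
qed

abbreviation "i_star \<equiv> induced_map i.B.G d i"
abbreviation "p_star \<equiv> induced_map p.B.G d\<^sub>0 p"

lemma exact_middle: "kernel i.B.H p.B.H p_star = i_star ` carrier i.A.H"
proof
  show "i_star ` carrier i.A.H \<subseteq> kernel i.B.H p.B.H p_star"
  proof
    fix x assume "x \<in> i_star ` carrier i.A.H"
    then obtain w where w: "w \<in> i.A.Z" "x = i_star (i.A.cls w)" unfolding i.A.H_carrier by blast
    then have x: "x = i.B.cls (i w)" using i.induced_cls by simp
    then have "p_star x = p.B.cls 0" using p.induced_cls i.f_in w p_i by simp
    then show "x \<in> kernel i.B.H p.B.H p_star"
      unfolding kernel_def p.B.H_one i.B.H_carrier x using i.f_Z[OF w(1)] by blast
  qed
  show "kernel i.B.H p.B.H p_star \<subseteq> i_star ` carrier i.A.H"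
  proof
    fix x assume "x \<in> kernel i.B.H p.B.H p_star"
    then obtain z where z: "z \<in> i.B.Z" "x = i.B.cls z" and "p_star x = p.B.cls 0"
      unfolding kernel_def p.B.H_one i.B.H_carrier by blast
    then have "p.B.cls (p z) = p.B.cls 0" using p.induced_cls by simp
    then obtain b\<^sub>0 where b0: "b\<^sub>0 \<in> S\<^sub>0" "p z = d\<^sub>0 b\<^sub>0"
      using p.B.cls_iff[of "p z" 0] p.f_in z p.B.zero by auto
    obtain b where b: "b \<in> S" "b\<^sub>0 = p b" using b0(1) p_surj by blast
    have "p (z - d b) = 0" using b0(2) b z p.f_diff p.f_d i.B.d_in by simp
    moreover have "z - d b \<in> S" using z(1) b(1) i.B.diff i.B.d_in by simp
    ultimately obtain w where w: "w \<in> S\<^sub>1" "z - d b = i w" using exact by blast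
    have "i (d\<^sub>1 w) = 0"
      using i.f_d[OF w(1)] w(2)[symmetric] z b i.B.d_diff i.B.d_in i.B.dd by simp
    then have wZ: "w \<in> i.A.Z" using i_eq_0 w(1) i.A.d_in by blast
    have "z = i w + d b" using w(2) by (metis diff_add_cancel)
    then have "x = i.B.cls (i w)" unfolding z(2) using i.B.cls_iff z(1) i.f_in w(1) b(1) by blast
    then have "x = i_star (i.A.cls w)" using i.induced_cls w(1) by simp
    then show "x \<in> i_star ` carrier i.A.H" unfolding i.A.H_carrier using wZ by blast
  qed
qed

lemma exact_right: "kernel p.B.H i.A.H connecting = p_star ` carrier i.B.H"
proof
  show "p_star ` carrier i.B.H \<subseteq> kernel p.B.H i.A.H connecting"
  proof
    fix x assume "x \<in> p_star ` carrier i.B.H"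
    then obtain z where z: "z \<in> i.B.Z" "x = p_star (i.B.cls z)" unfolding i.B.H_carrier by blast
    then have x: "x = p.B.cls (p z)" using p.induced_cls by simp
    have "connecting x = i.A.cls 0"
      unfolding x by (rule connecting_cls) (use z i.A.zero i.f_zero in auto)
    then show "x \<in> kernel p.B.H i.A.H connecting"
      unfolding kernel_def i.A.H_one p.B.H_carrier x using p.f_Z[OF z(1)] by blast
  qed
  show "kernel p.B.H i.A.H connecting \<subseteq> p_star ` carrier i.B.H"
  proof
    fix x assume "x \<in> kernel p.B.H i.A.H connecting"
    then obtain z where z: "z \<in> p.B.Z" "x = p.B.cls z" and k: "connecting x = i.A.cls 0"
      unfolding kernel_def i.A.H_one p.B.H_carrier by blast
    obtain c w where c: "c \<in> S" "w \<in> S\<^sub>1" "p c = z" "i w = d c" using lift_cycle[OF z(1)] .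
    have "i.A.cls w = i.A.cls 0" using k connecting_cls[OF c(2,1,4)] z(2) c(3) by simp
    then obtain a where a: "a \<in> S\<^sub>1" "w = d\<^sub>1 a" using i.A.cls_iff[of w 0] c i.A.zero by auto
    have "d (c - i a) = 0" using i.B.d_diff c a i.f_in i.f_d by simp
    then have cZ: "c - i a \<in> i.B.Z" using c a i.f_in i.B.diff by simp
    have "p (c - i a) = z" using p.f_diff c a i.f_in p_i by simp
    then have "x = p_star (i.B.cls (c - i a))" using p.induced_cls cZ z(2) by simp
    then show "x \<in> p_star ` carrier i.B.H" unfolding i.B.H_carrier using cZ by blast
  qed
qed

lemma exact_left: "kernel i.A.H i.B.H i_star = connecting ` carrier p.B.H"
proof
  show "connecting ` carrier p.B.H \<subseteq> kernel i.A.H i.B.H i_star"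
  proof
    fix x assume "x \<in> connecting ` carrier p.B.H"
    then obtain z where z: "z \<in> p.B.Z" "x = connecting (p.B.cls z)" unfolding p.B.H_carrier by blast
    obtain c w where c: "c \<in> S" "w \<in> S\<^sub>1" "p c = z" "i w = d c" using lift_cycle[OF z(1)] .
    have x: "x = i.A.cls w" using z(2) connecting_cls[OF c(2,1,4)] c(3) by simp
    have "i.B.cls (d c) = i.B.cls 0" using i.B.cls_iff[of "d c" 0] c(1) i.B.d_in i.B.zero by auto
    then have "i_star x = i.B.cls 0" unfolding x using i.induced_cls c by simp
    then show "x \<in> kernel i.A.H i.B.H i_star"
      unfolding kernel_def i.B.H_one i.A.H_carrier x using lift_Z(1)[OF c(2,1,4)] by blast
  qed
  show "kernel i.A.H i.B.H i_star \<subseteq> connecting ` carrier p.B.H"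
  proof
    fix x assume "x \<in> kernel i.A.H i.B.H i_star"
    then obtain w where w: "w \<in> i.A.Z" "x = i.A.cls w" and "i_star x = i.B.cls 0"
      unfolding kernel_def i.B.H_one i.A.H_carrier by blast
    then have "i.B.cls (i w) = i.B.cls 0" using i.induced_cls by simp
    then obtain c where c: "c \<in> S" "i w = d c" using i.B.cls_iff[of "i w" 0] w i.f_in i.B.zero by auto
    have "x = connecting (p.B.cls (p c))" using connecting_cls[of w c] w c by simp
    then show "x \<in> connecting ` carrier p.B.H"
      unfolding p.B.H_carrier using lift_Z(2)[of w c] w c by blast
  qed
qed

end

text \<open>Without gradings this is an exact triangle. \<open>exact_seq\<close> lists groups and
  maps from the last to the first, and five groups unroll the triangle far enough for exactness at
  each of its three vertices.\<close>

theorem long_exact_sequence: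
  assumes "short_exact S\<^sub>1 d\<^sub>1 S d i S\<^sub>0 d\<^sub>0 p"
  shows "\<exists>\<delta>. exact_seq ([homology_of (additive_group S) d, homology_of (additive_group S\<^sub>1) d\<^sub>1,
      homology_of (additive_group S\<^sub>0) d\<^sub>0, homology_of (additive_group S) d, homology_of (additive_group S\<^sub>1) d\<^sub>1],
    [induced_map (additive_group S) d i, \<delta>, induced_map (additive_group S\<^sub>0) d\<^sub>0 p, induced_map (additive_group S) d i])"
proof -
  interpret short_exact S\<^sub>1 d\<^sub>1 S d i S\<^sub>0 d\<^sub>0 p by (rule assms)
  have "group_hom i.A.H i.B.H i_star"
    unfolding group_hom_def group_hom_axioms_def using i.A.H_group i.B.H_group i.induced_hom by blast
  then show ?thesis
    using i.A.H_group i.B.H_group p.B.H_group i.induced_hom p.induced_hom connecting_hom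
      exact_middle exact_right exact_left
    by (intro exI[of _ connecting]) simp
qed

section \<open>The odd Khovanov complex\<close>

definition chains :: "diagram \<Rightarrow> chain set"
  where "chains D = {c. (\<forall>I \<in> vertices D. c I \<in> state_space D I) \<and> (\<forall>I. I \<notin> vertices D \<longrightarrow> c I = 0)}"

lemma chain_group_eq: "chain_group D = additive_group (chains D)"
  unfolding chain_group_def additive_group_def chains_def by (simp add: fun_eq_iff zero_fun_def)

lemma state_space_closed [simp]:
  "0 \<in> state_space D I"
  "u \<in> state_space D I \<Longrightarrow> v \<in> state_space D I \<Longrightarrow> u + v \<in> state_space D I"
  "u \<in> state_space D I \<Longrightarrow> - u \<in> state_space D I"
  by (simp_all add: state_space_def)

lemma state_space_sign: "s \<in> {1, - 1 :: int} \<Longrightarrow> u \<in> state_space D I \<Longrightarrow> of_int s * u \<in> state_space D I"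
  by auto

lemma vertices_upd:
  assumes "I \<in> vertices D" "x \<in> crossings D" "n \<in> {0, 1}"
  shows "I(x := n) \<in> vertices D"
  using assms unfolding vertices_def by (auto simp: PiE_iff extensional_def)

lemma vertices_values: "I \<in> vertices D \<Longrightarrow> x \<in> crossings D \<Longrightarrow> I x = 0 \<or> I x = 1"
  unfolding vertices_def by (auto simp: PiE_iff)

text \<open>An edge ending at \<open>J\<close> is determined by its direction, a crossing where
  \<open>J\<close> is 1.\<close>

lemma differential_eq:
  assumes "J \<in> vertices D"
  shows "differential D arr \<epsilon> c J =
    (\<Sum>x | x \<in> crossings D \<and> J x = 1. of_int (\<epsilon> (J(x := 0), x)) * edge_map D arr (J(x := 0), x) (c (J(x := 0))))"
proof -
  have eq: "{(I, x) \<in> edges D. I(x := 1) = J} = (\<lambda>x. (J(x := 0), x)) ` {x. x \<in> crossings D \<and> J x = 1}"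
  proof
    show "{(I, x) \<in> edges D. I(x := 1) = J} \<subseteq> (\<lambda>x. (J(x := 0), x)) ` {x. x \<in> crossings D \<and> J x = 1}"
    proof
      fix e assume "e \<in> {(I, x) \<in> edges D. I(x := 1) = J}"
      then obtain I x where e: "e = (I, x)" "x \<in> crossings D" "I x = 0" "I(x := 1) = J"
        by (auto simp: edges_def)
      then have "J(x := 0) = I" "J x = 1" by auto
      then show "e \<in> (\<lambda>x. (J(x := 0), x)) ` {x. x \<in> crossings D \<and> J x = 1}" using e by blast
    qed
    show "(\<lambda>x. (J(x := 0), x)) ` {x. x \<in> crossings D \<and> J x = 1} \<subseteq> {(I, x) \<in> edges D. I(x := 1) = J}"
      using vertices_upd[OF assms] by (auto simp: edges_def fun_upd_idem)
  qed
  have inj: "inj_on (\<lambda>x. (J(x := 0), x)) {x. x \<in> crossings D \<and> J x = 1}"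
    by (rule inj_onI) simp
  show ?thesis unfolding differential_def eq sum.reindex[OF inj] by (simp add: o_def)
qed

lemma differential_outside:
  assumes "J \<notin> vertices D"
  shows "differential D arr \<epsilon> c J = 0"
proof -
  have "{(I, x) \<in> edges D. I(x := 1) = J} = {}"
    using assms vertices_upd by (auto simp: edges_def)
  then show ?thesis unfolding differential_def by (simp only: sum.empty)
qed

text \<open>Exchanging the summation indices would only show that twice the sum is 0. The induction
  pairs the terms of each new element directly.\<close>

lemma sum_antisymmetric:
  fixes g :: "'a \<Rightarrow> 'a \<Rightarrow> 'b::ab_group_add"
  assumes "finite A" "\<And>x y. x \<in> A \<Longrightarrow> y \<in> A \<Longrightarrow> x \<noteq> y \<Longrightarrow> g x y = - g y x"
  shows "(\<Sum>y\<in>A. \<Sum>x\<in>A - {y}. g y x) = 0"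
  using assms
proof (induction A rule: finite_induct)
  case (insert z A)
  have "(\<Sum>y\<in>A. \<Sum>x\<in>insert z A - {y}. g y x) = (\<Sum>y\<in>A. g y z + (\<Sum>x\<in>A - {y}. g y x))"
  proof (rule sum.cong[OF refl])
    fix y assume "y \<in> A"
    then have "insert z A - {y} = insert z (A - {y})" using insert.hyps by auto
    then show "(\<Sum>x\<in>insert z A - {y}. g y x) = g y z + (\<Sum>x\<in>A - {y}. g y x)" using insert.hyps by simp
  qed
  also have "\<dots> = (\<Sum>y\<in>A. g y z) + (\<Sum>y\<in>A. \<Sum>x\<in>A - {y}. g y x)" by (rule sum.distrib)
  also have "(\<Sum>y\<in>A. \<Sum>x\<in>A - {y}. g y x) = 0"
    by (rule insert.IH) (rule insert.prems; simp)
  also have "(\<Sum>y\<in>A. g y z) = (\<Sum>y\<in>A. - g z y)"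
  proof (rule sum.cong[OF refl])
    fix y assume "y \<in> A"
    then show "g y z = - g z y" by (intro insert.prems) (use insert.hyps in auto)
  qed
  finally have "(\<Sum>y\<in>A. \<Sum>x\<in>insert z A - {y}. g y x) = - (\<Sum>y\<in>A. g z y)" by (simp add: sum_negf)
  moreover have "(\<Sum>x\<in>insert z A - {z}. g z x) = (\<Sum>x\<in>A. g z x)" using insert.hyps by simp
  ultimately show ?case using insert.hyps by simp
qed simp

text \<open>On interleaved faces both composites vanish. On all others \<open>sign_X\<close> and
  \<open>sign_Y\<close> coincide, so one argument covers both types of assignments.\<close>

lemma square_anticommute:
  assumes D: "link_diagram D" and data: "odd_khovanov_data D arr \<epsilon>"
    and s: "(I, x, y) \<in> squares D" and v: "v \<in> state_space D I"
  shows "of_int (\<epsilon> (I(x := 1), y) * \<epsilon> (I, x)) * composite D arr I x y v =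
    - (of_int (\<epsilon> (I(y := 1), x) * \<epsilon> (I, y)) * composite D arr I y x v)"
proof -
  have arr: "arrow_choice D arr" using data unfolding odd_khovanov_data_def by blast
  interpret cube_square D I x y by (rule square_cube_square[OF D s])
  have I: "I \<in> vertices D" using s by (auto simp: squares_def)
  note e = square_edges[OF I]
  let ?p = "\<epsilon> (I(x := 1), y) * \<epsilon> (I, x)" and ?q = "\<epsilon> (I(y := 1), x) * \<epsilon> (I, y)"
  have pq: "square_sign \<epsilon> I x y = ?p * ?q" by (simp add: square_sign_def mult_ac)
  have pm: "?p = 1 \<or> ?p = - 1" "?q = 1 \<or> ?q = - 1"
    using data_signs[OF data e(1)] data_signs[OF data e(2)] data_signs[OF data e(3)] data_signs[OF data e(4)] by auto
  have "square_sign \<epsilon> I x y = sign_X arr \<or> square_sign \<epsilon> I x y = sign_Y arr"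
    using data_square_sign[OF D data] s by auto
  then have sgn: "square_sign \<epsilon> I x y = sign_X arr"
    if "\<not> (splits D I x \<and> splits D I y \<and> \<not> splits D I\<^sub>1\<^sub>0 y)"
    using that unfolding sign_Y_def by auto
  show ?thesis
  proof (cases rule: split_cases)
    case same
    show ?thesis
    proof (cases "splits D I x \<and> splits D I y")
      case True
      then have "type_A D arr I x y" using type_A_I[OF arr] same by blast
      then have "composite D arr I x y v = - composite D arr I y x v" using v unfolding type_A_def by blast
      moreover have "?p * ?q = 1" using sgn same True pq unfolding sign_X_def by auto
      ultimately show ?thesis using pm by (auto simp del: of_int_mult)
    next
      case False
      then have "type_C D arr I x y" using type_C_I[OF arr] same by blast
      then have "composite D arr I x y v = composite D arr I y x v" using v unfolding type_C_def by blast
      moreover have "?p * ?q = - 1" using sgn same False pq unfolding sign_X_def by auto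
      ultimately show ?thesis using pm by (auto simp del: of_int_mult)
    qed
  next
    case parallel
    note t = parallel_type[OF arr parallel]
    show ?thesis
    proof (cases "circ (resolution D I\<^sub>1\<^sub>1) (midpoint x (tail (arr x))) = circ (resolution D I\<^sub>1\<^sub>1) (midpoint y (tail (arr y)))")
      case True
      then have "type_C D arr I x y" using t by simp
      then have "composite D arr I x y v = composite D arr I y x v" using v unfolding type_C_def by blast
      moreover have "?p * ?q = - 1" using sgn parallel True pq unfolding sign_X_def by auto
      ultimately show ?thesis using pm by (auto simp del: of_int_mult)
    next
      case False
      then have "type_A D arr I x y" using t by simp
      then have "composite D arr I x y v = - composite D arr I y x v" using v unfolding type_A_def by blast
      moreover have "?p * ?q = 1" using sgn parallel False pq unfolding sign_X_def by auto
      ultimately show ?thesis using pm by (auto simp del: of_int_mult)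
    qed
  next
    case interleaved
    then show ?thesis using interleaved_zero[OF arr v interleaved] by simp
  qed
qed

locale khovanov_data =
  fixes D :: diagram and arr :: arrows and \<epsilon> :: "edge \<Rightarrow> int"
  assumes D: "link_diagram D" and data: "odd_khovanov_data D arr \<epsilon>"
begin

lemma arr: "arrow_choice D arr"
  using data unfolding odd_khovanov_data_def by blast

abbreviation "dif \<equiv> differential D arr \<epsilon>"

definition signed_map :: "edge \<Rightarrow> circle exterior \<Rightarrow> circle exterior"
  where "signed_map e v = of_int (\<epsilon> e) * edge_map D arr e v"

lemma down_edge:
  assumes "J \<in> vertices D" "x \<in> crossings D" "J x = 1"
  shows "(J(x := 0), x) \<in> edges D" "J(x := 0) \<in> vertices D" "(J(x := 0))(x := 1) = J"
  using assms vertices_upd[OF assms(1,2)] by (auto simp: edges_def fun_upd_idem)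

lemma signed_map_in:
  assumes "(I, x) \<in> edges D" "v \<in> state_space D I"
  shows "signed_map (I, x) v \<in> state_space D (I(x := 1))"
  unfolding signed_map_def
  by (rule state_space_sign[OF data_signs[OF data assms(1)] cube_edge.edge_map_in[OF edge_cube_edge[OF D arr assms(1)] assms(2)]])

lemma signed_map_add:
  assumes "(I, x) \<in> edges D" "u \<in> state_space D I" "v \<in> state_space D I"
  shows "signed_map (I, x) (u + v) = signed_map (I, x) u + signed_map (I, x) v"
  unfolding signed_map_def
  using cube_edge.edge_map_add[OF edge_cube_edge[OF D arr assms(1)] assms(2,3)] by (simp add: distrib_left)

lemma signed_map_zero:
  assumes "(I, x) \<in> edges D"
  shows "signed_map (I, x) 0 = 0"
  using signed_map_add[OF assms, of 0 0] by simp

lemma signed_map_sum: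
  assumes "(I, x) \<in> edges D" "finite A" "\<And>a. a \<in> A \<Longrightarrow> v a \<in> state_space D I"
  shows "signed_map (I, x) (\<Sum>a\<in>A. v a) = (\<Sum>a\<in>A. signed_map (I, x) (v a)) \<and> (\<Sum>a\<in>A. v a) \<in> state_space D I"
  using assms(2,3)
  by (induction A rule: finite_induct) (simp_all add: signed_map_zero[OF assms(1)] signed_map_add[OF assms(1)])

lemma differential_signed:
  "J \<in> vertices D \<Longrightarrow> dif c J = (\<Sum>x | x \<in> crossings D \<and> J x = 1. signed_map (J(x := 0), x) (c (J(x := 0))))"
  unfolding signed_map_def by (rule differential_eq)

lemma finite_ones: "finite {x. x \<in> crossings D \<and> J x = 1}"
  using finite_crossings[OF D] by simp

lemma chains_state: "c \<in> chains D \<Longrightarrow> I \<in> vertices D \<Longrightarrow> c I \<in> state_space D I"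
  by (simp add: chains_def)

lemma term_in:
  assumes "c \<in> chains D" "J \<in> vertices D" "x \<in> crossings D" "J x = 1"
  shows "signed_map (J(x := 0), x) (c (J(x := 0))) \<in> state_space D J"
  using signed_map_in[OF down_edge(1)[OF assms(2-4)] chains_state[OF assms(1) down_edge(2)[OF assms(2-4)]]]
    down_edge(3)[OF assms(2-4)] by simp

lemma state_space_sum:
  assumes "finite A" "\<And>a. a \<in> A \<Longrightarrow> v a \<in> state_space D I"
  shows "(\<Sum>a\<in>A. v a) \<in> state_space D I"
  using assms by (induction A rule: finite_induct) simp_all

lemma differential_in: "c \<in> chains D \<Longrightarrow> dif c \<in> chains D"
  unfolding chains_def[of D] mem_Collect_eq
proof (intro conjI ballI allI impI)
  fix J assume c: "(\<forall>I\<in>vertices D. c I \<in> state_space D I) \<and> (\<forall>I. I \<notin> vertices D \<longrightarrow> c I = 0)"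
    and J: "J \<in> vertices D"
  have "c \<in> chains D" using c by (simp add: chains_def)
  then show "dif c J \<in> state_space D J"
    unfolding differential_signed[OF J] by (intro state_space_sum[OF finite_ones] term_in) (use J in auto)
qed (simp add: differential_outside)

lemma differential_add:
  assumes "c \<in> chains D" "c' \<in> chains D"
  shows "dif (c + c') = dif c + dif c'"
proof
  fix J
  show "dif (c + c') J = (dif c + dif c') J"
  proof (cases "J \<in> vertices D")
    case True
    have "signed_map (J(x := 0), x) ((c + c') (J(x := 0))) =
        signed_map (J(x := 0), x) (c (J(x := 0))) + signed_map (J(x := 0), x) (c' (J(x := 0)))"
      if "x \<in> {x. x \<in> crossings D \<and> J x = 1}" for x
      using signed_map_add[OF down_edge(1)[OF True]] chains_state[OF assms(1) down_edge(2)[OF True]]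
        chains_state[OF assms(2) down_edge(2)[OF True]] that by simp
    then show ?thesis by (simp add: differential_signed[OF True] sum.distrib)
  qed (simp add: differential_outside)
qed

lemma differential_differential:
  assumes c: "c \<in> chains D"
  shows "dif (dif c) = 0"
proof
  fix K
  show "dif (dif c) K = (0 :: chain) K"
  proof (cases "K \<in> vertices D")
    case True
    note K = this
    define A where "A = {x. x \<in> crossings D \<and> K x = 1}"
    \<comment> \<open>\<open>g y x\<close> is the contribution of the path into \<open>K\<close>
      that ends with the edge at \<open>y\<close>, preceded by the edge at \<open>x\<close>.\<close>
    define g where "g = (\<lambda>y x. signed_map (K(y := 0), y) (signed_map (K(y := 0, x := 0), x) (c (K(y := 0, x := 0)))))"
    have "dif (dif c) K = (\<Sum>y\<in>A. signed_map (K(y := 0), y) (dif c (K(y := 0))))"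
      unfolding differential_signed[OF K] A_def ..
    also have "\<dots> = (\<Sum>y\<in>A. \<Sum>x\<in>A - {y}. g y x)"
    proof (rule sum.cong[OF refl])
      fix y assume "y \<in> A"
      then have y: "y \<in> crossings D" "K y = 1" by (auto simp: A_def)
      note e = down_edge[OF K y]
      have A: "{x. x \<in> crossings D \<and> (K(y := 0)) x = 1} = A - {y}" by (auto simp: A_def)
      have "signed_map (K(y := 0), y) (dif c (K(y := 0))) =
          (\<Sum>x\<in>A - {y}. signed_map (K(y := 0), y) (signed_map ((K(y := 0))(x := 0), x) (c ((K(y := 0))(x := 0)))))"
        unfolding differential_signed[OF e(2)] A
      proof (rule conjunct1[OF signed_map_sum[OF e(1)]])
        show "finite (A - {y})" using finite_ones[of K] by (simp add: A_def)
        show "signed_map ((K(y := 0))(x := 0), x) (c ((K(y := 0))(x := 0))) \<in> state_space D (K(y := 0))"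
          if "x \<in> A - {y}" for x
          by (rule term_in[OF c e(2)]) (use that A_def in auto)
      qed
      then show "signed_map (K(y := 0), y) (dif c (K(y := 0))) = (\<Sum>x\<in>A - {y}. g y x)"
        by (simp add: g_def)
    qed
    also have "\<dots> = 0"
    proof (rule sum_antisymmetric)
      show "finite A" using finite_ones[of K] by (simp add: A_def)
      fix x y assume xy: "x \<in> A" "y \<in> A" "x \<noteq> y"
      \<comment> \<open>The bottom vertex of the face with top vertex \<open>K\<close> in the
        directions \<open>x\<close> and \<open>y\<close>.\<close>
      define I where "I = K(x := 0, y := 0)"
      have I': "K(y := 0, x := 0) = I" unfolding I_def using xy(3) by (simp add: fun_upd_twist)
      have Ix: "K(y := 0) = I(x := 1)" "K(x := 0) = I(y := 1)"
        using xy by (auto simp: I_def A_def fun_eq_iff)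
      have "I \<in> vertices D"
        unfolding I_def using K xy by (intro vertices_upd) (auto simp: A_def)
      then have s: "(I, x, y) \<in> squares D"
        using xy unfolding squares_def A_def I_def by auto
      have v: "c I \<in> state_space D I" using chains_state[OF c \<open>I \<in> vertices D\<close>] .
      interpret sq: cube_square D I x y by (rule square_cube_square[OF D s])
      note e = sq.square_edges[OF \<open>I \<in> vertices D\<close>]
      have comp: "signed_map (I(x := 1), y) (signed_map (I, x) (c I)) =
          of_int (\<epsilon> (I(x := 1), y) * \<epsilon> (I, x)) * composite D arr I x y (c I)"
        if e: "(I, x) \<in> edges D" "(I(x := 1), y) \<in> edges D" for x y
        using cube_edge.edge_map_minus[OF edge_cube_edge[OF D arr e(2)]
            cube_edge.edge_map_in[OF edge_cube_edge[OF D arr e(1)] v]] data_signs[OF data e(1)]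
        unfolding signed_map_def composite_def by auto
      have KI: "K(x := 0, y := 0) = I" by (simp add: I_def)
      have "g y x = signed_map (I(x := 1), y) (signed_map (I, x) (c I))"
        "g x y = signed_map (I(y := 1), x) (signed_map (I, y) (c I))"
        unfolding g_def unfolding I' KI unfolding Ix by (rule refl)+
      then show "g x y = - g y x"
        unfolding comp[OF e(1,2)] comp[OF e(3,4)] using square_anticommute[OF D data s v] by simp
    qed
    finally show ?thesis by simp
  qed (simp add: differential_outside)
qed

lemma chains_complex: "additive_complex (chains D) dif"
proof
  show "(0 :: chain) \<in> chains D" by (simp add: chains_def)
  show "c + c' \<in> chains D" if "c \<in> chains D" "c' \<in> chains D" for c c' using that by (simp add: chains_def)
  show "- c \<in> chains D" if "c \<in> chains D" for c using that by (simp add: chains_def)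
qed (use differential_in differential_add differential_differential in auto)

end

section \<open>Resolving one crossing\<close>

text \<open>The cube of \<open>D\<^sub>n\<close> is the facet of the cube of \<open>D\<close> on
  which the entry at \<open>x\<close> is \<open>n\<close>.\<close>

locale resolved =
  fixes D :: diagram and x :: square and n :: nat
  assumes D: "link_diagram D" and x: "x \<in> crossings D" and n: "n \<in> {0, 1}"
begin

abbreviation "D\<^sub>n \<equiv> replace_crossing D x n"

lemma crossings_Dn: "crossings D\<^sub>n = crossings D - {x}"
  using x by (auto simp: crossings_def replace_crossing_def split: if_splits)

lemma link_diagram_Dn: "link_diagram D\<^sub>n"
proof -
  have s: "\<Union> (strands (D\<^sub>n c)) = \<Union> (strands (D c))" for c
    by (simp add: replace_crossing_def sides_smoothing del: Union_iff)
  have "{c. D\<^sub>n c \<noteq> Blank} \<subseteq> insert x {c. D c \<noteq> Blank}"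
    by (auto simp: replace_crossing_def)
  then have "finite {c. D\<^sub>n c \<noteq> Blank}"
    using D finite_subset unfolding link_diagram_def by blast
  then show ?thesis using D unfolding link_diagram_def s by blast
qed

lemma vertices_ext: "I \<in> vertices D\<^sub>n \<Longrightarrow> I(x := n) \<in> vertices D"
  using n x unfolding vertices_def crossings_Dn by (auto simp: PiE_iff extensional_def)

text \<open>Vertices are extensional functions, so leaving out the crossing \<open>x\<close> means
  resetting its entry to \<open>undefined\<close>.\<close>

lemma vertices_res: "J \<in> vertices D \<Longrightarrow> J(x := undefined) \<in> vertices D\<^sub>n"
  unfolding vertices_def crossings_Dn by (auto simp: PiE_iff extensional_def)

lemma ext_res: "J x = n \<Longrightarrow> (J(x := undefined))(x := n) = J"
  by auto

lemma res_ext: "I \<in> vertices D\<^sub>n \<Longrightarrow> (I(x := n))(x := undefined) = I"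
  unfolding vertices_def crossings_Dn by (auto simp: PiE_iff extensional_def fun_eq_iff)

text \<open>Since the resolutions are literally equal, so are circles, state spaces and edge maps,
  and nothing has to be transported.\<close>

lemma resolution_ext: "resolution D (I(x := n)) = resolution D\<^sub>n I"
proof
  fix c
  have "c \<noteq> x \<Longrightarrow> D\<^sub>n c = D c" "D\<^sub>n x = smoothing n (D x)"
    by (simp_all add: replace_crossing_def)
  then show "resolution D (I(x := n)) c = resolution D\<^sub>n I c"
    unfolding resolution_def crossings_Dn using x by (cases "c = x") simp_all
qed

lemma upd_ext: "y \<noteq> x \<Longrightarrow> (I(x := n))(y := 1) = (I(y := 1))(x := n)"
  by (simp add: fun_upd_twist)

lemma state_space_ext: "state_space D (I(x := n)) = state_space D\<^sub>n I"
  by (simp add: state_space_def resolution_ext)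

lemma edge_map_ext:
  assumes "y \<noteq> x"
  shows "edge_map D arr (I(x := n), y) v = edge_map D\<^sub>n arr (I, y) v"
  unfolding edge_map_def fst_conv snd_conv Let_def upd_ext[OF assms] resolution_ext state_space_ext ..

lemma composite_ext:
  assumes "y \<noteq> x" "z \<noteq> x"
  shows "composite D arr (I(x := n)) y z v = composite D\<^sub>n arr I y z v"
  unfolding composite_def upd_ext[OF assms(1)] edge_map_ext[OF assms(1)] edge_map_ext[OF assms(2)] ..

lemma types_ext:
  assumes "y \<noteq> x" "z \<noteq> x"
  shows "type_A D arr (I(x := n)) y z = type_A D\<^sub>n arr I y z"
    "type_C D arr (I(x := n)) y z = type_C D\<^sub>n arr I y z"
    "type_X D arr (I(x := n)) y z = type_X D\<^sub>n arr I y z"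
    "type_Y D arr (I(x := n)) y z = type_Y D\<^sub>n arr I y z"
  using assms
  by (simp_all add: type_A_def type_C_def composites_nonzero_def composite_ext state_space_ext
      type_X_def type_Y_def interleaved_via_def resolution_ext)

lemma edges_ext: "(I, y) \<in> edges D\<^sub>n \<Longrightarrow> (I(x := n), y) \<in> edges D \<and> y \<noteq> x"
  using vertices_ext unfolding edges_def crossings_Dn by auto

lemma squares_ext: "(I, y, z) \<in> squares D\<^sub>n \<Longrightarrow> (I(x := n), y, z) \<in> squares D \<and> y \<noteq> x \<and> z \<noteq> x"
  using vertices_ext unfolding squares_def crossings_Dn by auto

definition restricted :: "(edge \<Rightarrow> int) \<Rightarrow> edge \<Rightarrow> int"
  where "restricted \<epsilon> = (\<lambda>(I, y). \<epsilon> (I(x := n), y))"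

lemma square_sign_ext:
  "y \<noteq> x \<Longrightarrow> z \<noteq> x \<Longrightarrow> square_sign (restricted \<epsilon>) I y z = square_sign \<epsilon> (I(x := n)) y z"
  unfolding square_sign_def restricted_def by (simp add: upd_ext)

lemma restricted_signs:
  assumes "\<And>e. e \<in> edges D \<Longrightarrow> \<epsilon> e \<in> {1, - 1}" "e \<in> edges D\<^sub>n"
  shows "restricted \<epsilon> e \<in> {1, - 1}"
proof -
  obtain I y where "e = (I, y)" by (metis surj_pair)
  then show ?thesis using assms edges_ext[of I y] by (simp add: restricted_def)
qed

text \<open>The two cardinalities count edges of different cubes; the products of signs, in
  contrast, agree factor by factor.\<close>

lemma even_square_ext:
  assumes pm: "\<And>e. e \<in> edges D \<Longrightarrow> \<epsilon> e \<in> {1, - 1}" and s: "(I, y, z) \<in> squares D\<^sub>n"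
  shows "even_square (restricted \<epsilon>) I y z = even_square \<epsilon> (I(x := n)) y z"
proof -
  note s' = squares_ext[OF s]
  have i: "I \<in> vertices D\<^sub>n" "I(x := n) \<in> vertices D"
    using s s' by (auto simp: squares_def)
  interpret a: cube_square D\<^sub>n I y z by (rule square_cube_square[OF link_diagram_Dn s])
  interpret b: cube_square D "I(x := n)" y z by (rule square_cube_square[OF D]) (use s' in blast)
  have "even_square (restricted \<epsilon>) I y z \<longleftrightarrow> square_sign (restricted \<epsilon>) I y z = 1"
    by (rule even_square_iff) (use a.xy a.Ix a.Iy a.square_edges[OF i(1)] restricted_signs[OF pm] in auto)
  moreover have "even_square \<epsilon> (I(x := n)) y z \<longleftrightarrow> square_sign \<epsilon> (I(x := n)) y z = 1"
    by (rule even_square_iff) (use b.xy b.Ix b.Iy b.square_edges[OF i(2)] pm in auto)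
  ultimately show ?thesis using square_sign_ext s' by simp
qed

text \<open>The type of a face is determined by resolutions and arrows at its two crossings, so an
  assignment of type X or Y restricts to one of the same type.\<close>

lemma restricted_data:
  assumes "odd_khovanov_data D arr \<epsilon>"
  shows "odd_khovanov_data D\<^sub>n arr (restricted \<epsilon>)"
proof -
  note pm = data_signs[OF assms]
  have sq: "(I(x := n), y, z) \<in> squares D"
    "type_A D\<^sub>n arr I y z = type_A D arr (I(x := n)) y z" "type_C D\<^sub>n arr I y z = type_C D arr (I(x := n)) y z"
    "type_X D\<^sub>n arr I y z = type_X D arr (I(x := n)) y z" "type_Y D\<^sub>n arr I y z = type_Y D arr (I(x := n)) y z"
    "even_square (restricted \<epsilon>) I y z = even_square \<epsilon> (I(x := n)) y z"
    if "(I, y, z) \<in> squares D\<^sub>n" for I y z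
    using squares_ext[OF that] types_ext even_square_ext[OF pm that] by simp_all
  have "arrow_choice D\<^sub>n arr"
    using assms unfolding odd_khovanov_data_def arrow_choice_def crossings_Dn
    by (auto simp: replace_crossing_def)
  moreover have "edge_assignment_X D\<^sub>n arr (restricted \<epsilon>)" if X: "edge_assignment_X D arr \<epsilon>"
    unfolding edge_assignment_X_def
  proof (intro conjI ballI, goal_cases)
    case (2 q)
    obtain I y z where "q = (I, y, z)" by (metis surj_pair)
    then show ?case using X sq[of I y z] 2 unfolding edge_assignment_X_def by fastforce
  qed (rule restricted_signs[OF pm])
  moreover have "edge_assignment_Y D\<^sub>n arr (restricted \<epsilon>)" if Y: "edge_assignment_Y D arr \<epsilon>"
    unfolding edge_assignment_Y_def
  proof (intro conjI ballI, goal_cases)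
    case (2 q)
    obtain I y z where "q = (I, y, z)" by (metis surj_pair)
    then show ?case using Y sq[of I y z] 2 unfolding edge_assignment_Y_def by fastforce
  qed (rule restricted_signs[OF pm])
  ultimately show ?thesis using assms unfolding odd_khovanov_data_def by blast
qed

lemma signed_map_ext:
  assumes "khovanov_data D arr \<epsilon>" "y \<noteq> x"
  shows "khovanov_data.signed_map D\<^sub>n arr (restricted \<epsilon>) (I, y) v =
    khovanov_data.signed_map D arr \<epsilon> (I(x := n), y) v"
proof -
  interpret a: khovanov_data D arr \<epsilon> by (rule assms(1))
  interpret b: khovanov_data D\<^sub>n arr "restricted \<epsilon>"
    by standard (rule link_diagram_Dn, rule restricted_data[OF a.data])
  show ?thesis
    unfolding a.signed_map_def b.signed_map_def by (simp add: restricted_def edge_map_ext[OF assms(2)])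
qed

end


section \<open>The short exact sequence of a crossing\<close>

lemma additive_sum:
  fixes f :: "'a::ab_group_add \<Rightarrow> 'b::ab_group_add"
  assumes "\<And>u v. f (u + v) = f u + f v"
  shows "f (\<Sum>a\<in>A. g a) = (\<Sum>a\<in>A. f (g a))"
proof -
  have "f 0 = 0" using assms[of 0 0] by simp
  then show ?thesis
    by (induction A rule: infinite_finite_induct) (simp_all add: assms)
qed

theorem proposition1p5:
  fixes D D\<^sub>0 D\<^sub>1 :: diagram and x :: square
    and arr arr\<^sub>0 arr\<^sub>1 :: arrows and \<epsilon> \<epsilon>\<^sub>0 \<epsilon>\<^sub>1 :: "edge \<Rightarrow> int"
  assumes "link_diagram D" and "x \<in> crossings D"
    and "D\<^sub>0 = replace_crossing D x 0" and "D\<^sub>1 = replace_crossing D x 1"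
    and "odd_khovanov_data D arr \<epsilon>"
    and "odd_khovanov_data D\<^sub>0 arr\<^sub>0 \<epsilon>\<^sub>0"
    and "odd_khovanov_data D\<^sub>1 arr\<^sub>1 \<epsilon>\<^sub>1"
  shows "\<exists>i \<pi> \<delta>.
    chain_map (chain_group D\<^sub>1) (differential D\<^sub>1 arr\<^sub>1 \<epsilon>\<^sub>1)
              (chain_group D) (differential D arr \<epsilon>) i \<and>
    chain_map (chain_group D) (differential D arr \<epsilon>)
              (chain_group D\<^sub>0) (differential D\<^sub>0 arr\<^sub>0 \<epsilon>\<^sub>0) \<pi> \<and>
    (let Kh = odd_khovanov D arr \<epsilon>;
         Kh\<^sub>0 = odd_khovanov D\<^sub>0 arr\<^sub>0 \<epsilon>\<^sub>0;
         Kh\<^sub>1 = odd_khovanov D\<^sub>1 arr\<^sub>1 \<epsilon>\<^sub>1;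
         i_star = induced_map (chain_group D) (differential D arr \<epsilon>) i;
         \<pi>_star = induced_map (chain_group D\<^sub>0) (differential D\<^sub>0 arr\<^sub>0 \<epsilon>\<^sub>0) \<pi>
     in exact_seq ([Kh, Kh\<^sub>1, Kh\<^sub>0, Kh, Kh\<^sub>1], [i_star, \<delta>, \<pi>_star, i_star]))"
proof -
  interpret R\<^sub>0: resolved D x 0 by standard (use assms in auto)
  interpret R\<^sub>1: resolved D x 1 by standard (use assms in auto)
  interpret K: khovanov_data D arr \<epsilon> by standard (use assms in auto)
  interpret K\<^sub>0: khovanov_data D\<^sub>0 arr\<^sub>0 \<epsilon>\<^sub>0 by standard (use assms R\<^sub>0.link_diagram_Dn in auto)
  interpret K\<^sub>1: khovanov_data D\<^sub>1 arr\<^sub>1 \<epsilon>\<^sub>1 by standard (use assms R\<^sub>1.link_diagram_Dn in auto)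
  \<comment> \<open>The restricted data give the complexes that actually occur in the complex of
    \<open>D\<close>, as quotient and as subcomplex.\<close>
  interpret L\<^sub>0: khovanov_data D\<^sub>0 arr "R\<^sub>0.restricted \<epsilon>"
    by standard (use assms R\<^sub>0.link_diagram_Dn R\<^sub>0.restricted_data in auto)
  interpret L\<^sub>1: khovanov_data D\<^sub>1 arr "R\<^sub>1.restricted \<epsilon>"
    by standard (use assms R\<^sub>1.link_diagram_Dn R\<^sub>1.restricted_data in auto)
  note D0 = assms(3)[symmetric] and D1 = assms(4)[symmetric]
  note vert0 = R\<^sub>0.vertices_ext[unfolded D0] R\<^sub>0.vertices_res[unfolded D0]
  note vert1 = R\<^sub>1.vertices_ext[unfolded D1] R\<^sub>1.vertices_res[unfolded D1]
  note cr0 = R\<^sub>0.crossings_Dn[unfolded D0] and cr1 = R\<^sub>1.crossings_Dn[unfolded D1]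
  note st0 = R\<^sub>0.state_space_ext[unfolded D0] and st1 = R\<^sub>1.state_space_ext[unfolded D1]
  note sg0 = R\<^sub>0.signed_map_ext[OF K.khovanov_data_axioms, unfolded D0]
  note sg1 = R\<^sub>1.signed_map_ext[OF K.khovanov_data_axioms, unfolded D1]
  note re0 = R\<^sub>0.res_ext[unfolded D0] and re1 = R\<^sub>1.res_ext[unfolded D1]
  \<comment> \<open>\<open>\<Phi>\<^sub>1\<close> leads from the given data of
    \<open>D\<^sub>1\<close> to the restricted ones, because \<open>i\<close> maps into the complex
    of \<open>D\<close>. \<open>\<Phi>\<^sub>0\<close> leads from restricted to given data, because
    \<open>p\<close> maps out of it.\<close>
  obtain \<Phi>\<^sub>1 \<Psi>\<^sub>1 where \<Phi>1: "\<And>I u v. \<Phi>\<^sub>1 I (u + v) = \<Phi>\<^sub>1 I u + \<Phi>\<^sub>1 I v"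
      "\<And>I v. v \<in> state_space D\<^sub>1 I \<Longrightarrow> \<Phi>\<^sub>1 I v \<in> state_space D\<^sub>1 I"
      "\<And>I v. v \<in> state_space D\<^sub>1 I \<Longrightarrow> \<Psi>\<^sub>1 I v \<in> state_space D\<^sub>1 I"
      "\<And>I v. v \<in> state_space D\<^sub>1 I \<Longrightarrow> \<Phi>\<^sub>1 I (\<Psi>\<^sub>1 I v) = v"
      "\<And>I v. v \<in> state_space D\<^sub>1 I \<Longrightarrow> \<Psi>\<^sub>1 I (\<Phi>\<^sub>1 I v) = v"
    and \<Phi>1s: "\<And>I y v. (I, y) \<in> edges D\<^sub>1 \<Longrightarrow> v \<in> state_space D\<^sub>1 I \<Longrightarrow>
      L\<^sub>1.signed_map (I, y) (\<Phi>\<^sub>1 I v) = \<Phi>\<^sub>1 (I(y := 1)) (K\<^sub>1.signed_map (I, y) v)"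
    unfolding L\<^sub>1.signed_map_def K\<^sub>1.signed_map_def
    by (fact compare_data[OF K\<^sub>1.D K\<^sub>1.data L\<^sub>1.data])
  obtain \<Phi>\<^sub>0 \<Psi>\<^sub>0 where \<Phi>0: "\<And>I u v. \<Phi>\<^sub>0 I (u + v) = \<Phi>\<^sub>0 I u + \<Phi>\<^sub>0 I v"
      "\<And>I v. v \<in> state_space D\<^sub>0 I \<Longrightarrow> \<Phi>\<^sub>0 I v \<in> state_space D\<^sub>0 I"
      "\<And>I v. v \<in> state_space D\<^sub>0 I \<Longrightarrow> \<Psi>\<^sub>0 I v \<in> state_space D\<^sub>0 I"
      "\<And>I v. v \<in> state_space D\<^sub>0 I \<Longrightarrow> \<Phi>\<^sub>0 I (\<Psi>\<^sub>0 I v) = v"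
      "\<And>I v. v \<in> state_space D\<^sub>0 I \<Longrightarrow> \<Psi>\<^sub>0 I (\<Phi>\<^sub>0 I v) = v"
    and \<Phi>0s: "\<And>I y v. (I, y) \<in> edges D\<^sub>0 \<Longrightarrow> v \<in> state_space D\<^sub>0 I \<Longrightarrow>
      K\<^sub>0.signed_map (I, y) (\<Phi>\<^sub>0 I v) = \<Phi>\<^sub>0 (I(y := 1)) (L\<^sub>0.signed_map (I, y) v)"
    unfolding L\<^sub>0.signed_map_def K\<^sub>0.signed_map_def
    by (fact compare_data[OF K\<^sub>0.D L\<^sub>0.data K\<^sub>0.data])
  have z1: "\<Phi>\<^sub>1 I 0 = 0" and z0: "\<Phi>\<^sub>0 I 0 = 0" for I
    using \<Phi>1(1)[of I 0 0] \<Phi>0(1)[of I 0 0] by simp_all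
  \<comment> \<open>Up to the isomorphisms, \<open>i\<close> is extension by zero from the facet
    with entry 1 at \<open>x\<close>, and \<open>p\<close> is restriction to the facet with entry
    0.\<close>
  define i where "i = (\<lambda>c J. if J \<in> vertices D \<and> J x = 1
    then \<Phi>\<^sub>1 (J(x := undefined)) (c (J(x := undefined))) else (0 :: circle exterior))"
  define p where "p = (\<lambda>c I. if I \<in> vertices D\<^sub>0 then \<Phi>\<^sub>0 I (c (I(x := 0))) else (0 :: circle exterior))"
  have i_ext: "i c (I(x := 1)) = \<Phi>\<^sub>1 I (c I)" if "I \<in> vertices D\<^sub>1" for c I
    using vert1(1)[OF that] re1[OF that] by (simp add: i_def)
  have split: "(\<exists>I \<in> vertices D\<^sub>1. J = I(x := 1)) \<or> J x = 0" if "J \<in> vertices D" for J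
    using vertices_values[OF that assms(2)] vert1(2)[OF that] R\<^sub>1.ext_res[of J] by metis
  have i_zero: "i c J = 0" if "J x = 0" for c J using that by (simp add: i_def)
  have i_in: "i c \<in> chains D" if c: "c \<in> chains D\<^sub>1" for c
    unfolding chains_def
  proof (intro CollectI conjI ballI allI impI)
    fix J assume J: "J \<in> vertices D"
    from split[OF J] show "i c J \<in> state_space D J"
    proof
      assume "\<exists>I \<in> vertices D\<^sub>1. J = I(x := 1)"
      then obtain I where I: "I \<in> vertices D\<^sub>1" "J = I(x := 1)" by blast
      show ?thesis
        unfolding I(2) i_ext[OF I(1)] st1 by (rule \<Phi>1(2)[OF K\<^sub>1.chains_state[OF c I(1)]])
    qed (simp add: i_zero)
  qed (simp add: i_def)
  have p_in: "p c \<in> chains D\<^sub>0" if c: "c \<in> chains D" for c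
    unfolding chains_def
  proof (intro CollectI conjI ballI allI impI)
    fix I assume I: "I \<in> vertices D\<^sub>0"
    have "c (I(x := 0)) \<in> state_space D\<^sub>0 I"
      using K.chains_state[OF c vert0(1)[OF I]] unfolding st0 .
    then show "p c I \<in> state_space D\<^sub>0 I" using I \<Phi>0(2) by (simp add: p_def)
  qed (simp add: p_def)
  have i_d: "i (K\<^sub>1.dif c) = K.dif (i c)" if c: "c \<in> chains D\<^sub>1" for c
  proof
    fix J
    show "i (K\<^sub>1.dif c) J = K.dif (i c) J"
    proof (cases "J \<in> vertices D")
      case True
      note J = this
      from split[OF J] show ?thesis
      proof
        \<comment> \<open>Edges into \<open>J\<close> start at vertices whose entry at
          \<open>x\<close> is 0 as well, and there \<open>i c\<close> vanishes.\<close>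
        assume "J x = 0"
        then have "K.signed_map (J(y := 0), y) (i c (J(y := 0))) = 0"
          if "y \<in> crossings D" "J y = 1" for y
          using that J K.signed_map_zero[OF K.down_edge(1)[OF J that]] i_zero[of "J(y := 0)"] by simp
        then show ?thesis using \<open>J x = 0\<close> by (simp add: K.differential_signed[OF J] i_zero)
      next
        assume "\<exists>I \<in> vertices D\<^sub>1. J = I(x := 1)"
        then obtain I where I: "I \<in> vertices D\<^sub>1" "J = I(x := 1)" by blast
        \<comment> \<open>Besides the edges within the facet, only the edge in direction
          \<open>x\<close> ends at \<open>J\<close>, and it starts outside the support of
          \<open>i c\<close>.\<close>
        have ones: "{y. y \<in> crossings D \<and> J y = 1} = insert x {y. y \<in> crossings D\<^sub>1 \<and> I y = 1}"
          using assms(2) unfolding cr1 I(2) by auto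
        have fin: "finite {y. y \<in> crossings D\<^sub>1 \<and> I y = 1}" "x \<notin> {y. y \<in> crossings D\<^sub>1 \<and> I y = 1}"
          using K\<^sub>1.finite_ones cr1 by auto
        have Jx: "J x = 1" using I(2) by simp
        have "K.signed_map (J(x := 0), x) (i c (J(x := 0))) = 0"
          using K.signed_map_zero[OF K.down_edge(1)[OF J assms(2) Jx]] i_zero[of "J(x := 0)"] by simp
        then have "K.dif (i c) J = (\<Sum>y | y \<in> crossings D\<^sub>1 \<and> I y = 1. K.signed_map (J(y := 0), y) (i c (J(y := 0))))"
          unfolding K.differential_signed[OF J] ones sum.insert[OF fin] by simp
        also have "\<dots> = (\<Sum>y | y \<in> crossings D\<^sub>1 \<and> I y = 1. \<Phi>\<^sub>1 I (K\<^sub>1.signed_map (I(y := 0), y) (c (I(y := 0)))))"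
        proof (rule sum.cong[OF refl])
          fix y assume "y \<in> {y. y \<in> crossings D\<^sub>1 \<and> I y = 1}"
          then have y: "y \<in> crossings D\<^sub>1" "I y = 1" "y \<noteq> x" using cr1 by auto
          note e = K\<^sub>1.down_edge[OF I(1) y(1,2)]
          have J': "J(y := 0) = (I(y := 0))(x := 1)" using y(3) I(2) by (simp add: fun_upd_twist)
          show "K.signed_map (J(y := 0), y) (i c (J(y := 0))) = \<Phi>\<^sub>1 I (K\<^sub>1.signed_map (I(y := 0), y) (c (I(y := 0))))"
            unfolding J' i_ext[OF e(2)] sg1[OF y(3), symmetric]
            using \<Phi>1s[OF e(1) K\<^sub>1.chains_state[OF c e(2)]] unfolding e(3) .
        qed
        also have "\<dots> = \<Phi>\<^sub>1 I (K\<^sub>1.dif c I)"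
          unfolding K\<^sub>1.differential_signed[OF I(1)] by (rule additive_sum[symmetric]) (rule \<Phi>1(1))
        also have "\<dots> = i (K\<^sub>1.dif c) J" unfolding I(2) i_ext[OF I(1)] ..
        finally show ?thesis by simp
      qed
    next
      case False
      then show ?thesis using K.differential_in i_in[OF c] by (simp add: i_def chains_def)
    qed
  qed
  have p_d: "p (K.dif c) = K\<^sub>0.dif (p c)" if c: "c \<in> chains D" for c
  proof
    fix I
    show "p (K.dif c) I = K\<^sub>0.dif (p c) I"
    proof (cases "I \<in> vertices D\<^sub>0")
      case True
      note I = this
      \<comment> \<open>No edge in direction \<open>x\<close> ends at a vertex with entry 0, so
        restriction loses no terms.\<close>
      have ones: "{y. y \<in> crossings D \<and> (I(x := 0)) y = 1} = {y. y \<in> crossings D\<^sub>0 \<and> I y = 1}"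
        unfolding cr0 by auto
      have "p (K.dif c) I = \<Phi>\<^sub>0 I (K.dif c (I(x := 0)))" using I by (simp add: p_def)
      also have "\<dots> = (\<Sum>y | y \<in> crossings D\<^sub>0 \<and> I y = 1.
          \<Phi>\<^sub>0 I (K.signed_map ((I(x := 0))(y := 0), y) (c ((I(x := 0))(y := 0)))))"
        unfolding K.differential_signed[OF vert0(1)[OF I]] ones by (rule additive_sum) (rule \<Phi>0(1))
      also have "\<dots> = (\<Sum>y | y \<in> crossings D\<^sub>0 \<and> I y = 1. K\<^sub>0.signed_map (I(y := 0), y) (p c (I(y := 0))))"
      proof (rule sum.cong[OF refl])
        fix y assume "y \<in> {y. y \<in> crossings D\<^sub>0 \<and> I y = 1}"
        then have y: "y \<in> crossings D\<^sub>0" "I y = 1" "y \<noteq> x" using cr0 by auto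
        note e = K\<^sub>0.down_edge[OF I y(1,2)]
        have J': "(I(x := 0))(y := 0) = (I(y := 0))(x := 0)" using y(3) by (simp add: fun_upd_twist)
        have v: "c ((I(y := 0))(x := 0)) \<in> state_space D\<^sub>0 (I(y := 0))"
          using K.chains_state[OF c vert0(1)[OF e(2)]] unfolding st0 .
        have "p c (I(y := 0)) = \<Phi>\<^sub>0 (I(y := 0)) (c ((I(y := 0))(x := 0)))" using e(2) by (simp add: p_def)
        then show "\<Phi>\<^sub>0 I (K.signed_map ((I(x := 0))(y := 0), y) (c ((I(x := 0))(y := 0)))) =
            K\<^sub>0.signed_map (I(y := 0), y) (p c (I(y := 0)))"
          unfolding J' sg0[OF y(3), symmetric] using \<Phi>0s[OF e(1) v] unfolding e(3) by simp
      qed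
      also have "\<dots> = K\<^sub>0.dif (p c) I" unfolding K\<^sub>0.differential_signed[OF I] ..
      finally show ?thesis .
    next
      case False
      then show ?thesis using K\<^sub>0.differential_in[OF p_in[OF c]] by (simp add: p_def chains_def)
    qed
  qed
  interpret A\<^sub>1: additive_complex "chains D\<^sub>1" K\<^sub>1.dif by (rule K\<^sub>1.chains_complex)
  interpret A: additive_complex "chains D" K.dif by (rule K.chains_complex)
  interpret A\<^sub>0: additive_complex "chains D\<^sub>0" K\<^sub>0.dif by (rule K\<^sub>0.chains_complex)
  interpret i: additive_chain_map "chains D\<^sub>1" K\<^sub>1.dif "chains D" K.dif i
    by standard (use i_in i_d \<Phi>1(1) in \<open>auto simp: i_def fun_eq_iff\<close>)
  interpret p: additive_chain_map "chains D" K.dif "chains D\<^sub>0" K\<^sub>0.dif p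
    by standard (use p_in p_d \<Phi>0(1) in \<open>auto simp: p_def fun_eq_iff\<close>)
  have i_surj: "c \<in> i ` chains D\<^sub>1" if c: "c \<in> chains D" and pc: "p c = 0" for c
  proof -
    define c' where "c' = (\<lambda>I. if I \<in> vertices D\<^sub>1 then \<Psi>\<^sub>1 I (c (I(x := 1))) else 0)"
    have v: "c (I(x := 1)) \<in> state_space D\<^sub>1 I" if "I \<in> vertices D\<^sub>1" for I
      using K.chains_state[OF c vert1(1)[OF that]] unfolding st1 .
    have "c' \<in> chains D\<^sub>1" unfolding chains_def using v \<Phi>1(3) by (simp add: c'_def)
    moreover have "i c' = c"
    proof
      fix J
      show "i c' J = c J"
      proof (cases "J \<in> vertices D")
        case True
        then show ?thesis
        proof (cases "J x = 0")
          case x0: True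
          define I where "I = J(x := undefined)"
          have I: "I \<in> vertices D\<^sub>0" "J = I(x := 0)" using vert0(2)[OF True] x0 by (auto simp: I_def)
          have v0: "c J \<in> state_space D\<^sub>0 I" using K.chains_state[OF c True] unfolding I(2) st0 .
          \<comment> \<open>\<open>\<Phi>\<^sub>0 I\<close> is injective on the state space, so a
            chain in the kernel of \<open>p\<close> vanishes wherever the entry at \<open>x\<close>
            is 0.\<close>
          have "\<Phi>\<^sub>0 I (c J) = 0" using fun_cong[OF pc, of I] I by (simp add: p_def)
          then have "c J = \<Psi>\<^sub>0 I 0" using \<Phi>0(5)[OF v0] by simp
          also have "\<dots> = 0" using \<Phi>0(5)[of 0 I] z0 by simp
          finally show ?thesis using i_zero[of J c'] x0 by simp
        next
          case False
          with split[OF True] have "\<exists>I \<in> vertices D\<^sub>1. J = I(x := 1)" by simp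
          then obtain I where I: "I \<in> vertices D\<^sub>1" "J = I(x := 1)" by blast
          show ?thesis
            unfolding I(2) i_ext[OF I(1)] using \<Phi>1(4)[OF v[OF I(1)]] I(1) by (simp add: c'_def)
        qed
      next
        case False
        then show ?thesis using c by (simp add: i_def chains_def)
      qed
    qed
    ultimately show ?thesis by blast
  qed
  have "short_exact (chains D\<^sub>1) K\<^sub>1.dif (chains D) K.dif i (chains D\<^sub>0) K\<^sub>0.dif p"
  proof unfold_locales
    show "inj_on i (chains D\<^sub>1)"
    proof (rule inj_onI)
      fix c c' assume c: "c \<in> chains D\<^sub>1" "c' \<in> chains D\<^sub>1" "i c = i c'"
      show "c = c'"
      proof
        fix I
        show "c I = c' I"
        proof (cases "I \<in> vertices D\<^sub>1")
          case True
          then have "\<Phi>\<^sub>1 I (c I) = \<Phi>\<^sub>1 I (c' I)" using i_ext c(3) by metis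
          then show ?thesis
            using \<Phi>1(5) K\<^sub>1.chains_state[OF c(1) True] K\<^sub>1.chains_state[OF c(2) True] by metis
        next
          case False
          then show ?thesis using c by (simp add: chains_def)
        qed
      qed
    qed
    show "p ` chains D = chains D\<^sub>0"
    proof
      show "p ` chains D \<subseteq> chains D\<^sub>0" using p_in by blast
      show "chains D\<^sub>0 \<subseteq> p ` chains D"
      proof
        fix z assume z: "z \<in> chains D\<^sub>0"
        \<comment> \<open>Extension by zero over the other facet. Its failure to commute with the
          differentials is what the connecting map measures.\<close>
        define c where "c = (\<lambda>J. if J \<in> vertices D \<and> J x = 0
          then \<Psi>\<^sub>0 (J(x := undefined)) (z (J(x := undefined))) else 0)"
        have ce: "c (I(x := 0)) = \<Psi>\<^sub>0 I (z I)" if "I \<in> vertices D\<^sub>0" for I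
          using vert0(1)[OF that] re0[OF that] by (simp add: c_def)
        have "c J \<in> state_space D J" if J: "J \<in> vertices D" for J
        proof (cases "J x = 0")
          case True
          define I where "I = J(x := undefined)"
          have I: "I \<in> vertices D\<^sub>0" "J = I(x := 0)" using vert0(2)[OF J] True by (auto simp: I_def)
          show ?thesis
            unfolding I(2) ce[OF I(1)] st0 by (rule \<Phi>0(3)[OF K\<^sub>0.chains_state[OF z I(1)]])
        qed (simp add: c_def)
        then have "c \<in> chains D" by (simp add: chains_def c_def)
        moreover have "p c = z"
        proof
          fix I
          show "p c I = z I"
            using ce[of I] \<Phi>0(4) K\<^sub>0.chains_state[OF z, of I] z by (cases "I \<in> vertices D\<^sub>0") (simp_all add: p_def chains_def)
        qed
        ultimately show "z \<in> p ` chains D" by blast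
      qed
    qed
    show "p c = 0 \<longleftrightarrow> c \<in> i ` chains D\<^sub>1" if c: "c \<in> chains D" for c
    proof
      assume "c \<in> i ` chains D\<^sub>1"
      then obtain c' where "c = i c'" by blast
      then show "p c = 0" using i_zero z0 by (simp add: p_def fun_eq_iff)
    qed (rule i_surj[OF c])
  qed
  from long_exact_sequence[OF this] show ?thesis
    unfolding odd_khovanov_def chain_group_eq Let_def using i.chain_map p.chain_map by blast
qed

end
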